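(* To every foliation $\mathcal{F}$ on $\mathbb{P}^2$ of degree at least $3$ admitting a continuous group of automorphisms one can associate a non-constant morphism $\widehat{\mathcal{G}}:\mathbb{P}^1\to\mathbb{P}^1$ such that $\mathrm{Deck}(\mathcal{G})\simeq\mathrm{Deck}(\widehat{\mathcal{G}})$, where $\mathcal{G}$ is the Gauss map of $\mathcal{F}$. In particular, $\mathcal{F}$ is Galois if and only if $\widehat{\mathcal{G}}$ is Galois.
   Context: Everything is over $\mathbb{C}$. A foliation $\mathcal{F}$ on $\mathbb{P}^2$ is given in an affine chart by a polynomial vector field with coprime coefficients; its degree $d$ is the number of tangencies with a generic line. The Gauss map $\mathcal{G}:\mathbb{P}^2\dashrightarrow\check{\mathbb{P}}^2$ sends a non-singular point $p$ to the line tangent to $\mathcal{F}$ at $p$; for $d\ge1$ it is dominant of topological degree $d$. $\mathcal{F}$ admits a continuous group of automorphisms if the group $\mathrm{Aut}(\mathcal{F})\subset\mathrm{PSL}_3(\mathbb{C})$ of projective transformations preserving $\mathcal{F}$ has non-trivial Lie algebra. For a dominant rational map $f:X\dashrightarrow Y$ between connected projective manifolds of the same dimension, $\mathrm{Deck}(f)=\{\phi\in\mathrm{Bir}(X)\mid f\circ\phi=f\}$, and $f$ is Galois if the field extension $f^*:\mathbb{C}(Y)\hookrightarrow\mathbb{C}(X)$ is Galois; $\mathcal{F}$ is Galois if $\mathcal{G}$ is. *)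

theory Defs
  imports
    "HOL-Analysis.Analysis"
    "HOL-Computational_Algebra.Computational_Algebra"
    "HOL-Computational_Algebra.Field_as_Ring"
    "HOL-Algebra.Group"
begin

section \<open>Galois field extensions\<close>

text \<open>
  The extensions considered here have as upper field a whole type \<open>'k\<close> and as lower field a
  subset \<open>k\<close> of it.
\<close>

definition polys_over :: "'k::field set \<Rightarrow> 'k poly set" where
  "polys_over k = {p. \<forall>i. coeff p i \<in> k}"

definition irreducible_over :: "'k::field set \<Rightarrow> 'k poly \<Rightarrow> bool" where
  "irreducible_over k p \<longleftrightarrow> p \<in> polys_over k \<and> degree p > 0 \<and>
     (\<forall>q\<in>polys_over k. \<forall>r\<in>polys_over k. p = q * r \<longrightarrow> degree q = 0 \<or> degree r = 0)"

definition algebraic_ext :: "'k::field set \<Rightarrow> bool" where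
  "algebraic_ext k \<longleftrightarrow> (\<forall>x. \<exists>p\<in>polys_over k. p \<noteq> 0 \<and> poly p x = 0)"

definition normal_ext :: "'k::field set \<Rightarrow> bool" where
  "normal_ext k \<longleftrightarrow> algebraic_ext k \<and>
     (\<forall>p. irreducible_over k p \<and> (\<exists>x. poly p x = 0) \<longrightarrow>
        (\<exists>c xs. p = smult c (\<Prod>x\<leftarrow>xs. [:-x, 1:])))"

definition separable_ext :: "'k::field set \<Rightarrow> bool" where
  "separable_ext k \<longleftrightarrow> algebraic_ext k \<and>
     (\<forall>p. irreducible_over k p \<and> (\<exists>x. poly p x = 0) \<longrightarrow> coprime p (pderiv p))"

definition galois_ext :: "'k::field set \<Rightarrow> bool" where
  "galois_ext k \<longleftrightarrow> normal_ext k \<and> separable_ext k"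


section \<open>Rational maps between projective spaces\<close>

text \<open>
  A rational map from a variety with function field \<open>K\<close> to projective space is a tuple of
  homogeneous coordinates in \<open>K\<close>, not all zero, up to a common nonzero factor in \<open>K\<close>,
  that is, a \<open>K\<close>-valued point of projective space. It is represented by its proportionality class.
\<close>

definition proj_class :: "'k::field ^ 'm \<Rightarrow> ('k ^ 'm) set" where
  "proj_class v = {c *s v | c. c \<noteq> 0}"

text \<open>
  The locale treats rational self-maps of a projective space \<open>X\<close> and rational maps out of it. The
  type \<open>'r\<close> is the coordinate ring of the affine chart in which the last homogeneous coordinate
  is \<open>1\<close>, so \<open>'r fract\<close> is the function field of \<open>X\<close>; \<open>gen\<close> is the tuple of homogeneous
  coordinates of the identity map, and \<open>ev w p\<close> is the polynomial \<open>p\<close> evaluated at the affine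
  coordinates (in the same chart) of the map with homogeneous coordinates \<open>w\<close>.
\<close>

locale proj_space =
  fixes ev :: "('r::{factorial_ring_gcd,semiring_gcd_mult_normalize}) fract ^ 'n \<Rightarrow> 'r \<Rightarrow> 'r fract"
    and gen :: "'r fract ^ 'n"
begin

text \<open>
  The image of \<open>w\<close> is Zariski dense iff no nonzero polynomial vanishes on it. (An image
  contained in the hyperplane at infinity is excluded as well: division by zero then sends
  the affine coordinates to \<open>0\<close>.)
\<close>
definition dominant :: "'r fract ^ 'n \<Rightarrow> bool" where
  "dominant w \<longleftrightarrow> w \<noteq> 0 \<and> (\<forall>p. p \<noteq> 0 \<longrightarrow> ev w p \<noteq> 0)"

text \<open>The embedding of function fields \<open>h \<mapsto> h \<circ> w\<close>, meaningful for dominant \<open>w\<close>.\<close>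
definition pullback :: "'r fract ^ 'n \<Rightarrow> 'r fract \<Rightarrow> 'r fract" where
  "pullback w h = (case quot_of_fract h of (p, q) \<Rightarrow> ev w p / ev w q)"

text \<open>The composition \<open>S \<circ> T\<close> (first the self-map \<open>T\<close>, then \<open>S\<close>), meaningful for dominant \<open>T\<close>.\<close>
definition rat_comp :: "('r fract ^ 'm) set \<Rightarrow> ('r fract ^ 'n) set \<Rightarrow> ('r fract ^ 'm) set" where
  "rat_comp S T = (\<Union>v\<in>S. \<Union>w\<in>T. proj_class (\<chi> i. pullback w (v $ i)))"

definition dominant_maps :: "('r fract ^ 'n) set set" where
  "dominant_maps = {proj_class w | w. dominant w}"

definition Bir :: "('r fract ^ 'n) set set" where
  "Bir = {\<phi> \<in> dominant_maps. \<exists>\<psi>\<in>dominant_maps.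
            rat_comp \<phi> \<psi> = proj_class gen \<and> rat_comp \<psi> \<phi> = proj_class gen}"

definition Deck :: "('r fract ^ 'm) set \<Rightarrow> ('r fract ^ 'n) set monoid" where
  "Deck f = \<lparr>carrier = {\<phi> \<in> Bir. rat_comp f \<phi> = f}, mult = rat_comp, one = proj_class gen\<rparr>"

text \<open>For a dominant rational map \<open>f\<close> from \<open>X\<close> to a projective space of the same dimension.\<close>
definition galois_map :: "('r fract ^ 'n) set \<Rightarrow> bool" where
  "galois_map f \<longleftrightarrow> galois_ext {pullback w h | w h. w \<in> f}"

end

definition ev1 :: "complex poly fract ^ 2 \<Rightarrow> complex poly \<Rightarrow> complex poly fract" where
  "ev1 w p = poly (map_poly (\<lambda>c. to_fract [:c:]) p) (w $ 1 / w $ 2)"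

definition gen1 :: "complex poly fract ^ 2" where
  "gen1 = vector [to_fract [:0, 1:], 1]"

interpretation P1: proj_space ev1 gen1 .

text \<open>
  In \<open>complex poly poly\<close> the inner variable is \<open>x\<close> and the outer one is \<open>y\<close>.
\<close>

definition ev2 :: "complex poly poly fract ^ 3 \<Rightarrow> complex poly poly \<Rightarrow> complex poly poly fract" where
  "ev2 w p = poly (map_poly (\<lambda>q. poly (map_poly (\<lambda>c. to_fract [:[:c:]:]) q) (w $ 1 / w $ 3)) p)
               (w $ 2 / w $ 3)"

abbreviation (input) polyX :: "complex poly poly" where "polyX \<equiv> [:[:0, 1:]:]"
abbreviation (input) polyY :: "complex poly poly" where "polyY \<equiv> [:0, 1:]"

definition gen2 :: "complex poly poly fract ^ 3" where
  "gen2 = vector [to_fract polyX, to_fract polyY, 1]"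

interpretation P2: proj_space ev2 gen2 .

text \<open>
  Coprime \<open>p\<close>, \<open>q\<close> give a map \<open>[p : q]\<close> that is regular on the affine line, and also at infinity, as
  one sees after division by \<open>t ^ max (degree p) (degree q)\<close>.
\<close>
definition nonconstant_morphism_P1 :: "(complex poly fract ^ 2) set \<Rightarrow> bool" where
  "nonconstant_morphism_P1 f \<longleftrightarrow> (\<exists>p q :: complex poly. coprime p q \<and>
     \<not> (degree p = 0 \<and> degree q = 0) \<and> f = proj_class (vector [to_fract p, to_fract q]))"


section \<open>Foliations on the projective plane\<close>

text \<open>
  A foliation is given by coprime \<open>P\<close>, \<open>Q\<close>, standing for the vector field \<open>P \<partial>/\<partial>x + Q \<partial>/\<partial>y\<close> in the
  chart \<open>(x, y) \<mapsto> [x : y : 1]\<close>.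
\<close>

definition eval2 :: "complex poly poly \<Rightarrow> complex \<Rightarrow> complex \<Rightarrow> complex" where
  "eval2 p a b = poly (poly p [:b:]) a"

definition nonsingular :: "complex poly poly \<Rightarrow> complex poly poly \<Rightarrow> complex \<Rightarrow> complex \<Rightarrow> bool" where
  "nonsingular P Q a b \<longleftrightarrow> \<not> (eval2 P a b = 0 \<and> eval2 Q a b = 0)"

text \<open>
  The line through \<open>[a : b : 1]\<close> in the direction of the vector field, as a plane
  in \<open>\<complex>\<^sup>3\<close> (for nonsingular \<open>(a, b)\<close>).
\<close>
definition tangent_line ::
    "complex poly poly \<Rightarrow> complex poly poly \<Rightarrow> complex \<Rightarrow> complex \<Rightarrow> (complex ^ 3) set" where
  "tangent_line P Q a b =
     {s *s vector [a, b, 1] + t *s vector [eval2 P a b, eval2 Q a b, 0] | s t. True}"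

text \<open>
  The dual plane carries the homogeneous coordinates \<open>[u\<^sub>1 : u\<^sub>2 : u\<^sub>3]\<close> of the line
  \<open>u\<^sub>1 z\<^sub>1 + u\<^sub>2 z\<^sub>2 + u\<^sub>3 z\<^sub>3 = 0\<close>. The coordinates of the Gauss map are those of the cross product
  of \<open>(x, y, 1)\<close> and \<open>(P, Q, 0)\<close>; see \<open>tangent_line_eq\<close> below.
\<close>
definition gauss_map ::
    "complex poly poly \<Rightarrow> complex poly poly \<Rightarrow> (complex poly poly fract ^ 3) set" where
  "gauss_map P Q = proj_class (vector [to_fract (- Q), to_fract P, to_fract (polyX * Q - polyY * P)])"

lemma tangent_line_eq:
  assumes "nonsingular P Q a b"
  shows "tangent_line P Q a b =
    {v. eval2 (- Q) a b * v $ 1 + eval2 P a b * v $ 2 + eval2 (polyX * Q - polyY * P) a b * v $ 3 = 0}"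
    (is "?L = ?R")
proof
  show "?L \<subseteq> ?R"
    by (auto simp: tangent_line_def eval2_def algebra_simps)
  show "?R \<subseteq> ?L"
  proof
    fix v assume "v \<in> ?R"
    define p q where "p = eval2 P a b" and "q = eval2 Q a b"
    have *: "p * (v $ 2 - b * v $ 3) = q * (v $ 1 - a * v $ 3)"
      using \<open>v \<in> ?R\<close> by (simp add: p_def q_def eval2_def algebra_simps)
    have "p \<noteq> 0 \<or> q \<noteq> 0"
      using assms by (auto simp: nonsingular_def p_def q_def)
    then have "\<exists>t. t * p = v $ 1 - a * v $ 3 \<and> t * q = v $ 2 - b * v $ 3"
    proof
      assume "p \<noteq> 0"
      with * show ?thesis
        by (intro exI[of _ "(v $ 1 - a * v $ 3) / p"]) (simp add: field_simps)
    next
      assume "q \<noteq> 0"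
      with * show ?thesis
        by (intro exI[of _ "(v $ 2 - b * v $ 3) / q"]) (simp add: field_simps)
    qed
    then obtain t where "t * p = v $ 1 - a * v $ 3" "t * q = v $ 2 - b * v $ 3"
      by blast
    then have "v = v $ 3 *s vector [a, b, 1] + t *s vector [p, q, 0]"
      by (simp add: vec_eq_iff forall_3 algebra_simps)
    then show "v \<in> ?L"
      unfolding tangent_line_def p_def q_def by blast
  qed
qed

text \<open>
  The number of tangencies with a generic line is \<open>d\<close>. The lines \<open>y = m x + k\<close> form a Zariski
  dense open subset of the dual plane, and \<open>H \<noteq> 0\<close> cuts out a nonempty Zariski open set of them.
  The tangency points are sought in the affine chart only: the tangent lines at the points
  at infinity fill at most a curve in the dual plane, so a generic line has no tangency there.
\<close>
definition foliation_degree :: "complex poly poly \<Rightarrow> complex poly poly \<Rightarrow> nat \<Rightarrow> bool" where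
  "foliation_degree P Q d \<longleftrightarrow> (\<exists>H :: complex poly poly. H \<noteq> 0 \<and>
     (\<forall>m k. eval2 H m k \<noteq> 0 \<longrightarrow>
        (let T = {(a, b). b = m * a + k \<and> eval2 Q a b = m * eval2 P a b}
         in finite T \<and> card T = d)))"

text \<open>
  The projective transformation of \<open>M\<close> preserves the foliation iff it carries tangent lines at
  nonsingular points to tangent lines. Points which \<open>M\<close> moves to infinity are omitted; the
  condition on the remaining dense set is equivalent.
\<close>
definition preserves_foliation ::
    "complex ^ 3 ^ 3 \<Rightarrow> complex poly poly \<Rightarrow> complex poly poly \<Rightarrow> bool" where
  "preserves_foliation M P Q \<longleftrightarrow>
     (\<forall>a b a' b' c. nonsingular P Q a b \<and> nonsingular P Q a' b' \<and> c \<noteq> 0 \<and>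
        M *v vector [a, b, 1] = c *s vector [a', b', 1] \<longrightarrow>
        (\<lambda>v. M *v v) ` tangent_line P Q a b = tangent_line P Q a' b')"

text \<open>
  The preimage in \<open>SL\<^sub>3(\<complex>)\<close> of the automorphism group in \<open>PSL\<^sub>3(\<complex>)\<close>. The kernel of the projection is
  finite, so both groups have the same Lie algebra.
\<close>
definition Aut_SL :: "complex poly poly \<Rightarrow> complex poly poly \<Rightarrow> (complex ^ 3 ^ 3) set" where
  "Aut_SL P Q = {M. det M = 1 \<and> preserves_foliation M P Q}"

definition matrix_exp :: "complex ^ 'n ^ 'n \<Rightarrow> complex ^ 'n ^ 'n" where
  "matrix_exp A = (\<Sum>n. (1 / fact n) *\<^sub>R (((**) A ^^ n) (mat 1)))"

text \<open>The Lie algebra of a closed group \<open>H\<close> of matrices.\<close>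
definition lie_algebra :: "(complex ^ 'n ^ 'n) set \<Rightarrow> (complex ^ 'n ^ 'n) set" where
  "lie_algebra H = {A. \<forall>t::real. matrix_exp (t *\<^sub>R A) \<in> H}"

definition has_continuous_automorphisms :: "complex poly poly \<Rightarrow> complex poly poly \<Rightarrow> bool" where
  "has_continuous_automorphisms P Q \<longleftrightarrow> (\<exists>A \<in> lie_algebra (Aut_SL P Q). A \<noteq> 0)"

end

theory Submission
  imports Defs "Jordan_Normal_Form.Jordan_Normal_Form_Existence"
begin

text \<open>Write \<open>K = C(x,y)\<close> for the function field of the plane. A dominant rational self-map is the same thing as
an endomorphism of the function field over the complex numbers, its pullback, and composition is reversed. So the deck
group of a dominant map \<open>f\<close> is the group of automorphisms of the function field that fix the range
\<open>L\<close> of the pullback of \<open>f\<close>, and \<open>f\<close> is Galois exactly if the function field is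
a Galois extension of \<open>L\<close> (\<open>Deck_iso_Gal_group\<close> and \<open>galois_map_iff\<close>, for the
line and the plane at once). The theorem thus becomes a statement about the subfield \<open>L\<close> of
\<open>K\<close> that is generated by the affine coordinates of the Gauss map: it suffices to find generators
\<open>t, s\<close> of \<open>K\<close> and a non-constant rational function \<open>G\<close> such that \<open>L =
C(G(t), s)\<close>. The morphism of the line is then \<open>G\<close>.

That this suffices is pure algebra. Since \<open>C(t)\<close> is algebraically closed in \<open>C(t,s)\<close>, every
automorphism of \<open>C(t,s)\<close> over \<open>C(G(t), s)\<close> preserves \<open>C(t)\<close>, so restriction and
extension identify the two automorphism groups (\<open>Gal_group_extend\<close>). The same fact and an orbit
polynomial argument show that one extension is normal exactly if the other is (\<open>galois_ext_extend\<close>);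
separability is automatic in characteristic zero.

The generators come from the symmetry. Let \<open>A\<close> be a non-zero element of the Lie algebra, \<open>D\<close>
the derivation of \<open>K\<close> given by the linear vector field \<open>A\<close>, and \<open>N = (-Q, P, xQ -
yP)\<close> the coefficients of the tangent line. Differentiating the invariance of the tangent lines under \<open>exp
(t A)\<close> at \<open>t = 0\<close> shows that \<open>D N + A\<^sup>T N\<close> is a multiple of \<open>N\<close>
(\<open>invariance_polynomial\<close>). Put \<open>A\<close> into Jordan normal form \<open>J\<close> by a linear
change \<open>z\<close> of the homogeneous coordinates, with dual coordinates \<open>m\<close> of the tangent line. Up
to multiples of \<open>z\<close> and \<open>m\<close>, \<open>D\<close> acts on \<open>z\<close> as \<open>J\<close>
and on \<open>m\<close> as \<open>- J\<^sup>T\<close>, and \<open>z \<bullet> m = 0\<close> because the point lies on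
its tangent line (\<open>adapted_frame\<close>). In affine coordinates, \<open>D\<close> is diagonal or affine, and
the Gauss map is an endomorphism that intertwines \<open>D\<close> with the dual field. A combination of the
coordinates of the point and of its image is \<open>D\<close>-invariant, for example \<open>z\<^sub>1 m\<^sub>1 /
(z\<^sub>3 m\<^sub>3)\<close> in the diagonal case.

The invariants of \<open>D\<close> can be listed, because numerator and denominator of an invariant fraction are
eigenvectors of \<open>D\<close> with the same constant eigenvalue (\<open>invariant_fraction\<close>). If
\<open>D\<close> has only constant invariants, the relation \<open>z \<bullet> m = 0\<close> expresses the point
rationally through its tangent line, so \<open>L = K\<close>. This is excluded by the degree: a generic line has at
least three, in particular two, tangency points, which are all mapped to that line, so the Gauss map is dominant but
not birational (\<open>gauss_dominant\<close>). In the other cases a monomial change of coordinates or the parabolic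
one \<open>x - y\<^sup>2/2\<close> makes the invariant field \<open>C(t)\<close>, and then \<open>L\<close> is
generated by some \<open>G(t)\<close> and some \<open>h(t) s + c(t)\<close>; the latter may replace \<open>s\<close>
as a generator (\<open>quotient_of_torus\<close>, \<open>quotient_of_J12\<close>, \<open>quotient_of_J3\<close>).\<close>

no_notation vec_index (infixl "$" 100)
no_notation fps_nth (infixl "$" 75)
hide_const (open) Matrix.vec Matrix.mat Module.smult List.transpose
hide_fact (open) Matrix.vec_eq_iff Matrix.mat_def

section \<open>Jordan normal forms of three by three matrices\<close>

text \<open>Jordan normal forms are taken of matrices of explicit dimension with indices from zero; this is the passage to
matrices indexed by a type.\<close>

definition of_mat3 :: "complex mat \<Rightarrow> complex ^ 3 ^ 3" where
  "of_mat3 M = vector [vector [M $$ (0,0), M $$ (0,1), M $$ (0,2)],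
                       vector [M $$ (1,0), M $$ (1,1), M $$ (1,2)],
                       vector [M $$ (2,0), M $$ (2,1), M $$ (2,2)]]"

lemma of_mat3_mult:
  assumes "M \<in> carrier_mat 3 3" "N \<in> carrier_mat 3 3"
  shows "of_mat3 (M * N) = of_mat3 M ** of_mat3 N"
proof -
  have 3: "{0..<3} = {0, 1, 2::nat}" by auto
  show ?thesis using assms
    by (simp add: of_mat3_def vec_eq_iff forall_3 matrix_matrix_mult_def sum_3 scalar_prod_def 3)
qed

lemma of_mat3_one: "of_mat3 (1\<^sub>m 3) = mat 1"
  by (simp add: of_mat3_def vec_eq_iff forall_3 mat_def)

lemma of_mat3_surj: "\<exists>M \<in> carrier_mat 3 3. A = of_mat3 M"
  by (rule bexI[of _ "Matrix.mat 3 3 (\<lambda>(i,j). A $ (if i = 0 then 1 else if i = 1 then 2 else 3) $ (if j = 0 then 1 else if j = 1 then 2 else 3))"])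
     (auto simp: of_mat3_def vec_eq_iff forall_3)

lemma pos_list_sum3:
  fixes xs :: "(nat \<times> 'a) list"
  assumes "0 \<notin> fst ` set xs" "sum_list (map fst xs) = 3"
  obtains a where "xs = [(3, a)]" | a b where "xs = [(2, a), (1, b)]" | a b where "xs = [(1, a), (2, b)]"
  | a b c where "xs = [(1, a), (1, b), (1, c)]"
proof -
  have nil: "sum_list (map fst ys) = 0 \<longleftrightarrow> ys = []" if "0 \<notin> fst ` set ys" for ys :: "(nat \<times> 'a) list"
    using that by (cases ys) auto
  obtain n a ys where xs: "xs = (n, a) # ys" using assms(2) by (cases xs) auto
  have n: "n > 0" "n + sum_list (map fst ys) = 3" "0 \<notin> fst ` set ys"
    using assms xs by auto
  show thesis
  proof (cases "n = 3")
    case True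
    then have "ys = []" using n nil[of ys] by auto
    then show ?thesis using that(1) xs True by auto
  next
    case False
    then have "sum_list (map fst ys) \<noteq> 0" using n by linarith
    then obtain m b zs where ys: "ys = (m, b) # zs" by (cases ys) auto
    have m: "m > 0" "n + m + sum_list (map fst zs) = 3" "0 \<notin> fst ` set zs" using n ys by auto
    show ?thesis
    proof (cases zs)
      case Nil
      then have "n = 1 \<and> m = 2 \<or> n = 2 \<and> m = 1" using m n(1) by auto
      then show ?thesis using that(2,3) xs ys Nil by blast
    next
      case (Cons c ws)
      obtain k d where c: "c = (k, d)" by (cases c)
      have k: "k > 0" "n + m + k + sum_list (map fst ws) = 3" "0 \<notin> fst ` set ws" using m Cons c by auto
      then have "sum_list (map fst ws) = 0" "n = 1" "m = 1" "k = 1" using n(1) m(1) by linarith+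
      moreover from this have "ws = []" using nil[OF k(3)] by blast
      ultimately have "n = 1" "m = 1" "k = 1" "ws = []" by blast+
      then show ?thesis using that(4) xs ys Cons c by auto
    qed
  qed
qed

definition similar3 :: "complex ^ 3 ^ 3 \<Rightarrow> complex ^ 3 ^ 3 \<Rightarrow> bool" where
  "similar3 A J \<longleftrightarrow> (\<exists>g h. g ** h = mat 1 \<and> h ** g = mat 1 \<and> A = h ** J ** g)"

text \<open>The blocks of the Jordan normal form have sizes that add up to three. In each of the listed shapes the last row is a
multiple of the last unit vector. So the third coordinate is an eigenvector of the linear vector field, and dividing
by it gives coordinates in which the field is affine.\<close>

lemma jordan_form3:
  fixes A :: "complex ^ 3 ^ 3"
  obtains a b c where "similar3 A (vector [vector [a, 0, 0], vector [0, b, 0], vector [0, 0, c]])"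
  | a b where "similar3 A (vector [vector [a, 0, 0], vector [0, b, 1], vector [0, 0, b]])"
  | a where "similar3 A (vector [vector [a, 1, 0], vector [0, a, 1], vector [0, 0, a]])"
proof -
  obtain M where M: "M \<in> carrier_mat 3 3" "A = of_mat3 M" using of_mat3_surj by blast
  obtain as where "char_poly M = (\<Prod>a\<leftarrow>as. [:- a, 1:])" using char_poly_factorized[OF M(1)] by blast
  then obtain xs where xs: "jordan_nf M xs" using jordan_nf_exists[OF M(1)] by blast
  then have "similar_mat M (jordan_matrix xs)" unfolding jordan_nf_def by blast
  then obtain n R S where RS: "{M, jordan_matrix xs, R, S} \<subseteq> carrier_mat n n"
    "R * S = 1\<^sub>m n" "S * R = 1\<^sub>m n" "M = R * jordan_matrix xs * S"
    using similar_matD by blast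
  have n: "n = 3" using M RS by auto
  have sum: "sum_list (map fst xs) = 3" using RS(1) n jordan_matrix_dim(1)[of xs] by auto
  have sim: "similar3 A (of_mat3 (jordan_matrix xs))"
  proof -
    have c: "R \<in> carrier_mat 3 3" "S \<in> carrier_mat 3 3" "jordan_matrix xs \<in> carrier_mat 3 3"
      using RS(1) n by auto
    have "of_mat3 S ** of_mat3 R = mat 1"
         "of_mat3 R ** of_mat3 S = mat 1"
      using of_mat3_mult[OF c(1,2)] of_mat3_mult[OF c(2,1)] RS(2,3) n of_mat3_one by auto
    moreover have "A = of_mat3 R ** of_mat3 (jordan_matrix xs) ** of_mat3 S"
      using of_mat3_mult[of "R * jordan_matrix xs" S] of_mat3_mult[OF c(1,3)] c M(2) RS(4) by auto
    ultimately show ?thesis unfolding similar3_def by blast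
  qed
  have "0 \<notin> fst ` set xs" using xs unfolding jordan_nf_def by blast
  from pos_list_sum3[OF this sum] show thesis
  proof cases
    case (1 a)
    then have "of_mat3 (jordan_matrix xs) = vector [vector [a, 1, 0], vector [0, a, 1], vector [0, 0, a]]"
      by (simp add: jordan_matrix_def of_mat3_def Let_def)
    then show ?thesis using sim that(3) by simp
  next
    case (2 a b)
    then have *: "of_mat3 (jordan_matrix xs) = vector [vector [a, 1, 0], vector [0, a, 0], vector [0, 0, b]]"
      by (simp add: jordan_matrix_def of_mat3_def Let_def)
    \<comment> \<open>A cyclic permutation of the basis moves the block of size one to the front.\<close>
    define C D :: "complex ^ 3 ^ 3" where
      "C = vector [vector [0, 0, 1], vector [1, 0, 0], vector [0, 1, 0]]"
      and "D = vector [vector [0, 1, 0], vector [0, 0, 1], vector [1, 0, 0]]"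
    define J :: "complex ^ 3 ^ 3" where "J = vector [vector [b, 0, 0], vector [0, a, 1], vector [0, 0, a]]"
    have CD: "C ** D = mat 1" "D ** C = mat 1"
      by (simp_all add: C_def D_def vec_eq_iff forall_3 matrix_matrix_mult_def sum_3 mat_def)
    have J: "of_mat3 (jordan_matrix xs) = D ** J ** C"
      unfolding * by (simp add: C_def D_def J_def vec_eq_iff forall_3 matrix_matrix_mult_def sum_3)
    obtain g h where gh: "g ** h = mat 1" "h ** g = mat 1" "A = h ** (D ** J ** C) ** g"
      using sim unfolding similar3_def J by blast
    have "(C ** g) ** (h ** D) = mat 1" "(h ** D) ** (C ** g) = mat 1"
      "A = (h ** D) ** J ** (C ** g)"
      using gh CD by (metis matrix_mul_assoc matrix_mul_rid)+
    then have "similar3 A J" unfolding similar3_def by blast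
    then show ?thesis using that(2) unfolding J_def by blast
  next
    case (3 a b)
    then have "of_mat3 (jordan_matrix xs) = vector [vector [a, 0, 0], vector [0, b, 1], vector [0, 0, b]]"
      by (simp add: jordan_matrix_def of_mat3_def Let_def)
    then show ?thesis using sim that(2) by simp
  next
    case (4 a b c)
    then have "of_mat3 (jordan_matrix xs) = vector [vector [a, 0, 0], vector [0, b, 0], vector [0, 0, c]]"
      by (simp add: jordan_matrix_def of_mat3_def Let_def)
    then show ?thesis using sim that(1) by simp
  qed
qed

section \<open>Rational self-maps and endomorphisms of the function field\<close>

text \<open>Homomorphisms of algebras over the complex numbers; \<open>k\<close> and \<open>l\<close> are the structure maps.\<close>

definition alg_hom :: "(complex \<Rightarrow> 'a::field) \<Rightarrow> (complex \<Rightarrow> 'b::field) \<Rightarrow> ('a \<Rightarrow> 'b) \<Rightarrow> bool" where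
  "alg_hom k l \<sigma> \<longleftrightarrow> field_hom \<sigma> \<and> (\<forall>c. \<sigma> (k c) = l c)"

lemma alg_homD: "alg_hom k l \<sigma> \<Longrightarrow> field_hom \<sigma>" "alg_hom k l \<sigma> \<Longrightarrow> \<sigma> (k c) = l c"
  by (auto simp: alg_hom_def)

lemma field_homI:
  assumes "\<And>a b. f (a + b) = f a + f b" "\<And>a b. f (a * b) = f a * f b" "f 1 = 1"
  shows "field_hom f"
proof
  have "f 0 + 0 = f 0 + f 0" using assms(1)[of 0 0] by (simp only: add_0_left add_0_right)
  then show "f 0 = 0" by (simp only: add_left_cancel)
qed (use assms in auto)

lemma field_hom_inj: "field_hom f \<Longrightarrow> inj f"
proof -
  assume "field_hom f"
  then interpret field_hom f .
  show "inj f"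
  proof (rule injI)
    fix x y assume "f x = f y"
    then have "f (x - y) = 0" by (simp add: hom_minus)
    moreover have "f (x - y) * f (inverse (x - y)) = 1" if "x \<noteq> y"
      using that by (simp add: hom_mult[symmetric])
    ultimately show "x = y" by auto
  qed
qed

lemma field_hom_eq_iff: "field_hom f \<Longrightarrow> f x = f y \<longleftrightarrow> x = y"
  using field_hom_inj by (auto dest: injD)

lemma field_hom_eq_0_iff: "field_hom f \<Longrightarrow> f x = 0 \<longleftrightarrow> x = 0"
proof -
  assume f: "field_hom f"
  then interpret field_hom f .
  show ?thesis using field_hom_eq_iff[OF f, of x 0] by simp
qed

lemma field_hom_id: "field_hom id" "field_hom (\<lambda>x. x)"
  by (rule field_homI; simp)+

lemma field_hom_comp: "field_hom f \<Longrightarrow> field_hom g \<Longrightarrow> field_hom (g \<circ> f)"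
proof -
  assume "field_hom f" "field_hom g"
  then interpret f: field_hom f + g: field_hom g .
  show ?thesis by (rule field_homI) (simp_all add: f.hom_add g.hom_add f.hom_mult g.hom_mult)
qed

lemma bij_inv_into_eq: "bij f \<Longrightarrow> inv_into UNIV f y = x \<longleftrightarrow> y = f x"
  using bij_inv_eq_iff[of f x y] by auto

lemma field_hom_inv: "field_hom f \<Longrightarrow> bij f \<Longrightarrow> field_hom (inv_into UNIV f)"
proof -
  assume f: "field_hom f" "bij f"
  then interpret f: field_hom f by simp
  note [simp] = bij_inv_into_eq[OF f(2)] surj_f_inv_f[OF bij_is_surj[OF f(2)]]
  show ?thesis by (rule field_homI) (simp_all add: f.hom_add f.hom_mult)
qed

lemma alg_hom_id: "alg_hom k k id"
  by (simp add: alg_hom_def field_hom_id)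

lemma alg_hom_comp: "alg_hom k l f \<Longrightarrow> alg_hom l m g \<Longrightarrow> alg_hom k m (g \<circ> f)"
  by (simp add: alg_hom_def field_hom_comp)

lemma alg_hom_inv: "alg_hom k l f \<Longrightarrow> bij f \<Longrightarrow> alg_hom l k (inv_into UNIV f)"
  by (auto simp: alg_hom_def field_hom_inv bij_inv_into_eq)

text \<open>Passing from maps to pullbacks reverses composition. The multiplication is therefore the opposite of the composition
of field automorphisms, so that it matches the composition of deck transformations.\<close>

definition Gal_group :: "(complex \<Rightarrow> 'k::field) \<Rightarrow> 'k set \<Rightarrow> ('k \<Rightarrow> 'k) monoid" where
  "Gal_group k M = \<lparr>carrier = {\<sigma>. alg_hom k k \<sigma> \<and> bij \<sigma> \<and> (\<forall>x\<in>M. \<sigma> x = x)},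
     mult = (\<lambda>\<sigma> \<tau>. \<tau> \<circ> \<sigma>), one = id\<rparr>"

lemma Gal_group_simps [simp]:
  "\<sigma> \<in> carrier (Gal_group k M) \<longleftrightarrow> alg_hom k k \<sigma> \<and> bij \<sigma> \<and> (\<forall>x\<in>M. \<sigma> x = x)"
  "mult (Gal_group k M) \<sigma> \<tau> = \<tau> \<circ> \<sigma>" "one (Gal_group k M) = id"
  by (simp_all add: Gal_group_def)

lemma group_Gal_group: "group (Gal_group k M)"
proof (rule groupI)
  fix \<sigma> assume s: "\<sigma> \<in> carrier (Gal_group k M)"
  then have "inv_into UNIV \<sigma> \<in> carrier (Gal_group k M)"
    by (auto simp: alg_hom_inv bij_imp_bij_inv bij_inv_into_eq)
  moreover have "\<sigma> \<circ> inv_into UNIV \<sigma> = id" using s by (simp add: fun_eq_iff surj_f_inv_f bij_is_surj)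
  ultimately show "\<exists>\<tau>\<in>carrier (Gal_group k M). mult (Gal_group k M) \<tau> \<sigma> = one (Gal_group k M)"
    by auto
qed (auto simp: alg_hom_comp alg_hom_id bij_comp o_assoc)

lemma proj_class_self: "v \<in> proj_class (v :: 'k::field ^ 'm)"
  unfolding proj_class_def by (rule CollectI, rule exI[of _ 1]) simp

lemma proj_class_eqI:
  assumes "v \<in> proj_class (w :: 'k::field ^ 'm)" shows "proj_class v = proj_class w"
proof -
  obtain c where c: "c \<noteq> 0" "v = c *s w" using assms unfolding proj_class_def by blast
  have "b *s w \<in> proj_class v" if "b \<noteq> 0" for b
    unfolding proj_class_def using that c by (auto intro!: exI[of _ "b / c"])
  moreover have "b *s v \<in> proj_class w" if "b \<noteq> 0" for b
    unfolding proj_class_def using that c by (auto intro!: exI[of _ "b * c"])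
  ultimately show ?thesis unfolding proj_class_def[of w] proj_class_def[of v] by (auto simp: proj_class_def)
qed

definition fract_lift :: "('r::{factorial_ring_gcd,semiring_gcd_mult_normalize} \<Rightarrow> 'k::field) \<Rightarrow> 'r fract \<Rightarrow> 'k" where
  "fract_lift \<rho> h = (case quot_of_fract h of (p, q) \<Rightarrow> \<rho> p / \<rho> q)"

lemma fract_as_quotient: obtains a b where "h = to_fract a / to_fract b" "b \<noteq> 0"
  by (cases h) (use that in \<open>auto simp: Fract_conv_to_fract\<close>)

text \<open>The universal property of a field of fractions. Lowest terms serve only to pick a value; the value does not depend on
the fraction because \<open>\<rho>\<close> respects cross multiplication and keeps denominators non-zero.\<close>

lemma fract_lift:
  fixes \<rho> :: "'r::{factorial_ring_gcd,semiring_gcd_mult_normalize} \<Rightarrow> 'k::field"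
  assumes "comm_ring_hom \<rho>" and nz: "\<And>p. p \<noteq> 0 \<Longrightarrow> \<rho> p \<noteq> 0"
  shows "b \<noteq> 0 \<Longrightarrow> fract_lift \<rho> (to_fract a / to_fract b) = \<rho> a / \<rho> b"
    and "fract_lift \<rho> (to_fract a) = \<rho> a" and "field_hom (fract_lift \<rho>)"
proof -
  interpret \<rho>: comm_ring_hom \<rho> by fact
  have frac: "fract_lift \<rho> (to_fract a / to_fract b) = \<rho> a / \<rho> b" if b: "b \<noteq> 0" for a b
  proof -
    define h where "h = to_fract a / to_fract b"
    obtain p q where pq: "quot_of_fract h = (p, q)" by (cases "quot_of_fract h")
    have q: "q \<noteq> 0" using snd_quot_of_fract_nonzero[of h] pq by simp
    have "h = to_fract p / to_fract q"
      using Fract_quot_of_fract[of h] pq by (simp add: Fract_conv_to_fract)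
    then have "to_fract (a * q) = to_fract (p * b)" unfolding h_def using q b by (simp add: frac_eq_eq)
    then have "a * q = p * b" by (simp only: to_fract_eq_iff)
    then have "\<rho> a * \<rho> q = \<rho> p * \<rho> b" by (metis \<rho>.hom_mult)
    then show ?thesis unfolding fract_lift_def h_def[symmetric] pq using nz b q by (simp add: frac_eq_eq)
  qed
  then show "b \<noteq> 0 \<Longrightarrow> fract_lift \<rho> (to_fract a / to_fract b) = \<rho> a / \<rho> b" .
  show whole: "fract_lift \<rho> (to_fract a) = \<rho> a" for a using frac[of 1 a] by simp
  show "field_hom (fract_lift \<rho>)"
  proof (rule field_homI)
    fix g h :: "'r fract"
    obtain a b :: 'r where g: "g = to_fract a / to_fract b" "b \<noteq> 0" by (rule fract_as_quotient)
    obtain c d :: 'r where h: "h = to_fract c / to_fract d" "d \<noteq> 0" by (rule fract_as_quotient)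
    have "g + h = to_fract (a * d + c * b) / to_fract (b * d)" "g * h = to_fract (a * c) / to_fract (b * d)"
      using g h by (simp_all add: add_frac_eq)
    then have "fract_lift \<rho> (g + h) = \<rho> (a * d + c * b) / \<rho> (b * d)" "fract_lift \<rho> (g * h) = \<rho> (a * c) / \<rho> (b * d)"
      using g(2) h(2) by (simp_all only: frac mult_eq_0_iff de_Morgan_disj not_False_eq_True)
    then show "fract_lift \<rho> (g + h) = fract_lift \<rho> g + fract_lift \<rho> h" "fract_lift \<rho> (g * h) = fract_lift \<rho> g * fract_lift \<rho> h"
      using g h nz by (simp_all add: frac \<rho>.hom_add \<rho>.hom_mult add_frac_eq)
  next
    show "fract_lift \<rho> 1 = 1" using whole[of 1] by (simp add: \<rho>.hom_one)
  qed
qed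

text \<open>What the line and the plane have in common. The element \<open>ev w p\<close> is the value of the polynomial
\<open>p\<close> at the affine coordinates of \<open>w\<close>, and \<open>gen\<close> is the generic point, at which
every polynomial takes itself as value. The assumption \<open>ev_coord\<close> says that a representative of a
dominant map is proportional to the vector of its affine coordinates.\<close>

locale rational_maps = proj_space ev gen
  for ev :: "('r::{factorial_ring_gcd,semiring_gcd_mult_normalize}) fract ^ 'n \<Rightarrow> 'r \<Rightarrow> 'r fract"
    and gen :: "'r fract ^ 'n" +
  fixes cst :: "complex \<Rightarrow> 'r fract"
  assumes ev_add: "ev w (p + q) = ev w p + ev w q"
    and ev_mult: "ev w (p * q) = ev w p * ev w q"
    and ev_one: "ev w 1 = 1"
    and ev_cst: "\<exists>p. cst z = to_fract p \<and> (\<forall>w. ev w p = cst z)"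
    and ev_scale: "c \<noteq> 0 \<Longrightarrow> ev (c *s w) p = ev w p"
    and ev_gen: "ev gen p = to_fract p"
    and hom_ev: "alg_hom cst cst \<sigma> \<Longrightarrow> \<sigma> (ev w p) = ev (\<chi> i. \<sigma> (w $ i)) p"
    and ev_coord: "dominant w \<Longrightarrow> \<exists>c. c \<noteq> 0 \<and> (\<forall>i. \<exists>p. gen $ i = to_fract p \<and> w $ i = c * ev w p)"
    and gen_nz: "gen \<noteq> 0"
begin

lemma pullback_eq: "pullback w = fract_lift (ev w)"
  unfolding pullback_def fract_lift_def ..

lemma ev_zero: "ev w 0 = 0"
proof -
  have "ev w 0 + 0 = ev w 0 + ev w 0" using ev_add[of w 0 0] by (simp only: add_0_left add_0_right)
  then show ?thesis by (simp only: add_left_cancel)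
qed

lemma comm_ring_hom_ev: "comm_ring_hom (ev w)"
  by unfold_locales (simp_all add: ev_add ev_mult ev_one ev_zero)

lemma pullback_frac: "dominant w \<Longrightarrow> b \<noteq> 0 \<Longrightarrow> pullback w (to_fract a / to_fract b) = ev w a / ev w b"
  and pullback_to_fract: "dominant w \<Longrightarrow> pullback w (to_fract a) = ev w a"
  unfolding pullback_eq dominant_def by (simp_all add: fract_lift[OF comm_ring_hom_ev])

lemma pullback_hom:
  assumes w: "dominant w" shows "alg_hom cst cst (pullback w)"
proof -
  have "field_hom (pullback w)"
    using w unfolding pullback_eq dominant_def by (intro fract_lift(3) comm_ring_hom_ev) blast
  moreover have "pullback w (cst c) = cst c" for c
    using ev_cst[of c] pullback_to_fract[OF w] by metis
  ultimately show ?thesis by (simp add: alg_hom_def)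
qed

lemma pullback_scale: "c \<noteq> 0 \<Longrightarrow> pullback (c *s w) = pullback w"
  by (rule ext) (simp add: pullback_def ev_scale)

text \<open>A dominant map can be recovered from its pullback: up to a common factor its components are the pullbacks of the
homogeneous coordinates of the generic point.\<close>

lemma pullback_gen_class: "dominant w \<Longrightarrow> w \<in> proj_class (\<chi> i. pullback w (gen $ i))"
proof -
  assume w: "dominant w"
  obtain c where c: "c \<noteq> 0" "\<forall>i. \<exists>p. gen $ i = to_fract p \<and> w $ i = c * ev w p" using ev_coord[OF w] by blast
  have "w $ i = c * pullback w (gen $ i)" for i
    using spec[OF c(2), of i] by (auto simp: pullback_to_fract[OF w])
  then have "w = c *s (\<chi> i. pullback w (gen $ i))"
    by (simp add: vec_eq_iff)
  then show ?thesis using c(1) unfolding proj_class_def by blast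
qed

lemma dominant_hom:
  assumes s: "alg_hom cst cst \<sigma>" and v: "dominant v"
  shows "dominant (\<chi> i. \<sigma> (v $ i))" "pullback (\<chi> i. \<sigma> (v $ i)) = \<sigma> \<circ> pullback v"
proof -
  interpret s: field_hom \<sigma> using s by (rule alg_homD)
  have 0: "\<sigma> x = 0 \<longleftrightarrow> x = 0" for x using s alg_homD field_hom_eq_0_iff by blast
  show "dominant (\<chi> i. \<sigma> (v $ i))" using v unfolding dominant_def
    by (auto simp: hom_ev[OF s, symmetric] 0 vec_eq_iff)
  show "pullback (\<chi> i. \<sigma> (v $ i)) = \<sigma> \<circ> pullback v"
    by (rule ext) (simp add: pullback_def hom_ev[OF s, symmetric] case_prod_unfold s.hom_div)
qed

lemma dominant_gen: "dominant gen" unfolding dominant_def using gen_nz by (simp add: ev_gen)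

lemma pullback_gen: "pullback gen = id"
proof
  fix h :: "'r fract" obtain a b :: 'r where "h = to_fract a / to_fract b" "b \<noteq> 0" by (rule fract_as_quotient)
  then show "pullback gen h = id h" using pullback_frac[OF dominant_gen] by (simp add: ev_gen)
qed

lemma dominant_endo:
  assumes "alg_hom cst cst \<sigma>"
  shows "dominant (\<chi> i. \<sigma> (gen $ i))" "pullback (\<chi> i. \<sigma> (gen $ i)) = \<sigma>"
  using dominant_hom[OF assms dominant_gen] by (simp_all add: pullback_gen)

lemma pullback_cong_class: "v \<in> proj_class w \<Longrightarrow> pullback v = pullback w"
  unfolding proj_class_def using pullback_scale by blast

lemma proj_class_eq_pullback:
  assumes "dominant v" "dominant w"
  shows "proj_class v = proj_class w \<longleftrightarrow> pullback v = pullback w"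
proof
  assume "proj_class v = proj_class w"
  then show "pullback v = pullback w" using pullback_cong_class proj_class_self by blast
next
  assume eq: "pullback v = pullback w"
  have "proj_class v = proj_class (\<chi> i. pullback v (gen $ i))"
    using pullback_gen_class[OF assms(1)] by (rule proj_class_eqI)
  also have "\<dots> = proj_class w"
    unfolding eq using proj_class_eqI[OF pullback_gen_class[OF assms(2)]] by simp
  finally show "proj_class v = proj_class w" .
qed

text \<open>Another representative of the outer map multiplies the composite by the pullback of a scalar, and another
representative of the inner map has the same pullback. So all representatives give the same class.\<close>

lemma rat_comp_proj:
  assumes w: "dominant w"
  shows "rat_comp (proj_class v) (proj_class w) = proj_class (\<chi> i. pullback w (v $ i))"
proof -
  interpret s: field_hom "pullback w" using pullback_hom[OF w] by (rule alg_homD)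
  have 0: "pullback w x = 0 \<longleftrightarrow> x = 0" for x using pullback_hom[OF w] alg_homD field_hom_eq_0_iff by blast
  have "proj_class (\<chi> i. pullback w' (v' $ i)) = proj_class (\<chi> i. pullback w (v $ i))"
    if v': "v' \<in> proj_class v" and w': "w' \<in> proj_class w" for v' w'
  proof -
    obtain c where c: "c \<noteq> 0" "v' = c *s v" using v' unfolding proj_class_def by blast
    have "(\<chi> i. pullback w' (v' $ i)) = pullback w c *s (\<chi> i. pullback w (v $ i))"
      using pullback_cong_class[OF w'] c
      by (simp add: vec_eq_iff s.hom_mult)
    then show ?thesis using c(1) 0 by (intro proj_class_eqI) (auto simp: proj_class_def)
  qed
  then have "rat_comp (proj_class v) (proj_class w) =
      (\<Union>v'\<in>proj_class v. \<Union>w'\<in>proj_class w. proj_class (\<chi> i. pullback w (v $ i)))"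
    unfolding rat_comp_def by (intro SUP_cong refl) auto
  also have "\<dots> = proj_class (\<chi> i. pullback w (v $ i))"
    using proj_class_self[of v] proj_class_self[of w] by auto
  finally show ?thesis .
qed

text \<open>The inverse of the passage from a map to its pullback.\<close>

definition map_of_endo :: "('r fract \<Rightarrow> 'r fract) \<Rightarrow> ('r fract ^ 'n) set" where
  "map_of_endo \<sigma> = proj_class (\<chi> i. \<sigma> (gen $ i))"

lemma map_of_endo_id: "map_of_endo id = proj_class gen"
  by (simp add: map_of_endo_def)

lemma map_of_endo_inj:
  "alg_hom cst cst \<sigma> \<Longrightarrow> alg_hom cst cst \<tau> \<Longrightarrow> map_of_endo \<sigma> = map_of_endo \<tau> \<longleftrightarrow> \<sigma> = \<tau>"
  by (simp add: map_of_endo_def proj_class_eq_pullback dominant_endo)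

lemma rat_comp_map_of_endo:
  assumes "alg_hom cst cst \<tau>"
  shows "rat_comp (map_of_endo \<sigma>) (map_of_endo \<tau>) = map_of_endo (\<tau> \<circ> \<sigma>)"
  unfolding map_of_endo_def by (simp add: rat_comp_proj[OF dominant_endo(1)[OF assms]] dominant_endo(2)[OF assms])

lemma dominant_maps_iff: "\<phi> \<in> dominant_maps \<longleftrightarrow> (\<exists>\<sigma>. alg_hom cst cst \<sigma> \<and> \<phi> = map_of_endo \<sigma>)"
proof
  assume "\<phi> \<in> dominant_maps"
  then obtain w where w: "dominant w" "\<phi> = proj_class w" unfolding dominant_maps_def by blast
  then have "\<phi> = map_of_endo (pullback w)"
    unfolding map_of_endo_def using proj_class_eqI[OF pullback_gen_class] by blast
  then show "\<exists>\<sigma>. alg_hom cst cst \<sigma> \<and> \<phi> = map_of_endo \<sigma>" using pullback_hom[OF w(1)] by blast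
next
  assume "\<exists>\<sigma>. alg_hom cst cst \<sigma> \<and> \<phi> = map_of_endo \<sigma>"
  then show "\<phi> \<in> dominant_maps" unfolding dominant_maps_def map_of_endo_def using dominant_endo(1) by blast
qed

lemma Bir_iff: "\<phi> \<in> Bir \<longleftrightarrow> (\<exists>\<sigma>. alg_hom cst cst \<sigma> \<and> bij \<sigma> \<and> \<phi> = map_of_endo \<sigma>)"
proof
  assume "\<phi> \<in> Bir"
  then obtain \<sigma> \<tau> where *: "alg_hom cst cst \<sigma>" "\<phi> = map_of_endo \<sigma>" "alg_hom cst cst \<tau>"
    "map_of_endo (\<tau> \<circ> \<sigma>) = map_of_endo id" "map_of_endo (\<sigma> \<circ> \<tau>) = map_of_endo id"
    unfolding Bir_def by (auto simp: dominant_maps_iff map_of_endo_id rat_comp_map_of_endo)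
  then have "\<tau> \<circ> \<sigma> = id" "\<sigma> \<circ> \<tau> = id"
    using map_of_endo_inj[OF alg_hom_comp alg_hom_id] by blast+
  then show "\<exists>\<sigma>. alg_hom cst cst \<sigma> \<and> bij \<sigma> \<and> \<phi> = map_of_endo \<sigma>" using * o_bij by blast
next
  assume "\<exists>\<sigma>. alg_hom cst cst \<sigma> \<and> bij \<sigma> \<and> \<phi> = map_of_endo \<sigma>"
  then obtain \<sigma> where s: "alg_hom cst cst \<sigma>" "bij \<sigma>" "\<phi> = map_of_endo \<sigma>" by blast
  have i: "alg_hom cst cst (inv_into UNIV \<sigma>)" using s alg_hom_inv by blast
  have c: "inv_into UNIV \<sigma> \<circ> \<sigma> = id" "\<sigma> \<circ> inv_into UNIV \<sigma> = id" using s(2) by (simp_all add: fun_eq_iff inv_f_f surj_f_inv_f bij_is_surj bij_is_inj)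
  have "map_of_endo \<sigma> \<in> dominant_maps" "map_of_endo (inv_into UNIV \<sigma>) \<in> dominant_maps"
    using s(1) i unfolding dominant_maps_iff by blast+
  moreover have "rat_comp (map_of_endo \<sigma>) (map_of_endo (inv_into UNIV \<sigma>)) = proj_class gen"
    "rat_comp (map_of_endo (inv_into UNIV \<sigma>)) (map_of_endo \<sigma>) = proj_class gen"
    unfolding rat_comp_map_of_endo[OF i] rat_comp_map_of_endo[OF s(1)] c map_of_endo_id by (rule refl)+
  ultimately show "\<phi> \<in> Bir" unfolding Bir_def s(3) by blast
qed

lemma rat_comp_eq_iff:
  assumes v: "dominant v" and s: "alg_hom cst cst \<sigma>"
  shows "rat_comp (proj_class v) (map_of_endo \<sigma>) = proj_class v \<longleftrightarrow> (\<forall>x\<in>range (pullback v). \<sigma> x = x)"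
proof -
  have "rat_comp (proj_class v) (map_of_endo \<sigma>) = proj_class (\<chi> i. \<sigma> (v $ i))"
    unfolding map_of_endo_def by (simp add: rat_comp_proj[OF dominant_endo(1)[OF s]] dominant_endo(2)[OF s])
  also have "\<dots> = proj_class v \<longleftrightarrow> \<sigma> \<circ> pullback v = pullback v"
    using proj_class_eq_pullback[OF dominant_hom(1)[OF s v] v] dominant_hom(2)[OF s v] by simp
  finally show ?thesis by (auto simp: fun_eq_iff)
qed

text \<open>A map \<open>\<phi>\<close> with pullback \<open>\<sigma>\<close> satisfies \<open>f \<circ> \<phi> = f\<close>
exactly if \<open>\<sigma>\<close> fixes the pullbacks of all functions along \<open>f\<close>, and it is birational
exactly if \<open>\<sigma>\<close> is bijective.\<close>

theorem Deck_iso_Gal_group: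
  assumes v: "dominant v"
  shows "Gal_group cst (range (pullback v)) \<cong> Deck (proj_class v)"
proof -
  let ?G = "Gal_group cst (range (pullback v))"
  have carr: "carrier (Deck (proj_class v)) = map_of_endo ` carrier ?G"
  proof (rule Set.set_eqI)
    fix \<phi>
    have "\<phi> \<in> carrier (Deck (proj_class v)) \<longleftrightarrow>
        (\<exists>\<sigma>. alg_hom cst cst \<sigma> \<and> bij \<sigma> \<and> \<phi> = map_of_endo \<sigma>) \<and> rat_comp (proj_class v) \<phi> = proj_class v"
      by (simp add: Deck_def Bir_iff)
    also have "\<dots> \<longleftrightarrow> (\<exists>\<sigma>. \<sigma> \<in> carrier ?G \<and> \<phi> = map_of_endo \<sigma>)"
      unfolding Gal_group_simps using rat_comp_eq_iff[OF v] by blast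
    finally show "\<phi> \<in> carrier (Deck (proj_class v)) \<longleftrightarrow> \<phi> \<in> map_of_endo ` carrier ?G" by blast
  qed
  have "map_of_endo \<in> iso ?G (Deck (proj_class v))"
  proof (rule isoI)
    show "map_of_endo \<in> hom ?G (Deck (proj_class v))"
    proof (rule homI)
      fix \<sigma> \<tau> assume "\<sigma> \<in> carrier ?G" "\<tau> \<in> carrier ?G"
      then show "map_of_endo (\<sigma> \<otimes>\<^bsub>?G\<^esub> \<tau>) = map_of_endo \<sigma> \<otimes>\<^bsub>Deck (proj_class v)\<^esub> map_of_endo \<tau>"
        using rat_comp_map_of_endo[of \<tau> \<sigma>] by (simp add: Deck_def)
    qed (simp add: carr del: Gal_group_simps)
    show "bij_betw map_of_endo (carrier ?G) (carrier (Deck (proj_class v)))"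
      unfolding bij_betw_def carr inj_on_def using map_of_endo_inj by simp
  qed
  then show ?thesis unfolding is_iso_def by blast
qed

text \<open>All representatives of a map have the same pullback, so the field in the definition of a Galois map is a single range.\<close>

lemma galois_map_iff: "galois_map (proj_class v) \<longleftrightarrow> galois_ext (range (pullback v))"
proof -
  have "{pullback w h |w h. w \<in> proj_class v} = range (pullback v)"
  proof
    show "{pullback w h |w h. w \<in> proj_class v} \<subseteq> range (pullback v)"
      using pullback_cong_class[of _ v] by auto
    show "range (pullback v) \<subseteq> {pullback w h |w h. w \<in> proj_class v}"
      using proj_class_self[of v] by auto
  qed
  then show ?thesis unfolding galois_map_def by simp
qed

end

section \<open>The function fields of the projective line and of the projective plane\<close>

definition cst1 :: "complex \<Rightarrow> complex poly fract" where "cst1 c = to_fract [:c:]"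
definition cst2 :: "complex \<Rightarrow> complex poly poly fract" where "cst2 c = to_fract [:[:c:]:]"
definition xK :: "complex poly poly fract" where "xK = to_fract polyX"
definition yK :: "complex poly poly fract" where "yK = to_fract polyY"
definition tK :: "complex poly fract" where "tK = to_fract [:0, 1:]"

lemma comm_ring_hom_cst1: "comm_ring_hom cst1" and comm_ring_hom_cst2: "comm_ring_hom cst2"
  by (unfold_locales; simp add: cst1_def cst2_def flip: to_fract_add to_fract_mult one_pCons)+

lemma comm_ring_hom_eval:
  assumes "comm_ring_hom \<kappa>" shows "comm_ring_hom (\<lambda>p. poly (map_poly \<kappa> p) z)"
proof -
  interpret k: comm_ring_hom \<kappa> by fact
  interpret m: map_poly_comm_ring_hom \<kappa> ..
  show ?thesis by unfold_locales (simp_all add: m.hom_add m.hom_mult m.hom_one)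
qed

lemma ev1_eq: "ev1 w p = poly (map_poly cst1 p) (w $ 1 / w $ 2)"
  unfolding ev1_def cst1_def[abs_def] ..

lemma ev2_eq: "ev2 w p = poly (map_poly (\<lambda>q. poly (map_poly cst2 q) (w $ 1 / w $ 3)) p) (w $ 2 / w $ 3)"
  unfolding ev2_def cst2_def[abs_def] ..

lemma ring_hom_ev1: "comm_ring_hom (ev1 w)"
  unfolding ev1_eq[abs_def] by (intro comm_ring_hom_eval comm_ring_hom_cst1)

lemma ring_hom_ev2: "comm_ring_hom (ev2 w)"
  unfolding ev2_eq[abs_def] by (intro comm_ring_hom_eval comm_ring_hom_cst2)

lemma cst_0 [simp]: "cst1 0 = 0" "cst2 0 = 0" by (simp_all add: cst1_def cst2_def)

lemma ev1_X: "ev1 w [:0, 1:] = w $ 1 / w $ 2"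
  by (simp add: ev1_def Polynomial.map_poly_pCons flip: one_pCons)

lemma ev2_X: "ev2 w polyX = w $ 1 / w $ 3"
  and ev2_Y: "ev2 w polyY = w $ 2 / w $ 3"
  by (simp_all add: ev2_def Polynomial.map_poly_pCons flip: one_pCons)

lemma ev1_const: "ev1 w [:c:] = cst1 c"
  by (simp add: ev1_eq Polynomial.map_poly_pCons)

lemma ev2_const: "ev2 w [:[:c:]:] = cst2 c"
  by (simp add: ev2_eq Polynomial.map_poly_pCons)

lemma alg_hom_ev1: assumes "alg_hom cst1 k \<sigma>"
  shows "\<sigma> (poly (map_poly cst1 p) z) = poly (map_poly k p) (\<sigma> z)"
proof -
  interpret field_hom \<sigma> using assms by (rule alg_homD)
  have "map_poly \<sigma> (map_poly cst1 p) = map_poly k p"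
    by (rule poly_eqI) (simp add: coeff_map_poly alg_homD(2)[OF assms, symmetric])
  then show ?thesis by (metis poly_map_poly)
qed

lemma alg_hom_ev2: assumes "alg_hom cst2 k \<sigma>"
  shows "\<sigma> (poly (map_poly (\<lambda>q. poly (map_poly cst2 q) y) p) z) = poly (map_poly (\<lambda>q. poly (map_poly k q) (\<sigma> y)) p) (\<sigma> z)"
proof -
  interpret field_hom \<sigma> using assms by (rule alg_homD)
  have 1: "\<sigma> (poly (map_poly cst2 q) y) = poly (map_poly k q) (\<sigma> y)" for q
  proof -
    have "map_poly \<sigma> (map_poly cst2 q) = map_poly k q"
      by (rule poly_eqI) (simp add: coeff_map_poly alg_homD(2)[OF assms, symmetric])
    then show ?thesis by (metis poly_map_poly)
  qed
  have "map_poly \<sigma> (map_poly (\<lambda>q. poly (map_poly cst2 q) y) p) = map_poly (\<lambda>q. poly (map_poly k q) (\<sigma> y)) p"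
    by (rule poly_eqI) (simp add: coeff_map_poly 1)
  then show ?thesis by (metis poly_map_poly)
qed

lemma ev1_gen: "ev1 gen1 p = to_fract p"
proof (induction p)
  case (pCons a p)
  have "ev1 gen1 (pCons a p) = cst1 a + tK * ev1 gen1 p"
    by (simp add: ev1_eq Polynomial.map_poly_pCons gen1_def tK_def)
  also have "\<dots> = to_fract (pCons a p)"
    unfolding pCons.IH by (simp add: cst1_def tK_def flip: to_fract_add to_fract_mult)
  finally show ?case .
qed (simp add: ev1_def)

lemma ev2_gen: "ev2 gen2 p = to_fract p"
proof (induction p)
  case (pCons a p)
  have 1: "poly (map_poly cst2 q) xK = to_fract [:q:]" for q
  proof (induction q)
    case (pCons a q)
    then show ?case by (simp add: Polynomial.map_poly_pCons cst2_def xK_def flip: to_fract_add to_fract_mult)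
  qed simp
  have "ev2 gen2 (pCons a p) = poly (map_poly cst2 a) xK + yK * ev2 gen2 p"
    by (simp add: ev2_eq Polynomial.map_poly_pCons gen2_def xK_def yK_def)
  also have "\<dots> = to_fract (pCons a p)"
    unfolding pCons.IH 1 by (simp add: yK_def flip: to_fract_add to_fract_mult)
  finally show ?case .
qed (simp add: ev2_def)

interpretation R1: rational_maps ev1 gen1 cst1
proof
  fix w :: "complex poly fract ^ 2" and p q :: "complex poly" and c :: "complex poly fract" and z :: complex
  interpret e: comm_ring_hom "ev1 w" by (rule ring_hom_ev1)
  show "ev1 w (p + q) = ev1 w p + ev1 w q" "ev1 w (p * q) = ev1 w p * ev1 w q" "ev1 w 1 = 1"
    by (rule e.hom_add e.hom_mult e.hom_one)+
  show "\<exists>p. cst1 z = to_fract p \<and> (\<forall>w. ev1 w p = cst1 z)"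
    using ev1_const cst1_def by blast
  show "c \<noteq> 0 \<Longrightarrow> ev1 (c *s w) p = ev1 w p" by (simp add: ev1_def)
  show "ev1 gen1 p = to_fract p" by (rule ev1_gen)
  show "gen1 \<noteq> 0" by (auto simp: gen1_def vec_eq_iff forall_2)
  show "\<sigma> (ev1 w p) = ev1 (\<chi> i. \<sigma> (w $ i)) p" if s: "alg_hom cst1 cst1 \<sigma>" for \<sigma>
  proof -
    interpret field_hom \<sigma> using s by (rule alg_homD)
    show ?thesis by (simp add: ev1_eq alg_hom_ev1[OF s] hom_div)
  qed
  show "\<exists>c. c \<noteq> 0 \<and> (\<forall>i. \<exists>p. gen1 $ i = to_fract p \<and> w $ i = c * ev1 w p)" if "P1.dominant w"
  proof -
    have "ev1 w [:0,1:] \<noteq> 0" using that unfolding P1.dominant_def by simp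
    then have w2: "w $ 2 \<noteq> 0" by (auto simp: ev1_X)
    have 1: "gen1 $ 1 = to_fract [:0,1:] \<and> w $ 1 = w $ 2 * ev1 w [:0,1:]"
      using w2 by (simp add: gen1_def ev1_X)
    have 2: "gen1 $ 2 = to_fract 1 \<and> w $ 2 = w $ 2 * ev1 w 1"
      using w2 by (simp add: gen1_def e.hom_one)
    show ?thesis unfolding forall_2 using w2 1 2 by blast
  qed
qed

interpretation R2: rational_maps ev2 gen2 cst2
proof
  fix w :: "complex poly poly fract ^ 3" and p q :: "complex poly poly" and c :: "complex poly poly fract" and z :: complex
  interpret e: comm_ring_hom "ev2 w" by (rule ring_hom_ev2)
  show "ev2 w (p + q) = ev2 w p + ev2 w q" "ev2 w (p * q) = ev2 w p * ev2 w q" "ev2 w 1 = 1"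
    by (rule e.hom_add e.hom_mult e.hom_one)+
  show "\<exists>p. cst2 z = to_fract p \<and> (\<forall>w. ev2 w p = cst2 z)"
    using ev2_const cst2_def by blast
  show "c \<noteq> 0 \<Longrightarrow> ev2 (c *s w) p = ev2 w p" by (simp add: ev2_def)
  show "ev2 gen2 p = to_fract p" by (rule ev2_gen)
  show "gen2 \<noteq> 0" by (auto simp: gen2_def vec_eq_iff forall_3)
  show "\<sigma> (ev2 w p) = ev2 (\<chi> i. \<sigma> (w $ i)) p" if s: "alg_hom cst2 cst2 \<sigma>" for \<sigma>
  proof -
    interpret field_hom \<sigma> using s by (rule alg_homD)
    show ?thesis by (simp add: ev2_eq alg_hom_ev2[OF s] hom_div)
  qed
  show "\<exists>c. c \<noteq> 0 \<and> (\<forall>i. \<exists>p. gen2 $ i = to_fract p \<and> w $ i = c * ev2 w p)" if "P2.dominant w"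
  proof -
    have "ev2 w polyX \<noteq> 0" using that unfolding P2.dominant_def by simp
    then have w2: "w $ 3 \<noteq> 0" by (auto simp: ev2_X)
    have 1: "gen2 $ 1 = to_fract polyX \<and> w $ 1 = w $ 3 * ev2 w polyX"
      using w2 by (simp add: gen2_def ev2_X)
    have 2: "gen2 $ 2 = to_fract polyY \<and> w $ 2 = w $ 3 * ev2 w polyY"
      using w2 by (simp add: gen2_def ev2_Y)
    have 3: "gen2 $ 3 = to_fract 1 \<and> w $ 3 = w $ 3 * ev2 w 1"
      using w2 by (simp add: gen2_def e.hom_one)
    show ?thesis unfolding forall_3 using w2 1 2 3 by blast
  qed
qed

definition subfieldC :: "(complex \<Rightarrow> 'k::field) \<Rightarrow> 'k set \<Rightarrow> bool" where
  "subfieldC k M \<longleftrightarrow> (\<forall>c. k c \<in> M) \<and> (\<forall>a\<in>M. \<forall>b\<in>M. a + b \<in> M \<and> a * b \<in> M) \<and> (\<forall>a\<in>M. - a \<in> M \<and> inverse a \<in> M)"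

lemma subfieldCD:
  assumes "subfieldC k M"
  shows "k c \<in> M" "a \<in> M \<Longrightarrow> b \<in> M \<Longrightarrow> a + b \<in> M" "a \<in> M \<Longrightarrow> b \<in> M \<Longrightarrow> a * b \<in> M"
    "a \<in> M \<Longrightarrow> - a \<in> M" "a \<in> M \<Longrightarrow> inverse a \<in> M" "a \<in> M \<Longrightarrow> b \<in> M \<Longrightarrow> a - b \<in> M"
    "a \<in> M \<Longrightarrow> b \<in> M \<Longrightarrow> a / b \<in> M"
proof -
  show "a \<in> M \<Longrightarrow> b \<in> M \<Longrightarrow> a - b \<in> M"
    using assms unfolding subfieldC_def by (metis add_uminus_conv_diff)
  show "a \<in> M \<Longrightarrow> b \<in> M \<Longrightarrow> a / b \<in> M"
    using assms unfolding subfieldC_def by (metis divide_inverse)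
qed (use assms in \<open>auto simp: subfieldC_def\<close>)

lemma subfieldC_power: assumes "subfieldC k M" "k 1 = 1" "a \<in> M" shows "a ^ n \<in> M"
  by (induction n) (use assms subfieldCD[OF assms(1)] in \<open>auto intro: subfieldCD(1)[OF assms(1), of 1, unfolded assms(2)]\<close>)

lemma subfieldC_power_int: assumes "subfieldC k M" "k 1 = 1" "a \<in> M" shows "a powi n \<in> M"
  unfolding power_int_def using subfieldC_power[OF assms] subfieldC_power[OF assms(1,2) subfieldCD(5)[OF assms(1,3)]] by auto

lemma subfieldC_range: assumes "alg_hom k l \<sigma>" shows "subfieldC l (range \<sigma>)"
proof -
  interpret field_hom \<sigma> using assms by (rule alg_homD)
  show ?thesis unfolding subfieldC_def
    by (auto simp: alg_homD(2)[OF assms, symmetric] simp flip: hom_add hom_mult hom_uminus hom_inverse)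
qed

lemma subfieldC_vimage: assumes "alg_hom k l \<sigma>" "subfieldC l M" shows "subfieldC k (\<sigma> -` M)"
proof -
  interpret field_hom \<sigma> using assms by (auto dest: alg_homD)
  show ?thesis using assms(2) unfolding subfieldC_def
    by (auto simp: alg_homD(2)[OF assms(1)] hom_add hom_mult hom_uminus hom_inverse)
qed

lemma subfieldC_eq: assumes "alg_hom k l \<sigma>" "alg_hom k l \<tau>" shows "subfieldC k {h. \<sigma> h = \<tau> h}"
proof -
  interpret s: field_hom \<sigma> using assms by (auto dest: alg_homD)
  interpret t: field_hom \<tau> using assms by (auto dest: alg_homD)
  show ?thesis unfolding subfieldC_def
    by (auto simp: alg_homD(2)[OF assms(1)] alg_homD(2)[OF assms(2)] s.hom_add s.hom_mult s.hom_uminus s.hom_inverse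
        t.hom_add t.hom_mult t.hom_uminus t.hom_inverse)
qed

text \<open>The coordinate generates the field of rational functions, so a homomorphism is determined by its value there, and
every field that contains this value contains the range.\<close>

lemma gen1_subfield: assumes M: "subfieldC cst1 M" "tK \<in> M" shows "h \<in> M"
proof -
  note cl = subfieldCD[OF M(1)]
  have p: "to_fract p \<in> M" for p
  proof (induction p)
    case 0
    then show ?case using cl(1)[of 0] by simp
  next
    case (pCons a p)
    have "to_fract (pCons a p) = cst1 a + tK * to_fract p"
      by (simp add: cst1_def tK_def flip: to_fract_add to_fract_mult)
    then show ?case using cl(1)[of a] cl(2)[OF _ cl(3)[OF M(2) pCons.IH]] by simp
  qed
  show ?thesis by (rule fract_as_quotient[of h]) (use cl(7) p in auto)
qed

lemma gen2_subfield: assumes M: "subfieldC cst2 M" "xK \<in> M" "yK \<in> M" shows "h \<in> M"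
proof -
  note cl = subfieldCD[OF M(1)]
  have q: "to_fract [:q:] \<in> M" for q
  proof (induction q)
    case 0
    then show ?case using cl(1)[of 0] by simp
  next
    case (pCons a p)
    have "to_fract [:pCons a p:] = cst2 a + xK * to_fract [:p:]"
      by (simp add: cst2_def xK_def flip: to_fract_add to_fract_mult)
    then show ?case using cl(1)[of a] cl(2)[OF _ cl(3)[OF M(2) pCons.IH]] by simp
  qed
  have p: "to_fract p \<in> M" for p
  proof (induction p)
    case 0
    then show ?case using cl(1)[of 0] by simp
  next
    case (pCons a p)
    have "to_fract (pCons a p) = to_fract [:a:] + yK * to_fract p"
      by (simp add: yK_def flip: to_fract_add to_fract_mult)
    then show ?case using q[of a] cl(2)[OF _ cl(3)[OF M(3) pCons.IH]] by simp
  qed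
  show ?thesis by (rule fract_as_quotient[of h]) (use cl(7) p in auto)
qed

lemma range_subset1: "alg_hom cst1 k \<sigma> \<Longrightarrow> subfieldC k M \<Longrightarrow> \<sigma> tK \<in> M \<Longrightarrow> range \<sigma> \<subseteq> M"
  using gen1_subfield[OF subfieldC_vimage] by blast

lemma range_subset2: "alg_hom cst2 k \<sigma> \<Longrightarrow> subfieldC k M \<Longrightarrow> \<sigma> xK \<in> M \<Longrightarrow> \<sigma> yK \<in> M \<Longrightarrow> range \<sigma> \<subseteq> M"
  using gen2_subfield[OF subfieldC_vimage] by blast

lemma alg_hom_ext1: "alg_hom cst1 k \<sigma> \<Longrightarrow> alg_hom cst1 k \<tau> \<Longrightarrow> \<sigma> tK = \<tau> tK \<Longrightarrow> \<sigma> = \<tau>"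
  using gen1_subfield[OF subfieldC_eq] by blast

lemma alg_hom_ext2: "alg_hom cst2 k \<sigma> \<Longrightarrow> alg_hom cst2 k \<tau> \<Longrightarrow> \<sigma> xK = \<tau> xK \<Longrightarrow> \<sigma> yK = \<tau> yK \<Longrightarrow> \<sigma> = \<tau>"
  using gen2_subfield[OF subfieldC_eq] by blast

lemma gen2_comp: "gen2 $ 1 = xK" "gen2 $ 2 = yK" "gen2 $ 3 = 1"
  by (simp_all add: gen2_def xK_def yK_def)

text \<open>The endomorphism with \<open>x \<mapsto> s\<close> and \<open>y \<mapsto> t\<close>, for algebraically independent
\<open>s\<close> and \<open>t\<close>.\<close>

definition subst2 :: "complex poly poly fract \<Rightarrow> complex poly poly fract \<Rightarrow> complex poly poly fract \<Rightarrow> complex poly poly fract" where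
  "subst2 s t = P2.pullback (vector [s, t, 1])"

lemma subst2:
  assumes "P2.dominant (vector [s, t, 1])"
  shows "alg_hom cst2 cst2 (subst2 s t)" "subst2 s t xK = s" "subst2 s t yK = t"
  using R2.pullback_hom[OF assms] R2.pullback_to_fract[OF assms, of polyX] R2.pullback_to_fract[OF assms, of polyY]
  by (simp_all add: subst2_def xK_def yK_def ev2_X ev2_Y)

definition subst1 :: "complex poly fract \<Rightarrow> complex poly fract \<Rightarrow> complex poly fract" where
  "subst1 s = P1.pullback (vector [s, 1])"

lemma subst1:
  assumes "P1.dominant (vector [s, 1])"
  shows "alg_hom cst1 cst1 (subst1 s)" "subst1 s tK = s"
  using R1.pullback_hom[OF assms] R1.pullback_to_fract[OF assms, of "[:0,1:]"]
  by (simp_all add: subst1_def tK_def ev1_X)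

lemma eval2_simps [simp]:
  "eval2 0 a b = 0" "eval2 1 a b = 1" "eval2 (p + q) a b = eval2 p a b + eval2 q a b" "eval2 (p * q) a b = eval2 p a b * eval2 q a b"
  "eval2 (- p) a b = - eval2 p a b" "eval2 (p - q) a b = eval2 p a b - eval2 q a b"
  "eval2 (pCons r p) a b = poly r a + b * eval2 p a b" "eval2 (smult r p) a b = poly r a * eval2 p a b"
  by (simp_all add: eval2_def)

lemma nonzero_eval2: assumes "B \<noteq> 0" obtains a b where "eval2 B a b \<noteq> 0"
proof -
  have "finite ((\<lambda>b. [:b:]) -` {r. poly B r = 0})"
    by (intro finite_vimageI poly_roots_finite assms) (auto simp: inj_def)
  then obtain b :: complex where "b \<notin> (\<lambda>b. [:b:]) -` {r. poly B r = 0}"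
    using infinite_UNIV_char_0 by (metis UNIV_eq_I)
  then have "poly B [:b:] \<noteq> 0" by simp
  then obtain a where "poly (poly B [:b:]) a \<noteq> 0" by (meson poly_all_0_iff_0)
  then show thesis using that by (simp add: eval2_def)
qed

text \<open>The fraction need not be in lowest terms. This makes values compatible with sums and products without any
cancellation; any two fractions with non-vanishing denominators give the same value.\<close>

definition has_value :: "complex poly poly fract \<Rightarrow> complex \<Rightarrow> complex \<Rightarrow> complex \<Rightarrow> bool" where
  "has_value f a b c \<longleftrightarrow> (\<exists>n d. f = to_fract n / to_fract d \<and> eval2 d a b \<noteq> 0 \<and> c = eval2 n a b / eval2 d a b)"

lemma has_valueI: "eval2 d a b \<noteq> 0 \<Longrightarrow> has_value (to_fract n / to_fract d) a b (eval2 n a b / eval2 d a b)"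
  unfolding has_value_def by blast

lemma has_value_to_fract: "has_value (to_fract p) a b (eval2 p a b)"
  using has_valueI[of 1 a b p] by simp

lemma has_value_unique: assumes "has_value f a b c" "has_value f a b c'" shows "c = c'"
proof -
  obtain n d n' d' where *: "f = to_fract n / to_fract d" "eval2 d a b \<noteq> 0" "c = eval2 n a b / eval2 d a b"
    "f = to_fract n' / to_fract d'" "eval2 d' a b \<noteq> 0" "c' = eval2 n' a b / eval2 d' a b"
    using assms unfolding has_value_def by blast
  then have "d \<noteq> 0" "d' \<noteq> 0" by auto
  then have "to_fract (n * d') = to_fract (n' * d)" using *(1,4) by (simp add: frac_eq_eq)
  then have "n * d' = n' * d" by (simp only: to_fract_eq_iff)
  then have "eval2 n a b * eval2 d' a b = eval2 n' a b * eval2 d a b" by (metis eval2_simps(4))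
  then show ?thesis using * by (simp add: frac_eq_eq)
qed

lemma has_value_add: assumes "has_value f a b c" "has_value g a b c'" shows "has_value (f + g) a b (c + c')"
  and has_value_mult: "has_value (f * g) a b (c * c')"
proof -
  obtain n d n' d' where *: "f = to_fract n / to_fract d" "eval2 d a b \<noteq> 0" "c = eval2 n a b / eval2 d a b"
    "g = to_fract n' / to_fract d'" "eval2 d' a b \<noteq> 0" "c' = eval2 n' a b / eval2 d' a b"
    using assms unfolding has_value_def by blast
  then have nz: "d \<noteq> 0" "d' \<noteq> 0" by auto
  have d: "eval2 (d * d') a b \<noteq> 0" using * by simp
  have "f + g = to_fract (n * d' + n' * d) / to_fract (d * d')" "c + c' = eval2 (n * d' + n' * d) a b / eval2 (d * d') a b"
    using * nz by (simp_all add: add_frac_eq)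
  then show "has_value (f + g) a b (c + c')" using has_valueI[OF d] by metis
  have "f * g = to_fract (n * n') / to_fract (d * d')" "c * c' = eval2 (n * n') a b / eval2 (d * d') a b"
    using * by simp_all
  then show "has_value (f * g) a b (c * c')" using has_valueI[OF d] by metis
qed

lemma has_value_cst: "has_value (cst2 c) a b c"
  using has_value_to_fract[of "[:[:c:]:]" a b] by (simp add: cst2_def)

lemma has_value_inverse: assumes "has_value f a b c" "c \<noteq> 0" shows "has_value (inverse f) a b (inverse c)"
proof -
  obtain n d where *: "f = to_fract n / to_fract d" "eval2 d a b \<noteq> 0" "c = eval2 n a b / eval2 d a b"
    using assms unfolding has_value_def by blast
  then show ?thesis using has_valueI[of n a b d] assms(2) by simp
qed

lemma has_value_ev2:
  assumes "has_value (w $ 1 / w $ 3) a b u" "has_value (w $ 2 / w $ 3) a b v"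
  shows "has_value (ev2 w p) a b (eval2 p u v)"
proof -
  define s t where "s = w $ 1 / w $ 3" and "t = w $ 2 / w $ 3"
  have 1: "has_value (poly (map_poly cst2 q) s) a b (poly q u)" for q
  proof (induction q)
    case (pCons r q)
    then show ?case using has_value_add[OF has_value_cst[of r] has_value_mult[OF assms(1) pCons.IH]]
      by (simp add: Polynomial.map_poly_pCons s_def)
  qed (use has_value_cst[of 0] in simp)
  have "has_value (poly (map_poly (\<lambda>q. poly (map_poly cst2 q) s) p) t) a b (eval2 p u v)"
  proof (induction p)
    case (pCons r q)
    then show ?case using has_value_add[OF 1[of r] has_value_mult[OF assms(2) pCons.IH]]
      by (simp add: Polynomial.map_poly_pCons t_def)
  qed (use has_value_cst[of 0] in simp)
  then show ?thesis by (simp add: ev2_eq s_def t_def)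
qed

text \<open>If the map reaches every point outside the curve \<open>B = 0\<close>, then a non-zero polynomial \<open>p\<close>
cannot vanish on its image: there is a point where neither \<open>p\<close> nor \<open>B\<close> vanishes, and this
point has a preimage.\<close>

lemma dominantI:
  assumes "B \<noteq> 0"
    and "\<And>u v. eval2 B u v \<noteq> 0 \<Longrightarrow> \<exists>a b. has_value (w $ 1 / w $ 3) a b u \<and> has_value (w $ 2 / w $ 3) a b v"
    and "w \<noteq> 0"
  shows "P2.dominant w"
  unfolding P2.dominant_def
proof (intro conjI allI impI)
  fix p :: "complex poly poly" assume "p \<noteq> 0"
  then have "p * B \<noteq> 0" using assms(1) by simp
  then obtain u v where "eval2 (p * B) u v \<noteq> 0" by (rule nonzero_eval2)
  then have uv: "eval2 p u v \<noteq> 0" "eval2 B u v \<noteq> 0" by simp_all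
  then obtain a b where "has_value (ev2 w p) a b (eval2 p u v)" using assms(2) has_value_ev2 by blast
  then show "ev2 w p \<noteq> 0" using uv(1) has_value_unique has_value_cst[of 0 a b] by auto
qed fact

lemma dominant_pairI:
  assumes "B \<noteq> 0"
    and "\<And>u v. eval2 B u v \<noteq> 0 \<Longrightarrow> \<exists>a b. has_value s a b u \<and> has_value t a b v"
  shows "P2.dominant (vector [s, t, 1])"
  using assms by (intro dominantI[of B]) (auto simp: vec_eq_iff forall_3)

section \<open>Tangencies with a generic line\<close>

text \<open>A non-zero element of least degree in the ideal generated by both polynomials.\<close>

lemma field_poly_bezout:
  fixes p q :: "'k::field poly"
  assumes "p \<noteq> 0 \<or> q \<noteq> 0"
  obtains u v d where "d = u * p + v * q" "d \<noteq> 0" "d dvd p" "d dvd q"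
proof -
  define I where "I = {u * p + v * q |u v. True}"
  have pI: "p \<in> I" "q \<in> I" unfolding I_def
    by (rule CollectI, rule exI[of _ 1], rule exI[of _ 0], simp, rule CollectI, rule exI[of _ 0], rule exI[of _ 1], simp)
  have sub: "f mod d \<in> I" if f: "f \<in> I" and d: "d \<in> I" for f d
  proof -
    obtain u v u' v' where *: "f = u * p + v * q" "d = u' * p + v' * q" using f d unfolding I_def by blast
    have "f mod d = f - (f div d) * d" by (simp add: minus_div_mult_eq_mod)
    also have "\<dots> = (u - f div d * u') * p + (v - f div d * v') * q"
      by (subst *(1), subst (2) *(2)) (simp add: algebra_simps)
    finally show ?thesis unfolding I_def by blast
  qed
  define d where "d = (ARG_MIN degree d. d \<in> I \<and> d \<noteq> 0)"
  have ex: "\<exists>d. d \<in> I \<and> d \<noteq> 0" using pI assms by blast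
  have d: "d \<in> I" "d \<noteq> 0" "\<And>f. f \<in> I \<Longrightarrow> f \<noteq> 0 \<Longrightarrow> degree d \<le> degree f"
    using arg_min_nat_lemma[of "\<lambda>d. d \<in> I \<and> d \<noteq> 0" _ degree] ex unfolding d_def by blast+
  have "d dvd f" if f: "f \<in> I" for f
  proof -
    have "f mod d = 0"
    proof (rule ccontr)
      assume "f mod d \<noteq> 0"
      then have "degree (f mod d) < degree d" using degree_mod_less'[OF d(2)] by blast
      then show False using d(3)[OF sub[OF f d(1)]] \<open>f mod d \<noteq> 0\<close> by simp
    qed
    then show ?thesis by auto
  qed
  then show thesis using that d(1,2) pI unfolding I_def by blast
qed

lemma clear_denominators:
  fixes u :: "'a :: {factorial_ring_gcd,semiring_gcd_mult_normalize} fract poly"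
  obtains d U where "d \<noteq> 0" "smult (to_fract d) u = fract_poly U"
proof -
  have "\<exists>d U. d \<noteq> 0 \<and> smult (to_fract d) u = fract_poly U"
  proof (induction u)
    case 0
    show ?case by (rule exI[of _ 1], rule exI[of _ 0]) simp
  next
    case (pCons c u)
    then obtain d U where d: "d \<noteq> 0" "smult (to_fract d) u = fract_poly U" by blast
    obtain a b where c: "c = to_fract a / to_fract b" "b \<noteq> 0"
      by (cases c) (auto simp: Fract_conv_to_fract)
    have "smult (to_fract (d * b)) (pCons c u) = fract_poly (pCons (d * a) (smult b U))"
      using c d by (simp add: Polynomial.map_poly_pCons mult.commute[of d b] flip: d(2))
    moreover have "d * b \<noteq> 0" using c d by simp
    ultimately show ?case by blast
  qed
  then show thesis using that by blast
qed

text \<open>Elimination of \<open>y\<close>. By the lemma of Gauss, coprime polynomials remain coprime over the field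
\<open>C(x)\<close>; clearing the denominators of a relation \<open>u P + v Q = 1\<close> leaves a non-zero polynomial
in \<open>x\<close> alone.\<close>

lemma coprime_elimination:
  fixes P Q :: "complex poly poly"
  assumes "coprime P Q"
  obtains R U V where "R \<noteq> 0" "[:R:] = U * P + V * Q"
proof -
  have nz: "P \<noteq> 0 \<or> Q \<noteq> 0" using assms by auto
  then have "fract_poly P \<noteq> 0 \<or> fract_poly Q \<noteq> 0" by simp
  then obtain u v d where d: "d = u * fract_poly P + v * fract_poly Q" "d \<noteq> 0" "d dvd fract_poly P" "d dvd fract_poly Q"
    by (rule field_poly_bezout)
  define D where "D = primitive_part_fract d"
  have D: "smult (fract_content d) (fract_poly D) = d" unfolding D_def by (rule content_times_primitive_part_fract)
  have cD: "content D = 1" unfolding D_def using d(2) by (rule content_primitive_part_fract)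
  have "fract_poly D dvd smult (fract_content d) (fract_poly D)" by (rule dvd_smult) simp
  then have "fract_poly D dvd d" by (simp only: D)
  then have "D dvd P" "D dvd Q" using fract_poly_dvdD[OF _ cD] d(3,4) dvd_trans by blast+
  then have "is_unit D" using assms coprime_common_divisor by blast
  then have "degree (smult (fract_content d) (fract_poly D)) = 0" using degree_map_poly_le[of to_fract D] by (simp add: poly_dvd_1)
  then have "degree d = 0" by (simp only: D)
  then obtain c where c: "d = [:c:]" by (rule degree_eq_zeroE)
  obtain r U where r: "r \<noteq> 0" "smult (to_fract r) (smult (inverse c) u) = fract_poly U" by (rule clear_denominators)
  obtain s V where s: "s \<noteq> 0" "smult (to_fract s) (smult (inverse c) v) = fract_poly V" by (rule clear_denominators)
  have c0: "c \<noteq> 0" using c d(2) by auto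
  define k where "k = to_fract r * to_fract s * inverse c"
  have 1: "smult (to_fract s) (fract_poly U) = smult k u" "smult (to_fract r) (fract_poly V) = smult k v"
    unfolding r(2)[symmetric] s(2)[symmetric] k_def smult_smult by (simp_all only: mult_ac)
  have "fract_poly (smult s U * P + smult r V * Q) = smult k u * fract_poly P + smult k v * fract_poly Q"
    unfolding 1[symmetric] by (simp only: fract_poly_add fract_poly_mult fract_poly_smult)
  also have "\<dots> = smult k d" unfolding d(1) by (simp only: smult_add_right mult_smult_left)
  also have "\<dots> = fract_poly [:r * s:]"
    unfolding c k_def using c0 by (simp add: Polynomial.map_poly_pCons)
  finally have "smult s U * P + smult r V * Q = [:r * s:]" by (simp only: fract_poly_eq_iff)
  then show thesis using that[of "r * s" "smult s U" "smult r V"] r(1) s(1) by simp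
qed

lemma eval2_eq_poly_y: "eval2 p a b = poly (map_poly (\<lambda>c. poly c a) p) b"
  by (induction p) (simp_all add: Polynomial.map_poly_pCons)

lemma eval2_power [simp]: "eval2 (p ^ n) a b = eval2 p a b ^ n"
  by (induction n) simp_all

text \<open>Elimination leaves finitely many first coordinates \<open>a\<close>. On a line \<open>x = a\<close> there are finitely
many common zeros since otherwise both polynomials would be divisible by \<open>x - a\<close>.\<close>

lemma finite_singularities:
  assumes "coprime P Q"
  shows "finite {(a, b). eval2 P a b = 0 \<and> eval2 Q a b = 0}"
proof -
  obtain R U V where R: "R \<noteq> 0" "[:R:] = U * P + V * Q" using assms by (rule coprime_elimination)
  have a: "poly R a = 0" if "eval2 P a b = 0" "eval2 Q a b = 0" for a b
  proof -
    have "eval2 [:R:] a b = 0" unfolding R(2) using that by simp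
    then show ?thesis by simp
  qed
  have fin: "finite {b. eval2 P a b = 0 \<and> eval2 Q a b = 0}" for a
  proof -
    have "[:[:-a, 1:]:] dvd p" if "map_poly (\<lambda>c. poly c a) p = 0" for p
    proof (rule const_poly_dvd_iff[THEN iffD2], rule allI)
      fix i
      have "coeff (map_poly (\<lambda>c. poly c a) p) i = 0" using that by simp
      then show "[:-a, 1:] dvd coeff p i" by (simp add: coeff_map_poly poly_eq_0_iff_dvd)
    qed
    moreover have "\<not> is_unit [:[:-a, 1:]:]" by (auto simp: is_unit_const_poly_iff is_unit_poly_iff)
    ultimately have "map_poly (\<lambda>c. poly c a) P \<noteq> 0 \<or> map_poly (\<lambda>c. poly c a) Q \<noteq> 0"
      using coprime_common_divisor[OF assms] by blast
    then have "finite {b. poly (map_poly (\<lambda>c. poly c a) P) b = 0} \<or> finite {b. poly (map_poly (\<lambda>c. poly c a) Q) b = 0}"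
      using poly_roots_finite by blast
    then show ?thesis unfolding eval2_eq_poly_y by (rule disjE) (erule rev_finite_subset; blast)+
  qed
  define Z where "Z a = {b. eval2 P a b = 0 \<and> eval2 Q a b = 0}" for a
  have "finite (Sigma {a. poly R a = 0} Z)"
  proof (rule finite_SigmaI)
    show "finite {a. poly R a = 0}" using R(1) by (rule poly_roots_finite)
    show "finite (Z a)" for a unfolding Z_def by (rule fin)
  qed
  moreover have "{(a, b). eval2 P a b = 0 \<and> eval2 Q a b = 0} \<subseteq> Sigma {a. poly R a = 0} Z"
    unfolding Z_def using a by blast
  ultimately show ?thesis by (rule rev_finite_subset)
qed

text \<open>The line \<open>y = m x + k\<close> is the point \<open>(m/k, -1/k)\<close> of the chart of the dual plane that the
Gauss map uses. Clearing the denominator \<open>k\<close> turns a curve in that chart into a polynomial condition on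
the parameters of the line.\<close>

lemma homogenize:
  obtains p' n where "\<And>m k. k \<noteq> 0 \<Longrightarrow> eval2 p' m k = k ^ n * eval2 p (m / k) (- 1 / k)"
proof -
  have 1: "\<exists>n r'. \<forall>m k. k \<noteq> 0 \<longrightarrow> eval2 r' m k = k ^ n * poly r (m / k)" for r :: "complex poly"
  proof (induction r)
    case 0
    show ?case by (rule exI[of _ 0], rule exI[of _ 0]) simp
  next
    case (pCons c r)
    then obtain n r' where "\<forall>m k. k \<noteq> 0 \<longrightarrow> eval2 r' m k = k ^ n * poly r (m / k)" by blast
    then have "eval2 ([:[:c:]:] * polyY ^ Suc n + polyX * r') m k = k ^ Suc n * poly (pCons c r) (m / k)" if k: "k \<noteq> 0" for m k
    proof -
      have "eval2 ([:[:c:]:] * polyY ^ Suc n + polyX * r') m k = c * k ^ Suc n + m * eval2 r' m k"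
        by (simp only: eval2_simps eval2_power) simp
      also have "\<dots> = k ^ Suc n * (c + m / k * poly r (m / k))"
        using k by (simp add: \<open>\<forall>m k. k \<noteq> 0 \<longrightarrow> eval2 r' m k = k ^ n * poly r (m / k)\<close> distrib_left)
      finally show ?thesis by simp
    qed
    then show ?case by blast
  qed
  have alg: "k ^ Suc n * (k ^ l * R) - k ^ l * (k ^ n * S) = k ^ Suc (n + l) * (R + (- 1 / k) * S)"
    if "k \<noteq> 0" for k R S :: complex and n l
    using that by (simp add: field_simps power_add)
  have "\<exists>n p'. \<forall>m k. k \<noteq> 0 \<longrightarrow> eval2 p' m k = k ^ n * eval2 p (m / k) (- 1 / k)"
  proof (induction p)
    case 0
    show ?case by (rule exI[of _ 0], rule exI[of _ 0]) simp
  next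
    case (pCons r p)
    then obtain n p' where p: "\<forall>m k. k \<noteq> 0 \<longrightarrow> eval2 p' m k = k ^ n * eval2 p (m / k) (- 1 / k)" by blast
    obtain l r' where r: "\<forall>m k. k \<noteq> 0 \<longrightarrow> eval2 r' m k = k ^ l * poly r (m / k)" using 1 by blast
    have "eval2 (polyY ^ Suc n * r' - polyY ^ l * p') m k = k ^ Suc (n + l) * eval2 (pCons r p) (m / k) (- 1 / k)"
      if k: "k \<noteq> 0" for m k
    proof -
      have "eval2 (polyY ^ Suc n * r' - polyY ^ l * p') m k = k ^ Suc n * eval2 r' m k - k ^ l * eval2 p' m k"
        by (simp only: eval2_simps eval2_power) simp
      also have "\<dots> = k ^ Suc n * (k ^ l * poly r (m / k)) - k ^ l * (k ^ n * eval2 p (m / k) (- 1 / k))"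
        using p r k by simp
      also have "\<dots> = k ^ Suc (n + l) * (poly r (m / k) + (- 1 / k) * eval2 p (m / k) (- 1 / k))"
        by (rule alg[OF k])
      finally show ?thesis by simp
    qed
    then show ?case by blast
  qed
  then show thesis using that by blast
qed

text \<open>The tangent line at \<open>(a, b)\<close> as a point of the affine chart of the dual plane.\<close>

definition gauss_value :: "complex poly poly \<Rightarrow> complex poly poly \<Rightarrow> complex \<Rightarrow> complex \<Rightarrow> complex \<Rightarrow> complex \<Rightarrow> bool" where
  "gauss_value P Q a b u v \<longleftrightarrow> eval2 (polyX * Q - polyY * P) a b \<noteq> 0 \<and>
      eval2 (- Q) a b / eval2 (polyX * Q - polyY * P) a b = u \<and>
      eval2 P a b / eval2 (polyX * Q - polyY * P) a b = v"

text \<open>A generic line is not in the given curve \<open>B = 0\<close> of the dual plane and avoids the finitely many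
singularities. So at each of its \<open>d\<close> tangency points the tangent line exists and is the line itself.\<close>

lemma generic_line_two_tangencies:
  assumes "coprime P Q" "foliation_degree P Q d" "d \<ge> 3" "B \<noteq> 0"
  obtains u v a b a' b' where "eval2 B u v \<noteq> 0" "a \<noteq> a'" "gauss_value P Q a b u v" "gauss_value P Q a' b' u v"
proof -
  obtain H where H: "H \<noteq> 0" "\<And>m k. eval2 H m k \<noteq> 0 \<Longrightarrow>
      finite {(a, b). b = m * a + k \<and> eval2 Q a b = m * eval2 P a b} \<and>
      card {(a, b). b = m * a + k \<and> eval2 Q a b = m * eval2 P a b} = d"
    using assms(2) unfolding foliation_degree_def Let_def by blast
  obtain B' n where B': "\<And>m k. k \<noteq> 0 \<Longrightarrow> eval2 B' m k = k ^ n * eval2 B (m / k) (- 1 / k)"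
    using homogenize[of B] by blast
  have "B' \<noteq> 0"
  proof
    assume B0: "B' = 0"
    have "eval2 B u v = 0" if "v \<noteq> 0" for u v
      using B'[of "- 1 / v" "- u / v"] that by (simp add: B0)
    then have "eval2 (B * polyY) u v = 0" for u v by (cases "v = 0") auto
    then show False using nonzero_eval2[of "B * polyY"] assms(4) by auto
  qed
  define S where "S = {(a, b). eval2 P a b = 0 \<and> eval2 Q a b = 0}"
  have S: "finite S" unfolding S_def using assms(1) by (rule finite_singularities)
  \<comment> \<open>The factors of \<open>E\<close> keep the line off the curve, off the origin, among the lines with \<open>d\<close> tangencies, and off the singularities.\<close>
  define E where "E = B' * polyY * H * (\<Prod>(a,b)\<in>S. [:[:b, - a:], - 1:])"
  have "E \<noteq> 0" using \<open>B' \<noteq> 0\<close> H(1) S by (auto simp: E_def)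
  then obtain m k where mk: "eval2 E m k \<noteq> 0" by (rule nonzero_eval2)
  have prod: "eval2 (\<Prod>(a,b)\<in>S. [:[:b, - a:], - 1:]) m k = (\<Prod>(a,b)\<in>S. b - m * a - k)"
    using S by (induction S rule: finite_induct) (auto simp: algebra_simps)
  have k: "k \<noteq> 0" and Bmk: "eval2 B (m / k) (- 1 / k) \<noteq> 0" and Hmk: "eval2 H m k \<noteq> 0"
    and nsing: "\<And>a b. (a, b) \<in> S \<Longrightarrow> b \<noteq> m * a + k"
    using mk B'[of k m] S by (auto simp: E_def prod)
  define T where "T = {(a, b). b = m * a + k \<and> eval2 Q a b = m * eval2 P a b}"
  have T: "finite T" "card T = d" using H(2)[OF Hmk] unfolding T_def by auto
  have "\<not> card T \<le> 1" using T assms(3) by simp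
  then obtain s t where st: "s \<in> T" "t \<in> T" "s \<noteq> t" using card_le_Suc0_iff_eq[OF T(1)] by auto
  obtain a b a' b' where ab: "s = (a, b)" "t = (a', b')" by (cases s, cases t)
  have *: "gauss_value P Q \<alpha> \<beta> (m / k) (- 1 / k)" if "(\<alpha>, \<beta>) \<in> T" for \<alpha> \<beta>
  proof -
    have ab: "\<beta> = m * \<alpha> + k" "eval2 Q \<alpha> \<beta> = m * eval2 P \<alpha> \<beta>" using that unfolding T_def by auto
    have "eval2 P \<alpha> \<beta> \<noteq> 0" using nsing[of \<alpha> \<beta>] ab unfolding S_def by auto
    moreover have "eval2 (polyX * Q - polyY * P) \<alpha> \<beta> = - k * eval2 P \<alpha> \<beta>"
      using ab by (simp add: algebra_simps)
    ultimately show ?thesis unfolding gauss_value_def using k ab(2) by simp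
  qed
  have "a \<noteq> a'" using st unfolding ab T_def by auto
  have mem: "(a, b) \<in> T" "(a', b') \<in> T" using st(1,2) unfolding ab by simp_all
  show thesis by (rule that[OF Bmk \<open>a \<noteq> a'\<close> *[OF mem(1)] *[OF mem(2)]])
qed

abbreviation (input) gauss_vec :: "complex poly poly \<Rightarrow> complex poly poly \<Rightarrow> complex poly poly fract ^ 3" where
  "gauss_vec P Q \<equiv> vector [to_fract (- Q), to_fract P, to_fract (polyX * Q - polyY * P)]"

text \<open>Every curve in the dual plane misses the Gauss image of some point, so the Gauss map is dominant. If \<open>x\<close>
were a rational function of the tangent line, two tangency points of a common generic line would have the same first
coordinate; on a line \<open>y = m x + k\<close> they would be equal.\<close>

lemma gauss_dominant:
  assumes "coprime P Q" "foliation_degree P Q d" "d \<ge> 3"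
  shows "P2.dominant (gauss_vec P Q)" "range (P2.pullback (gauss_vec P Q)) \<noteq> UNIV"
proof -
  define w where "w = gauss_vec P Q"
  have w: "w $ 1 = to_fract (- Q)" "w $ 2 = to_fract P" "w $ 3 = to_fract (polyX * Q - polyY * P)"
    by (simp_all add: w_def del: to_fract_uminus to_fract_diff to_fract_mult)
  have val: "has_value (ev2 w p) a b (eval2 p u v)" if v: "gauss_value P Q a b u v" for a b p u v
  proof (rule has_value_ev2)
    have nz: "eval2 (polyX * Q - polyY * P) a b \<noteq> 0" using v by (simp add: gauss_value_def)
    show "has_value (w $ 1 / w $ 3) a b u" "has_value (w $ 2 / w $ 3) a b v"
      using has_valueI[OF nz, of "- Q"] has_valueI[OF nz, of P] v unfolding w gauss_value_def by metis+
  qed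
  show dom: "P2.dominant (gauss_vec P Q)"
    unfolding P2.dominant_def w_def[symmetric]
  proof (intro conjI allI impI)
    fix B :: "complex poly poly" assume B: "B \<noteq> 0"
    obtain u v a b a' b' where *: "eval2 B u v \<noteq> 0" "a \<noteq> a'" "gauss_value P Q a b u v" "gauss_value P Q a' b' u v"
      by (rule generic_line_two_tangencies[OF assms B])
    then show "ev2 w B \<noteq> 0" using val[OF *(3), of B] has_value_unique[OF _ has_value_cst[of 0 a b]] by auto
  next
    show "w \<noteq> 0"
    proof
      assume "w = 0"
      then have "to_fract (- Q) = 0" "to_fract P = 0" unfolding w[symmetric] by simp_all
      then have "P = 0" "Q = 0" by simp_all
      then show False using assms(1) by simp
    qed
  qed
  show "range (P2.pullback (gauss_vec P Q)) \<noteq> UNIV"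
  proof
    assume "range (P2.pullback (gauss_vec P Q)) = UNIV"
    then obtain h where h: "P2.pullback w h = xK" unfolding w_def by (metis UNIV_I imageE)
    obtain A B where AB: "h = to_fract A / to_fract B" "B \<noteq> 0" by (rule fract_as_quotient)
    then have "ev2 w A / ev2 w B = xK" using R2.pullback_frac[OF dom] h unfolding w_def by metis
    moreover have "ev2 w B \<noteq> 0" using dom AB(2) unfolding P2.dominant_def w_def by blast
    ultimately have eq: "ev2 w A = xK * ev2 w B" by (simp add: field_simps)
    obtain u v a b a' b' where *: "eval2 B u v \<noteq> 0" "a \<noteq> a'" "gauss_value P Q a b u v" "gauss_value P Q a' b' u v"
      by (rule generic_line_two_tangencies[OF assms AB(2)])
    have eqv: "eval2 A u v = \<alpha> * eval2 B u v" if g: "gauss_value P Q \<alpha> \<beta> u v" for \<alpha> \<beta>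
    proof -
      have "has_value xK \<alpha> \<beta> \<alpha>" using has_value_to_fract[of polyX \<alpha> \<beta>] by (simp add: xK_def)
      then have "has_value (ev2 w A) \<alpha> \<beta> (\<alpha> * eval2 B u v)" unfolding eq using val[OF g] by (rule has_value_mult)
      then show ?thesis using has_value_unique val[OF g] by blast
    qed
    have "a * eval2 B u v = a' * eval2 B u v" unfolding eqv[OF *(3), symmetric] by (rule eqv[OF *(4)])
    then show False using *(1,2) by simp
  qed
qed

section \<open>Infinitesimal automorphisms\<close>

lemma matrix_power_scaleR:
  fixes A :: "complex ^ 'n ^ 'n"
  shows "((**) (t *\<^sub>R A) ^^ n) (mat 1) = t ^ n *\<^sub>R ((**) A ^^ n) (mat 1)"
proof (induction n)
  case (Suc n)
  then show ?case
    by (simp add: vec_eq_iff matrix_matrix_mult_def scaleR_sum_right)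
qed simp

lemma matrix_power_bound:
  fixes A :: "complex ^ 'n ^ 'n"
  defines "C \<equiv> \<Sum>i\<in>UNIV. \<Sum>j\<in>UNIV. norm (A $ i $ j)"
  shows "norm (((**) A ^^ n) (mat 1) $ i $ j) \<le> C ^ n"
proof (induction n arbitrary: i j)
  case 0
  show ?case by (simp add: mat_def)
next
  case (Suc n)
  let ?B = "((**) A ^^ n) (mat 1)"
  have C0: "C \<ge> 0" unfolding C_def by (intro sum_nonneg) simp
  have "norm ((A ** ?B) $ i $ j) \<le> (\<Sum>k\<in>UNIV. norm (A $ i $ k * ?B $ k $ j))"
    by (simp add: matrix_matrix_mult_def norm_sum)
  also have "\<dots> \<le> (\<Sum>k\<in>UNIV. norm (A $ i $ k) * C ^ n)"
    unfolding norm_mult by (intro sum_mono mult_left_mono Suc.IH) simp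
  also have "\<dots> = (\<Sum>k\<in>UNIV. norm (A $ i $ k)) * C ^ n" by (simp add: sum_distrib_right)
  also have "\<dots> \<le> C * C ^ n"
    unfolding C_def by (intro mult_right_mono member_le_sum[of i UNIV "\<lambda>i. \<Sum>k\<in>UNIV. norm (A $ i $ k)"])
      (auto intro!: sum_nonneg zero_le_power)
  finally show ?case by simp
qed

text \<open>The entries of the matrix exponential are everywhere convergent power series, which reduces its derivative to that of
a power series.\<close>

lemma matrix_exp_entry:
  fixes A :: "complex ^ 'n ^ 'n"
  defines "a \<equiv> \<lambda>i j n. ((**) A ^^ n) (mat 1) $ i $ j / fact n"
  shows "summable (\<lambda>n. a i j n * z ^ n)"
    and "matrix_exp (t *\<^sub>R A) $ i $ j = (\<Sum>n. a i j n * of_real t ^ n)"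
proof -
  define C where "C = (\<Sum>i\<in>UNIV. \<Sum>j\<in>UNIV. norm (A $ i $ j))"
  have sm: "summable (\<lambda>n. a i j n * z ^ n)" for i j z
  proof (rule summable_comparison_test')
    show "summable (\<lambda>n. (C * norm z) ^ n /\<^sub>R fact n)" by (rule summable_exp_generic)
    fix n
    have "norm (a i j n * z ^ n) = norm (((**) A ^^ n) (mat 1) $ i $ j) * norm z ^ n / fact n"
      by (simp add: a_def norm_mult norm_divide norm_power)
    also have "\<dots> \<le> C ^ n * norm z ^ n / fact n"
      unfolding C_def by (intro divide_right_mono mult_right_mono matrix_power_bound) auto
    finally show "norm (a i j n * z ^ n) \<le> (C * norm z) ^ n /\<^sub>R fact n"
      by (simp add: power_mult_distrib divide_inverse mult.commute)
  qed
  then show "summable (\<lambda>n. a i j n * z ^ n)" .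
  define X where "X n = (1 / fact n :: real) *\<^sub>R (((**) (t *\<^sub>R A) ^^ n) (mat 1))" for n
  have X: "X n $ i $ j = a i j n * of_real t ^ n" for n i j
  proof -
    have "X n $ i $ j = (1 / fact n) *\<^sub>R (t ^ n *\<^sub>R ((**) A ^^ n) (mat 1) $ i $ j)"
      unfolding X_def matrix_power_scaleR by (simp only: vector_scaleR_component)
    then show ?thesis unfolding a_def by (simp only: scaleR_conv_of_real) simp
  qed
  define S where "S = (\<chi> i j. \<Sum>n. a i j n * of_real t ^ n)"
  have "X sums S" unfolding sums_def
  proof (intro vec_tendstoI)
    fix i j
    have "(\<lambda>n. \<Sum>k<n. a i j k * of_real t ^ k) \<longlonglongrightarrow> S $ i $ j"
      unfolding S_def using summable_sums[OF sm[of i j "of_real t"]] by (simp add: sums_def)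
    then show "(\<lambda>n. (\<Sum>k<n. X k) $ i $ j) \<longlonglongrightarrow> S $ i $ j" by (simp add: X)
  qed
  then have "matrix_exp (t *\<^sub>R A) = S" unfolding matrix_exp_def X_def by (rule sums_unique[symmetric])
  then show "matrix_exp (t *\<^sub>R A) $ i $ j = (\<Sum>n. a i j n * of_real t ^ n)" by (simp add: S_def)
qed

lemma matrix_exp_zero: "matrix_exp (0 *\<^sub>R A) = (mat 1 :: complex ^ 'n ^ 'n)"
proof -
  have "matrix_exp (0 *\<^sub>R A) $ i $ j = (mat 1 :: complex ^ 'n ^ 'n) $ i $ j" for i j
    unfolding matrix_exp_entry(2) using powser_zero[of "\<lambda>n. ((**) A ^^ n) (mat 1) $ i $ j / fact n"] by simp
  then show ?thesis by (simp add: vec_eq_iff)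
qed

lemma matrix_exp_derivative:
  "((\<lambda>t. matrix_exp (t *\<^sub>R A) $ i $ j) has_vector_derivative A $ i $ j) (at 0)"
proof -
  define a where "a n = ((**) A ^^ n) (mat 1) $ i $ j / fact n" for n
  have "((\<lambda>z. \<Sum>n. a n * z ^ n) has_field_derivative (\<Sum>n. diffs a n * 0 ^ n)) (at 0)"
    by (rule termdiffs_strong[of _ 1]) (use matrix_exp_entry(1)[of A i j 1] in \<open>simp_all add: a_def\<close>)
  also have "(\<Sum>n. diffs a n * 0 ^ n) = A $ i $ j" by (simp add: powser_zero diffs_def a_def)
  finally have "((\<lambda>t. \<Sum>n. a n * of_real t ^ n) has_vector_derivative A $ i $ j) (at 0)"
    using has_vector_derivative_real_field[of "\<lambda>z. \<Sum>n. a n * z ^ n" "A $ i $ j" 0 UNIV] by simp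
  then show ?thesis unfolding matrix_exp_entry(2) a_def .
qed

lemma eval2_derivative:
  assumes "(a has_vector_derivative a') (at t)" "(b has_vector_derivative b') (at t)"
  shows "((\<lambda>t. eval2 p (a t) (b t)) has_vector_derivative
     eval2 (map_poly pderiv p) (a t) (b t) * a' + eval2 (pderiv p) (a t) (b t) * b') (at t)"
proof (induction p)
  case 0
  show ?case by simp
next
  case (pCons r p)
  have "((poly r \<circ> a) has_vector_derivative (a' * poly (pderiv r) (a t))) (at t)"
    by (rule field_vector_diff_chain_at[OF assms(1)]) (rule poly_DERIV)
  then have 1: "((\<lambda>t. poly r (a t)) has_vector_derivative (a' * poly (pderiv r) (a t))) (at t)" by (simp add: o_def)
  have "((\<lambda>t. poly r (a t) + b t * eval2 p (a t) (b t)) has_vector_derivative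
     (a' * poly (pderiv r) (a t) + (b t * (eval2 (map_poly pderiv p) (a t) (b t) * a' + eval2 (pderiv p) (a t) (b t) * b')
        + b' * eval2 p (a t) (b t)))) (at t)"
    by (intro has_vector_derivative_add has_vector_derivative_mult 1 assms pCons.IH)
  then show ?case by (simp add: Polynomial.map_poly_pCons pderiv_pCons algebra_simps)
qed

lemma has_vector_derivative_quotient:
  fixes f g :: "real \<Rightarrow> complex"
  assumes "(f has_vector_derivative f') (at t)" "(g has_vector_derivative g') (at t)" "g t = 1"
  shows "((\<lambda>t. f t / g t) has_vector_derivative f' - f t * g') (at t)"
proof -
  have "((inverse \<circ> g) has_vector_derivative (g' * - (inverse (g t) ^ Suc (Suc 0)))) (at t)"
    by (rule field_vector_diff_chain_at[OF assms(2)]) (rule DERIV_inverse, simp add: assms(3))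
  then have "((\<lambda>t. inverse (g t)) has_vector_derivative - g') (at t)" by (simp add: o_def assms(3))
  from has_vector_derivative_mult[OF assms(1) this] show ?thesis by (simp add: divide_inverse assms(3) algebra_simps)
qed

text \<open>The rows of \<open>A (x, y, 1)\<^sup>T\<close>.\<close>

definition lin_poly :: "complex ^ 3 ^ 3 \<Rightarrow> 3 \<Rightarrow> complex poly poly" where
  "lin_poly A i = [:[:A $ i $ 1:]:] * polyX + [:[:A $ i $ 2:]:] * polyY + [:[:A $ i $ 3:]:]"

text \<open>The vector field that \<open>A\<close> induces on the affine chart: the flow of \<open>(x, y, 1)\<close> leaves the
plane \<open>z = 1\<close> with velocity \<open>(A X)\<^sub>3\<close>, and dividing by the third coordinate subtracts
\<open>(A X)\<^sub>3\<close> times the position.\<close>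

definition proj_field :: "complex ^ 3 ^ 3 \<Rightarrow> complex poly poly \<Rightarrow> complex poly poly" where
  "proj_field A p = (lin_poly A 1 - polyX * lin_poly A 3) * map_poly pderiv p + (lin_poly A 2 - polyY * lin_poly A 3) * pderiv p"

lemma eval2_lin_poly: "eval2 (lin_poly A i) a b = A $ i $ 1 * a + A $ i $ 2 * b + A $ i $ 3"
  by (simp add: lin_poly_def algebra_simps)

text \<open>The homogeneous coordinates of the tangent line, as a linear form that vanishes on it.\<close>

definition gauss_poly :: "complex poly poly \<Rightarrow> complex poly poly \<Rightarrow> 3 \<Rightarrow> complex poly poly" where
  "gauss_poly P Q i = (if i = 1 then - Q else if i = 2 then P else polyX * Q - polyY * P)"

lemma gauss_poly_simps [simp]:
  "gauss_poly P Q 1 = - Q" "gauss_poly P Q 2 = P" "gauss_poly P Q 3 = polyX * Q - polyY * P"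
  by (simp_all add: gauss_poly_def)

text \<open>A vector \<open>v\<close> of the tangent line at \<open>X\<close> is carried by \<open>exp (t A)\<close> to the
tangent line at the image of \<open>X\<close>. So the linear form of the tangent line along the orbit of
\<open>X\<close> vanishes on \<open>exp (t A) v\<close>, for all small \<open>t\<close>; the formula is the derivative
at \<open>t = 0\<close>.\<close>

lemma infinitesimal_invariance:
  assumes A: "A \<in> lie_algebra (Aut_SL P Q)" and ns: "nonsingular P Q a b"
    and v: "(\<Sum>i\<in>UNIV. eval2 (gauss_poly P Q i) a b * v $ i) = 0"
  shows "(\<Sum>i\<in>UNIV. eval2 (gauss_poly P Q i) a b * (A *v v) $ i + eval2 (proj_field A (gauss_poly P Q i)) a b * v $ i) = 0"
proof -
  define X :: "complex ^ 3" where "X = vector [a, b, 1]"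
  have X: "X $ 1 = a" "X $ 2 = b" "X $ 3 = 1" by (simp_all add: X_def)
  define M where "M t = matrix_exp (t *\<^sub>R A)" for t :: real
  have M0: "M 0 = mat 1" unfolding M_def by (rule matrix_exp_zero)
  have dM: "((\<lambda>t. (M t *v w) $ i) has_vector_derivative (A *v w) $ i) (at 0)" for w i
    unfolding matrix_vector_mult_def M_def
    by (simp, intro has_vector_derivative_sum has_vector_derivative_mult_left matrix_exp_derivative)
  define z where "z t = M t *v X" for t
  have z0: "z 0 = X" by (simp add: z_def M0)
  have dz: "((\<lambda>t. z t $ i) has_vector_derivative (A *v X) $ i) (at 0)" for i
    unfolding z_def by (rule dM)
  define \<alpha> \<beta> where "\<alpha> t = z t $ 1 / z t $ 3" and "\<beta> t = z t $ 2 / z t $ 3" for t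
  have d\<alpha>: "(\<alpha> has_vector_derivative (A *v X) $ 1 - a * (A *v X) $ 3) (at 0)"
    unfolding \<alpha>_def using has_vector_derivative_quotient[OF dz[of 1] dz[of 3]] by (simp add: z0 X)
  have d\<beta>: "(\<beta> has_vector_derivative (A *v X) $ 2 - b * (A *v X) $ 3) (at 0)"
    unfolding \<beta>_def using has_vector_derivative_quotient[OF dz[of 2] dz[of 3]] by (simp add: z0 X)
  have 0: "\<alpha> 0 = a" "\<beta> 0 = b" by (simp_all add: \<alpha>_def \<beta>_def z0 X)
  have V: "eval2 (lin_poly A i) a b = (A *v X) $ i" for i
    by (simp add: eval2_lin_poly matrix_vector_mult_def sum_3 X)
  have dN: "((\<lambda>t. eval2 p (\<alpha> t) (\<beta> t)) has_vector_derivative eval2 (proj_field A p) a b) (at 0)" for p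
    using eval2_derivative[OF d\<alpha> d\<beta>, of p] by (simp add: 0 proj_field_def V algebra_simps)
  have cont: "((\<lambda>t. eval2 p (\<alpha> t) (\<beta> t)) \<longlongrightarrow> eval2 p a b) (at 0)" for p
    using has_vector_derivative_continuous[OF dN[of p]] by (simp add: continuous_within 0)
  have "((\<lambda>t. z t $ 3) \<longlongrightarrow> 1) (at 0)"
    using has_vector_derivative_continuous[OF dz[of 3]] by (simp add: continuous_within z0 X)
  then have ev1: "\<forall>\<^sub>F t in at 0. z t $ 3 \<noteq> 0" by (rule tendsto_imp_eventually_ne) simp
  have ev2: "\<forall>\<^sub>F t in at 0. nonsingular P Q (\<alpha> t) (\<beta> t)"
  proof (cases "eval2 P a b = 0")
    case True
    then have "eval2 Q a b \<noteq> 0" using ns unfolding nonsingular_def by simp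
    from tendsto_imp_eventually_ne[OF cont this] show ?thesis
      by eventually_elim (simp add: nonsingular_def)
  next
    case False
    from tendsto_imp_eventually_ne[OF cont this] show ?thesis
      by eventually_elim (simp add: nonsingular_def)
  qed
  define \<phi> where "\<phi> t = (\<Sum>i\<in>UNIV. eval2 (gauss_poly P Q i) (\<alpha> t) (\<beta> t) * (M t *v v) $ i)" for t
  have "\<forall>\<^sub>F t in at 0. \<phi> t = 0" using ev1 ev2
  proof eventually_elim
    case (elim t)
    have "M t *v X = z t $ 3 *s vector [\<alpha> t, \<beta> t, 1]"
      using elim(1) by (simp add: z_def[symmetric] vec_eq_iff forall_3 \<alpha>_def \<beta>_def)
    moreover have "preserves_foliation (M t) P Q"
      using A unfolding lie_algebra_def Aut_SL_def M_def by simp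
    ultimately have img: "(\<lambda>v. M t *v v) ` tangent_line P Q a b = tangent_line P Q (\<alpha> t) (\<beta> t)"
      using ns elim unfolding preserves_foliation_def X_def by blast
    have "v \<in> tangent_line P Q a b"
      using v unfolding tangent_line_eq[OF ns] by (simp add: sum_3)
    then have "M t *v v \<in> tangent_line P Q (\<alpha> t) (\<beta> t)" using img by blast
    then show ?case unfolding tangent_line_eq[OF elim(2)] \<phi>_def by (simp add: sum_3)
  qed
  moreover have "\<phi> 0 = 0" using v by (simp add: \<phi>_def 0 M0)
  ultimately have "\<forall>\<^sub>F t in nhds 0. t \<in> UNIV \<longrightarrow> \<phi> t = 0"
    unfolding eventually_at_filter by (auto elim: eventually_mono)
  then have "(\<phi> has_vector_derivative 0) (at 0) \<longleftrightarrow> ((\<lambda>_. 0 :: complex) has_vector_derivative 0) (at (0::real))"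
    using has_vector_derivative_cong_ev[where f = \<phi> and g = "\<lambda>_. 0" and x = 0 and S = UNIV] \<open>\<phi> 0 = 0\<close> by blast
  then have "(\<phi> has_vector_derivative 0) (at 0)" by simp
  moreover have "(\<phi> has_vector_derivative (\<Sum>i\<in>UNIV. eval2 (gauss_poly P Q i) (\<alpha> 0) (\<beta> 0) * (A *v v) $ i +
      eval2 (proj_field A (gauss_poly P Q i)) a b * (M 0 *v v) $ i)) (at 0)"
    unfolding \<phi>_def by (intro has_vector_derivative_sum has_vector_derivative_mult dN dM)
  ultimately show ?thesis using vector_derivative_unique_at[of \<phi> 0 0] by (auto simp: 0 M0)
qed

text \<open>The derivative of the determinant at the identity is the trace, and the determinant is constant along the
one-parameter group.\<close>

lemma lie_algebra_trace:
  assumes A: "A \<in> lie_algebra (Aut_SL P Q)"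
  shows "A $ 1 $ 1 + A $ 2 $ 2 + A $ 3 $ 3 = 0"
proof -
  define M where "M t = matrix_exp (t *\<^sub>R A)" for t :: real
  have M0: "M 0 = mat 1" unfolding M_def by (rule matrix_exp_zero)
  have dM: "((\<lambda>t. M t $ i $ j) has_vector_derivative A $ i $ j) (at 0)" for i j
    unfolding M_def by (rule matrix_exp_derivative)
  have d3: "((\<lambda>t. M t $ i $ j * M t $ k $ l * M t $ m $ n) has_vector_derivative
      (M 0 $ i $ j * M 0 $ k $ l) * A $ m $ n + (M 0 $ i $ j * A $ k $ l + A $ i $ j * M 0 $ k $ l) * M 0 $ m $ n) (at 0)"
    for i j k l m n by (intro has_vector_derivative_mult dM)
  have "M t \<in> Aut_SL P Q" for t using A unfolding lie_algebra_def M_def by simp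
  then have "Determinants.det (M t) = 1" for t unfolding Aut_SL_def by simp
  then have "(\<lambda>t. Determinants.det (M t)) = (\<lambda>_. 1)" by auto
  then have "((\<lambda>t. Determinants.det (M t)) has_vector_derivative 0) (at 0)" by simp
  then have 1: "((\<lambda>t. M t $ 1 $ 1 * M t $ 2 $ 2 * M t $ 3 $ 3 + M t $ 1 $ 2 * M t $ 2 $ 3 * M t $ 3 $ 1 +
      M t $ 1 $ 3 * M t $ 2 $ 1 * M t $ 3 $ 2 - M t $ 1 $ 1 * M t $ 2 $ 3 * M t $ 3 $ 2 -
      M t $ 1 $ 2 * M t $ 2 $ 1 * M t $ 3 $ 3 - M t $ 1 $ 3 * M t $ 2 $ 2 * M t $ 3 $ 1) has_vector_derivative 0) (at 0)"
    unfolding det_3 .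
  have m1: "M 0 $ i $ j = (if i = j then 1 else 0)" for i j by (simp add: M0 mat_def)
  from vector_derivative_unique_at[OF 1 has_vector_derivative_diff[OF has_vector_derivative_diff[OF has_vector_derivative_diff[OF
      has_vector_derivative_add[OF has_vector_derivative_add[OF d3 d3] d3] d3] d3] d3]]
  show ?thesis by (simp add: m1 algebra_simps)
qed

text \<open>The equations say that the vector \<open>W = D N + A\<^sup>T N\<close> is parallel to \<open>N\<close>. At a
non-singular point the linear form \<open>W\<close> vanishes on the kernel of \<open>N\<close> by
\<open>infinitesimal_invariance\<close>, and at a singular point \<open>N\<close> vanishes; a polynomial that is zero
at all points is zero.\<close>

lemma invariance_polynomial:
  assumes A: "A \<in> lie_algebra (Aut_SL P Q)"
  defines "W \<equiv> \<lambda>i. proj_field A (gauss_poly P Q i) + (\<Sum>k\<in>UNIV. [:[:A $ k $ i:]:] * gauss_poly P Q k)"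
  shows "W i * gauss_poly P Q j = W j * gauss_poly P Q i"
proof -
  have "eval2 (W i * gauss_poly P Q j - W j * gauss_poly P Q i) a b = 0" for a b
  proof (cases "nonsingular P Q a b")
    case False
    then have "eval2 (gauss_poly P Q k) a b = 0" for k
      using exhaust_3[of k] by (auto simp: nonsingular_def)
    then show ?thesis by simp
  next
    case True
    define N where "N k = eval2 (gauss_poly P Q k) a b" for k
    \<comment> \<open>The vector with entries \<open>N j\<close> at \<open>i\<close> and \<open>- N i\<close> at \<open>j\<close> lies in the kernel of \<open>N\<close>, and evaluating there gives the two by two minor.\<close>
    define v :: "complex ^ 3" where "v = (\<chi> k. (if k = i then N j else 0) - (if k = j then N i else 0))"
    have sum: "(\<Sum>k\<in>UNIV. f k * v $ k) = f i * N j - f j * N i" for f :: "3 \<Rightarrow> complex"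
    proof -
      have "f k * v $ k = (if k = i then f k * N j else 0) - (if k = j then f k * N i else 0)" for k
        by (simp add: v_def right_diff_distrib)
      then show ?thesis by (simp add: sum_subtractf)
    qed
    have es: "eval2 (\<Sum>k\<in>UNIV. f k) a b = (\<Sum>k\<in>UNIV. eval2 (f k) a b)" for f :: "3 \<Rightarrow> complex poly poly"
      by (simp add: sum_3)
    have "(\<Sum>k\<in>UNIV. N k * v $ k) = 0" by (simp add: sum)
    then have "(\<Sum>k\<in>UNIV. N k * (A *v v) $ k + eval2 (proj_field A (gauss_poly P Q k)) a b * v $ k) = 0"
      using infinitesimal_invariance[OF A True, of v] unfolding N_def by simp
    then have "(\<Sum>k\<in>UNIV. N k * (A $ k $ i * N j - A $ k $ j * N i)) +
       (eval2 (proj_field A (gauss_poly P Q i)) a b * N j - eval2 (proj_field A (gauss_poly P Q j)) a b * N i) = 0"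
      by (simp only: sum.distrib sum matrix_vector_mult_def vec_lambda_beta)
    then show ?thesis by (simp add: W_def es N_def[symmetric] sum_3 algebra_simps del: gauss_poly_simps)
  qed
  then have "W i * gauss_poly P Q j - W j * gauss_poly P Q i = 0" using nonzero_eval2 by blast
  then show ?thesis by simp
qed

section \<open>Minimal polynomials and normal extensions\<close>

instance fract :: ("{idom, ring_char_0}") ring_char_0
proof
  show "inj (of_nat :: nat \<Rightarrow> 'a fract)"
  proof (rule injI)
    have of_nat: "of_nat n = (to_fract (of_nat n) :: 'a fract)" for n
      by (induction n) simp_all
    fix m n :: nat assume "(of_nat m :: 'a fract) = of_nat n"
    then show "m = n" by (simp add: of_nat)
  qed
qed

instance fract :: ("{idom, ring_char_0}") field_char_0 ..

definition splits :: "'k::field poly \<Rightarrow> bool" where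
  "splits p \<longleftrightarrow> (\<exists>c xs. p = smult c (\<Prod>x\<leftarrow>xs. [:-x, 1:]))"

text \<open>Linear factors are removed one at a time: a root of the product is a root of the divisor or of the cofactor.\<close>

lemma splits_dvd:
  assumes "p dvd q" "q \<noteq> 0" "splits q" shows "splits p"
proof -
  have "splits p" if "p dvd smult c (\<Prod>x\<leftarrow>xs. [:-x, 1:])" "c \<noteq> 0" for c xs and p :: "'a poly"
    using that(1)
  proof (induction xs arbitrary: p)
    case Nil
    then have "p dvd [:c:]" by simp
    then have "degree p = 0" using dvd_imp_degree_le[of p "[:c:]"] \<open>c \<noteq> 0\<close> by simp
    then obtain b where "p = [:b:]" by (rule degree_eq_zeroE)
    then show ?case unfolding splits_def by (intro exI[of _ b] exI[of _ "[]"]) simp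
  next
    case (Cons x xs)
    define R where "R = smult c (\<Prod>x\<leftarrow>xs. [:-x, 1:])"
    have eq: "smult c (\<Prod>x\<leftarrow>x # xs. [:-x, 1:]) = [:-x, 1:] * R" by (simp add: R_def mult.commute)
    obtain r where r: "[:-x, 1:] * R = p * r" using Cons.prems unfolding eq by (rule dvdE)
    have "poly p x * poly r x = poly ([:-x, 1:] * R) x" unfolding r by simp
    then have "poly p x = 0 \<or> poly r x = 0" by simp
    then show ?case
    proof
      assume "poly p x = 0"
      then obtain p' where p': "p = [:-x, 1:] * p'" unfolding poly_eq_0_iff_dvd by (rule dvdE)
      then have "[:-x, 1:] * R = [:-x, 1:] * (p' * r)" using r by (simp only: mult.assoc)
      then have "R = p' * r" by (subst (asm) mult_left_cancel) simp_all
      then have "splits p'" using Cons.IH[of p'] unfolding R_def by simp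
      then obtain b ys where "p' = smult b (\<Prod>x\<leftarrow>ys. [:-x, 1:])" unfolding splits_def by blast
      then have "p = smult b (\<Prod>x\<leftarrow>x # ys. [:-x, 1:])" using p' by (simp add: mult.commute)
      then show ?thesis unfolding splits_def by blast
    next
      assume "poly r x = 0"
      then obtain r' where r': "r = [:-x, 1:] * r'" unfolding poly_eq_0_iff_dvd by (rule dvdE)
      then have "[:-x, 1:] * R = [:-x, 1:] * (p * r')" using r by (simp only: mult_ac)
      then have "R = p * r'" by (subst (asm) mult_left_cancel) simp_all
      then show ?thesis using Cons.IH[of p] unfolding R_def by simp
    qed
  qed
  moreover obtain c xs where q: "q = smult c (\<Prod>x\<leftarrow>xs. [:-x, 1:])" using assms(3) unfolding splits_def by blast
  moreover have "c \<noteq> 0" using q assms(2) by auto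
  ultimately show ?thesis using assms(1) by blast
qed

lemma splits_prod_set: "finite S \<Longrightarrow> splits (\<Prod>x\<in>S. [:-x, 1:])"
proof -
  assume "finite S"
  then obtain xs where xs: "set xs = S" "distinct xs" using finite_distinct_list by blast
  have "(\<Prod>x\<in>S. [:-x, 1:]) = smult 1 (\<Prod>x\<leftarrow>xs. [:-x, 1:])"
    unfolding xs(1)[symmetric] by (simp add: prod.distinct_set_conv_list[OF xs(2)])
  then show ?thesis unfolding splits_def by blast
qed

lemma map_poly_hom_simps:
  assumes "field_hom \<gamma>"
  shows "map_poly \<gamma> (p + q) = map_poly \<gamma> p + map_poly \<gamma> q" "map_poly \<gamma> (p * q) = map_poly \<gamma> p * map_poly \<gamma> q"
    "map_poly \<gamma> (smult c p) = smult (\<gamma> c) (map_poly \<gamma> p)" "map_poly \<gamma> (pCons c p) = pCons (\<gamma> c) (map_poly \<gamma> p)"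
    "poly (map_poly \<gamma> p) (\<gamma> x) = \<gamma> (poly p x)" "map_poly \<gamma> (pderiv p) = pderiv (map_poly \<gamma> p)"
    "degree (map_poly \<gamma> p) = degree p" "map_poly \<gamma> p = 0 \<longleftrightarrow> p = 0" "map_poly \<gamma> 1 = 1" "coeff (map_poly \<gamma> p) i = \<gamma> (coeff p i)"
    "map_poly \<gamma> (p - q) = map_poly \<gamma> p - map_poly \<gamma> q"
proof -
  interpret g: field_hom \<gamma> by fact
  interpret m: map_poly_idom_hom \<gamma> ..
  have z: "\<gamma> x = 0 \<longleftrightarrow> x = 0" for x using field_hom_eq_0_iff[OF assms] .
  show c: "coeff (map_poly \<gamma> p) i = \<gamma> (coeff p i)" for p i by (simp add: coeff_map_poly)
  show "map_poly \<gamma> (p + q) = map_poly \<gamma> p + map_poly \<gamma> q" "map_poly \<gamma> (p * q) = map_poly \<gamma> p * map_poly \<gamma> q"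
    "map_poly \<gamma> (p - q) = map_poly \<gamma> p - map_poly \<gamma> q" "map_poly \<gamma> 1 = 1"
    by (simp_all add: m.hom_add m.hom_mult m.hom_minus m.hom_one)
  show "map_poly \<gamma> (smult c p) = smult (\<gamma> c) (map_poly \<gamma> p)" "map_poly \<gamma> (pCons c p) = pCons (\<gamma> c) (map_poly \<gamma> p)"
    "poly (map_poly \<gamma> p) (\<gamma> x) = \<gamma> (poly p x)" "map_poly \<gamma> (pderiv p) = pderiv (map_poly \<gamma> p)"
    by (simp_all add: g.map_poly_hom_smult g.map_poly_pCons_hom g.map_poly_pderiv)
  show "degree (map_poly \<gamma> p) = degree p" by (rule Polynomial.degree_map_poly) (simp add: z)
  show "map_poly \<gamma> p = 0 \<longleftrightarrow> p = 0" by (simp add: poly_eq_iff c z)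
qed

text \<open>A subfield that is the range of a homomorphism can be replaced by the source of the homomorphism, where polynomials
can be divided with remainder. All statements on irreducible polynomials over a subfield are proved in this way.\<close>

lemma polys_over_range:
  assumes "field_hom \<gamma>" shows "p \<in> polys_over (range \<gamma>) \<longleftrightarrow> (\<exists>p0. p = map_poly \<gamma> p0)"
proof
  interpret g: field_hom \<gamma> by fact
  note inj = field_hom_inj[OF assms]
  assume p: "p \<in> polys_over (range \<gamma>)"
  have "p = map_poly \<gamma> (map_poly (inv_into UNIV \<gamma>) p)"
  proof (rule poly_eqI)
    fix i
    have "inv_into UNIV \<gamma> 0 = 0" using inv_f_f[OF inj, of 0] by simp
    then show "coeff p i = coeff (map_poly \<gamma> (map_poly (inv_into UNIV \<gamma>) p)) i"
      using p unfolding polys_over_def by (simp add: coeff_map_poly f_inv_into_f)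
  qed
  then show "\<exists>p0. p = map_poly \<gamma> p0" ..
next
  assume "\<exists>p0. p = map_poly \<gamma> p0"
  then show "p \<in> polys_over (range \<gamma>)" unfolding polys_over_def using map_poly_hom_simps(10)[OF assms] by auto
qed

lemma irreducible_over_range:
  assumes g: "field_hom \<gamma>" and "irreducible_over (range \<gamma>) p"
  obtains p0 where "p = map_poly \<gamma> p0" "degree p0 > 0" "\<forall>q r. p0 = q * r \<longrightarrow> degree q = 0 \<or> degree r = 0"
proof -
  obtain p0 where p0: "p = map_poly \<gamma> p0" using assms polys_over_range unfolding irreducible_over_def by blast
  have "degree p0 > 0" using assms(2) p0 map_poly_hom_simps(7)[OF g] unfolding irreducible_over_def by metis
  moreover have "degree q = 0 \<or> degree r = 0" if "p0 = q * r" for q r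
    using assms(2) that p0 map_poly_hom_simps(2,7)[OF g] polys_over_range[OF g] unfolding irreducible_over_def by metis
  ultimately show thesis using that p0 by blast
qed

text \<open>The greatest common divisor over the small field has the common root, so it is not constant, and by irreducibility it
is the first polynomial.\<close>

lemma irreducible_over_dvd:
  assumes g: "field_hom \<gamma>" and p: "irreducible_over (range \<gamma>) p" and q: "q \<in> polys_over (range \<gamma>)"
    and "poly p \<beta> = 0" "poly q \<beta> = 0"
  shows "p dvd q"
proof -
  obtain p0 where p0: "p = map_poly \<gamma> p0" "degree p0 > 0" "\<forall>q r. p0 = q * r \<longrightarrow> degree q = 0 \<or> degree r = 0"
    by (rule irreducible_over_range[OF g p])
  obtain q0 where q0: "q = map_poly \<gamma> q0" using q polys_over_range[OF g] by blast
  have "p0 \<noteq> 0" using p0(2) by auto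
  then have "p0 \<noteq> 0 \<or> q0 \<noteq> 0" ..
  then obtain u v d where d: "d = u * p0 + v * q0" "d \<noteq> 0" "d dvd p0" "d dvd q0" by (rule field_poly_bezout)
  have "map_poly \<gamma> d = map_poly \<gamma> u * p + map_poly \<gamma> v * q"
    by (simp only: d(1) map_poly_hom_simps(1,2)[OF g] p0(1) q0)
  then have d\<beta>: "poly (map_poly \<gamma> d) \<beta> = 0" using assms(4,5) by simp
  have "degree d \<noteq> 0"
  proof
    assume "degree d = 0"
    then obtain c where c: "d = [:c:]" by (rule degree_eq_zeroE)
    then have "map_poly \<gamma> d = [:\<gamma> c:]" by (simp add: map_poly_hom_simps(4)[OF g])
    then have "\<gamma> c = 0" using d\<beta> by simp
    then show False using c d(2) field_hom_eq_0_iff[OF g] by simp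
  qed
  obtain e where e: "p0 = d * e" using d(3) by (rule dvdE)
  then have "degree e = 0" using p0(3)[rule_format, OF e] \<open>degree d \<noteq> 0\<close> by simp
  then obtain c where c: "e = [:c:]" by (rule degree_eq_zeroE)
  have "c \<noteq> 0" using c e \<open>p0 \<noteq> 0\<close> by auto
  then have "p0 dvd d" unfolding e c by (simp add: smult_dvd_iff)
  then have "p0 dvd q0" using d(4) dvd_trans by blast
  then obtain s where "q0 = p0 * s" by (rule dvdE)
  then have "q = p * map_poly \<gamma> s" unfolding q0 p0(1) by (simp only: map_poly_hom_simps(2)[OF g])
  then show ?thesis by simp
qed

text \<open>In characteristic zero the derivative is non-zero and of smaller degree, so it has no factor in common with an
irreducible polynomial.\<close>

lemma irreducible_over_separable:
  fixes \<gamma> :: "'a::field_char_0 \<Rightarrow> 'k::field_char_0"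
  assumes g: "field_hom \<gamma>" and p: "irreducible_over (range \<gamma>) p"
  shows "coprime p (pderiv p)"
proof -
  obtain p0 where p0: "p = map_poly \<gamma> p0" "degree p0 > 0" "\<forall>q r. p0 = q * r \<longrightarrow> degree q = 0 \<or> degree r = 0"
    by (rule irreducible_over_range[OF g p])
  have nz: "p0 \<noteq> 0" "pderiv p0 \<noteq> 0" using p0(2) by (auto simp: pderiv_eq_0_iff)
  from nz(1) have "p0 \<noteq> 0 \<or> pderiv p0 \<noteq> 0" ..
  then obtain u v d where d: "d = u * p0 + v * pderiv p0" "d \<noteq> 0" "d dvd p0" "d dvd pderiv p0"
    by (rule field_poly_bezout)
  obtain e where e: "p0 = d * e" using d(3) by (rule dvdE)
  have "degree d \<le> degree (pderiv p0)" using d(4) nz by (simp add: dvd_imp_degree_le)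
  then have "degree d < degree p0" using p0(2) by (simp add: degree_pderiv)
  moreover have "degree p0 = degree d + degree e" using e nz by (simp add: degree_mult_eq)
  ultimately have "degree d = 0" using p0(3)[rule_format, OF e] by auto
  then obtain c where c: "d = [:c:]" by (rule degree_eq_zeroE)
  have "[:\<gamma> c:] = map_poly \<gamma> d" unfolding c by (simp add: map_poly_hom_simps(4)[OF g])
  also have "\<dots> = map_poly \<gamma> u * p + map_poly \<gamma> v * pderiv p"
    by (simp only: d(1) map_poly_hom_simps(1,2,6)[OF g] p0(1))
  finally have eq: "[:\<gamma> c:] = map_poly \<gamma> u * p + map_poly \<gamma> v * pderiv p" .
  have "\<gamma> c \<noteq> 0" using c d(2) field_hom_eq_0_iff[OF g] by auto
  then have "is_unit [:\<gamma> c:]" by (simp add: is_unit_const_poly_iff)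
  then show ?thesis using eq by (intro coprimeI) (metis dvd_add dvd_mult dvd_trans)
qed

lemma galois_ext_iff_normal_ext:
  fixes \<gamma> :: "'a::field_char_0 \<Rightarrow> 'k::field_char_0"
  assumes "field_hom \<gamma>" shows "galois_ext (range \<gamma>) \<longleftrightarrow> normal_ext (range \<gamma>)"
  unfolding galois_ext_def separable_ext_def normal_ext_def using irreducible_over_separable[OF assms] by blast

lemma normal_ext_splits:
  "normal_ext k \<longleftrightarrow> algebraic_ext k \<and> (\<forall>p. irreducible_over k p \<and> (\<exists>x. poly p x = 0) \<longrightarrow> splits p)"
  unfolding normal_ext_def splits_def ..

lemma minimal_polynomial:
  assumes g: "field_hom \<gamma>" and q: "q \<in> polys_over (range \<gamma>)" "q \<noteq> 0" "poly q \<beta> = 0"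
  obtains p where "irreducible_over (range \<gamma>) p" "poly p \<beta> = 0"
proof -
  let ?R = "\<lambda>p. p \<in> polys_over (range \<gamma>) \<and> p \<noteq> 0 \<and> poly p \<beta> = 0"
  define p where "p = (ARG_MIN degree p. ?R p)"
  have p: "?R p" "\<And>r. ?R r \<Longrightarrow> degree p \<le> degree r"
    using arg_min_nat_lemma[of ?R q degree] q unfolding p_def by blast+
  have "degree p > 0"
  proof (rule ccontr)
    assume "\<not> degree p > 0"
    then have "degree p = 0" by simp
    then obtain c where "p = [:c:]" by (rule degree_eq_zeroE)
    then show False using p(1) by auto
  qed
  moreover have "degree a = 0 \<or> degree b = 0"
    if ab: "a \<in> polys_over (range \<gamma>)" "b \<in> polys_over (range \<gamma>)" "p = a * b" for a b
  proof -
    have nz: "a \<noteq> 0" "b \<noteq> 0" using p(1) ab by auto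
    have "poly a \<beta> = 0 \<or> poly b \<beta> = 0" using p(1) ab(3) by auto
    then have "degree p \<le> degree a \<or> degree p \<le> degree b" using p(2) ab nz by blast
    then show ?thesis using ab(3) nz by (auto simp: degree_mult_eq)
  qed
  moreover have "p \<in> polys_over (range \<gamma>)" "poly p \<beta> = 0" using p(1) by simp_all
  ultimately show thesis by (intro that) (simp_all add: irreducible_over_def)
qed

lemma splits_map_poly: "field_hom \<tau> \<Longrightarrow> splits p \<Longrightarrow> splits (map_poly \<tau> p)"
proof -
  assume t: "field_hom \<tau>" and "splits p"
  interpret t: field_hom \<tau> by fact
  obtain c xs where p: "p = smult c (\<Prod>x\<leftarrow>xs. [:-x, 1:])" using \<open>splits p\<close> unfolding splits_def by blast
  have "map_poly \<tau> (\<Prod>x\<leftarrow>xs. [:-x, 1:]) = (\<Prod>x\<leftarrow>map \<tau> xs. [:-x, 1:])"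
  proof (induction xs)
    case Nil
    show ?case by (simp add: map_poly_hom_simps[OF t])
  next
    case (Cons a xs)
    have "map_poly \<tau> [:-a, 1:] = [:- \<tau> a, 1:]" by (simp add: map_poly_hom_simps(4)[OF t] t.hom_uminus)
    then show ?case using Cons.IH by (simp only: list.map prod_list.Cons map_poly_hom_simps(2)[OF t])
  qed
  then have "map_poly \<tau> p = smult (\<tau> c) (\<Prod>x\<leftarrow>map \<tau> xs. [:-x, 1:])" unfolding p by (simp only: map_poly_hom_simps(3)[OF t])
  then show ?thesis unfolding splits_def by blast
qed

text \<open>An automorphism of the big field carries polynomials, irreducibility and splittings over a subfield to its image.\<close>

lemma normal_ext_image:
  assumes t: "field_hom \<tau>" "bij \<tau>" and n: "normal_ext M"
  shows "normal_ext (\<tau> ` M)"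
proof -
  define \<tau>' where "\<tau>' = inv_into UNIV \<tau>"
  have t': "field_hom \<tau>'" unfolding \<tau>'_def using t by (rule field_hom_inv)
  have inv: "\<tau> (\<tau>' x) = x" "\<tau>' (\<tau> z) = z" for x z
    unfolding \<tau>'_def using t(2) by (simp_all add: surj_f_inv_f bij_is_surj bij_is_inj)
  have pinv: "map_poly \<tau> (map_poly \<tau>' p) = p" "map_poly \<tau>' (map_poly \<tau> q) = q" for p q
    by (rule poly_eqI, simp add: map_poly_hom_simps(10)[OF t(1)] map_poly_hom_simps(10)[OF t'] inv)+
  have po: "map_poly \<tau> p \<in> polys_over (\<tau> ` M) \<longleftrightarrow> p \<in> polys_over M" for p
    unfolding polys_over_def using map_poly_hom_simps(10)[OF t(1)] field_hom_inj[OF t(1)] by (simp add: inj_image_mem_iff)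
  have "algebraic_ext (\<tau> ` M)" unfolding algebraic_ext_def
  proof
    fix x
    obtain p where p: "p \<in> polys_over M" "p \<noteq> 0" "poly p (\<tau>' x) = 0" using n unfolding normal_ext_def algebraic_ext_def by blast
    have "poly (map_poly \<tau> p) (\<tau> (\<tau>' x)) = \<tau> 0" unfolding map_poly_hom_simps(5)[OF t(1)] p(3) ..
    then have "poly (map_poly \<tau> p) x = 0" using field_hom_eq_0_iff[OF t(1)] by (simp add: inv)
    then show "\<exists>p\<in>polys_over (\<tau> ` M). p \<noteq> 0 \<and> poly p x = 0"
      using p po map_poly_hom_simps(8)[OF t(1)] by blast
  qed
  moreover have "splits p" if p: "irreducible_over (\<tau> ` M) p" "poly p x = 0" for p x
  proof -
    have "irreducible_over M (map_poly \<tau>' p)" unfolding irreducible_over_def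
    proof (intro conjI ballI impI)
      show "map_poly \<tau>' p \<in> polys_over M" "degree (map_poly \<tau>' p) > 0"
        using p(1) po[of "map_poly \<tau>' p"] unfolding irreducible_over_def pinv map_poly_hom_simps(7)[OF t'] by simp_all
      fix q r assume qr: "q \<in> polys_over M" "r \<in> polys_over M" "map_poly \<tau>' p = q * r"
      have "p = map_poly \<tau> q * map_poly \<tau> r" using arg_cong[OF qr(3), of "map_poly \<tau>"] unfolding pinv map_poly_hom_simps(2)[OF t(1)] .
      moreover have "map_poly \<tau> q \<in> polys_over (\<tau> ` M)" "map_poly \<tau> r \<in> polys_over (\<tau> ` M)"
        using qr(1,2) by (simp_all only: po)
      moreover have "\<forall>q\<in>polys_over (\<tau> ` M). \<forall>r\<in>polys_over (\<tau> ` M). p = q * r \<longrightarrow> degree q = 0 \<or> degree r = 0"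
        using p(1) unfolding irreducible_over_def by (elim conjE)
      ultimately have "degree (map_poly \<tau> q) = 0 \<or> degree (map_poly \<tau> r) = 0" by simp
      then show "degree q = 0 \<or> degree r = 0" unfolding map_poly_hom_simps(7)[OF t(1)] .
    qed
    moreover have "poly (map_poly \<tau>' p) (\<tau>' x) = 0"
      unfolding map_poly_hom_simps(5)[OF t'] p(2) using field_hom_eq_0_iff[OF t'] by simp
    ultimately have "splits (map_poly \<tau>' p)" using n unfolding normal_ext_splits by blast
    then show ?thesis using splits_map_poly[OF t(1)] pinv(1) by metis
  qed
  ultimately show ?thesis unfolding normal_ext_splits by blast
qed

text \<open>Conjugation by the automorphism.\<close>

lemma Gal_group_image:
  assumes t: "alg_hom k k \<tau>" "bij \<tau>"
  shows "Gal_group k M \<cong> Gal_group k (\<tau> ` M)"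
proof -
  define \<tau>' where "\<tau>' = inv_into UNIV \<tau>"
  have t': "alg_hom k k \<tau>'" "bij \<tau>'" unfolding \<tau>'_def using t alg_hom_inv bij_imp_bij_inv by blast+
  have inv: "\<tau> (\<tau>' x) = x" "\<tau>' (\<tau> x) = x" for x
    unfolding \<tau>'_def using t(2) by (simp_all add: surj_f_inv_f bij_is_surj bij_is_inj)
  define h where "h \<sigma> = \<tau> \<circ> \<sigma> \<circ> \<tau>'" for \<sigma>
  have mem: "h \<sigma> \<in> carrier (Gal_group k (\<tau> ` M))" if "\<sigma> \<in> carrier (Gal_group k M)" for \<sigma>
    using that t t' unfolding h_def by (auto simp: inv intro!: alg_hom_comp[of k k _ k] bij_comp)
  have mem': "\<tau>' \<circ> \<sigma> \<circ> \<tau> \<in> carrier (Gal_group k M)" if "\<sigma> \<in> carrier (Gal_group k (\<tau> ` M))" for \<sigma>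
    using that t t' by (auto simp: inv intro!: alg_hom_comp[of k k _ k] bij_comp)
  have "h \<in> iso (Gal_group k M) (Gal_group k (\<tau> ` M))"
  proof (rule isoI)
    show "h \<in> hom (Gal_group k M) (Gal_group k (\<tau> ` M))"
    proof (rule homI)
      show "h \<sigma> \<in> carrier (Gal_group k (\<tau> ` M))" if "\<sigma> \<in> carrier (Gal_group k M)" for \<sigma> using mem[OF that] .
      show "h (\<sigma> \<otimes>\<^bsub>Gal_group k M\<^esub> \<rho>) = h \<sigma> \<otimes>\<^bsub>Gal_group k (\<tau> ` M)\<^esub> h \<rho>" for \<sigma> \<rho>
        by (simp add: h_def fun_eq_iff inv)
    qed
    show "bij_betw h (carrier (Gal_group k M)) (carrier (Gal_group k (\<tau> ` M)))"
    proof (rule bij_betwI[where g = "\<lambda>\<sigma>. \<tau>' \<circ> \<sigma> \<circ> \<tau>"])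
      show "h \<in> carrier (Gal_group k M) \<rightarrow> carrier (Gal_group k (\<tau> ` M))" using mem by blast
      show "(\<lambda>\<sigma>. \<tau>' \<circ> \<sigma> \<circ> \<tau>) \<in> carrier (Gal_group k (\<tau> ` M)) \<rightarrow> carrier (Gal_group k M)" using mem' by blast
    qed (simp_all add: h_def fun_eq_iff inv)
  qed
  then show ?thesis unfolding is_iso_def by blast
qed

section \<open>Adjoining a variable: automorphisms\<close>

text \<open>The inclusion of \<open>C(x)\<close> into \<open>C(x,y)\<close>.\<close>

definition emb :: "complex poly fract \<Rightarrow> complex poly poly fract" where
  "emb = fract_lift (\<lambda>q. to_fract [:q:])"

lemma emb: "alg_hom cst1 cst2 emb" "emb (to_fract q) = to_fract [:q:]" "emb tK = xK"
proof -
  have h: "comm_ring_hom (\<lambda>q :: complex poly. to_fract [:q:])"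
    by unfold_locales (simp_all flip: to_fract_add to_fract_mult one_pCons)
  show 1: "emb (to_fract q) = to_fract [:q:]" for q unfolding emb_def by (rule fract_lift(2)[OF h]) simp
  have "field_hom emb" unfolding emb_def by (rule fract_lift(3)[OF h]) simp
  then show "alg_hom cst1 cst2 emb" unfolding alg_hom_def by (simp add: cst1_def cst2_def 1)
  show "emb tK = xK" unfolding tK_def xK_def by (rule 1)
qed

lemma field_hom_emb: "field_hom emb" using emb(1) by (rule alg_homD)

lemma emb_eq_iff: "emb f = emb g \<longleftrightarrow> f = g" using field_hom_eq_iff[OF field_hom_emb] .
lemma emb_eq_0_iff: "emb f = 0 \<longleftrightarrow> f = 0" using field_hom_eq_0_iff[OF field_hom_emb] .

lemma poly_emb_fract: "poly (map_poly emb (fract_poly U)) yK = to_fract U"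
proof (induction U)
  case (pCons a p)
  have "poly (map_poly emb (fract_poly (pCons a p))) yK = to_fract [:a:] + yK * to_fract p"
    using pCons.IH by (simp add: Polynomial.map_poly_pCons map_poly_hom_simps(4)[OF field_hom_emb] emb(2))
  also have "\<dots> = to_fract (pCons a p)" by (simp add: yK_def flip: to_fract_add to_fract_mult)
  finally show ?case .
qed simp

lemma y_transcendental:
  assumes "poly (map_poly emb r) yK = 0" shows "r = 0"
proof -
  obtain d U where d: "d \<noteq> 0" "smult (to_fract d) r = fract_poly U" by (rule clear_denominators)
  have "to_fract U = poly (map_poly emb (smult (to_fract d) r)) yK" unfolding d(2) by (rule poly_emb_fract[symmetric])
  also have "\<dots> = 0" unfolding map_poly_hom_simps(3)[OF field_hom_emb] using assms by simp
  finally have "U = 0" by simp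
  then show ?thesis using d by simp
qed

definition coeff_map :: "(complex poly fract \<Rightarrow> complex poly fract) \<Rightarrow> complex poly poly \<Rightarrow> complex poly fract poly" where
  "coeff_map \<sigma> p = map_poly (\<lambda>q. \<sigma> (to_fract q)) p"

text \<open>The endomorphism acts on the coefficients of a polynomial in \<open>y\<close> and fixes \<open>y\<close>. Hence the
range of \<open>extend_endo \<gamma>\<close> is the field generated by \<open>y\<close> and the range of
\<open>\<gamma>\<close>, in short \<open>C(G(x), y)\<close> if \<open>\<gamma> x = G\<close>.\<close>

definition extend_endo :: "(complex poly fract \<Rightarrow> complex poly fract) \<Rightarrow> complex poly poly fract \<Rightarrow> complex poly poly fract" where
  "extend_endo \<sigma> = fract_lift (\<lambda>p. poly (map_poly emb (coeff_map \<sigma> p)) yK)"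

lemma coeff_map:
  assumes "field_hom \<sigma>"
  shows "comm_ring_hom (coeff_map \<sigma>)" "coeff_map \<sigma> p = 0 \<longleftrightarrow> p = 0" "coeff (coeff_map \<sigma> p) i = \<sigma> (to_fract (coeff p i))"
proof -
  have eq: "coeff_map \<sigma> p = map_poly \<sigma> (fract_poly p)" for p
    using field_hom_eq_0_iff[OF assms, of 0] unfolding coeff_map_def by (intro poly_eqI) (simp add: coeff_map_poly)
  show "comm_ring_hom (coeff_map \<sigma>)" unfolding eq[abs_def]
    by unfold_locales (simp_all add: map_poly_hom_simps[OF assms])
  show "coeff_map \<sigma> p = 0 \<longleftrightarrow> p = 0" unfolding eq map_poly_hom_simps(8)[OF assms] by simp
  show "coeff (coeff_map \<sigma> p) i = \<sigma> (to_fract (coeff p i))" unfolding eq map_poly_hom_simps(10)[OF assms] by (simp add: coeff_map_poly)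
qed

lemma extend_endo:
  assumes "alg_hom cst1 cst1 \<sigma>"
  shows "alg_hom cst2 cst2 (extend_endo \<sigma>)" "extend_endo \<sigma> (emb h) = emb (\<sigma> h)" "extend_endo \<sigma> yK = yK"
    "extend_endo \<sigma> (to_fract p) = poly (map_poly emb (coeff_map \<sigma> p)) yK"
proof -
  have s: "field_hom \<sigma>" using assms by (rule alg_homD)
  interpret s: field_hom \<sigma> by (rule s)
  define \<rho> where "\<rho> p = poly (map_poly emb (coeff_map \<sigma> p)) yK" for p
  interpret c: comm_ring_hom "coeff_map \<sigma>" by (rule coeff_map(1)[OF s])
  have h: "comm_ring_hom \<rho>" unfolding \<rho>_def
    by unfold_locales (simp_all add: c.hom_add c.hom_mult c.hom_one map_poly_hom_simps[OF field_hom_emb])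
  have nz: "\<rho> p \<noteq> 0" if "p \<noteq> 0" for p
    using y_transcendental[of "coeff_map \<sigma> p"] coeff_map(2)[OF s, of p] that unfolding \<rho>_def by blast
  have ext: "extend_endo \<sigma> = fract_lift \<rho>" unfolding extend_endo_def \<rho>_def ..
  have val: "extend_endo \<sigma> (to_fract p) = \<rho> p" for p unfolding ext by (rule fract_lift(2)[OF h nz])
  show "extend_endo \<sigma> (to_fract p) = poly (map_poly emb (coeff_map \<sigma> p)) yK" unfolding val \<rho>_def ..
  have hom: "field_hom (extend_endo \<sigma>)" unfolding ext by (rule fract_lift(3)[OF h nz])
  have q: "extend_endo \<sigma> (to_fract [:q:]) = emb (\<sigma> (to_fract q))" for q
    unfolding val \<rho>_def coeff_map_def by (simp add: Polynomial.map_poly_pCons map_poly_hom_simps(4)[OF field_hom_emb])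
  show 1: "alg_hom cst2 cst2 (extend_endo \<sigma>)" unfolding alg_hom_def
    using hom q alg_homD(2)[OF assms] alg_homD(2)[OF emb(1)] by (simp add: cst1_def cst2_def)
  interpret e: field_hom emb by (rule field_hom_emb)
  have "extend_endo \<sigma> (to_fract polyY) = yK" unfolding val \<rho>_def coeff_map_def
    by (simp add: Polynomial.map_poly_pCons)
  then show "extend_endo \<sigma> yK = yK" by (simp only: yK_def)
  have "extend_endo \<sigma> \<circ> emb = emb \<circ> \<sigma>"
  proof (rule alg_hom_ext1)
    show "alg_hom cst1 cst2 (extend_endo \<sigma> \<circ> emb)" using emb(1) 1 by (rule alg_hom_comp)
    show "alg_hom cst1 cst2 (emb \<circ> \<sigma>)" using assms emb(1) by (rule alg_hom_comp)
    show "(extend_endo \<sigma> \<circ> emb) tK = (emb \<circ> \<sigma>) tK"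
      using q[of "[:0,1:]"] by (simp add: tK_def emb(2))
  qed
  then show "extend_endo \<sigma> (emb h) = emb (\<sigma> h)" by (simp add: fun_eq_iff)
qed

lemma extend_endo_unique:
  assumes "alg_hom cst1 cst1 \<sigma>" "alg_hom cst2 cst2 \<rho>" "\<rho> xK = emb (\<sigma> tK)" "\<rho> yK = yK"
  shows "extend_endo \<sigma> = \<rho>"
proof (rule alg_hom_ext2[OF extend_endo(1)[OF assms(1)] assms(2)])
  show "extend_endo \<sigma> xK = \<rho> xK" using extend_endo(2)[OF assms(1), of tK] by (simp add: emb(3) assms(3))
  show "extend_endo \<sigma> yK = \<rho> yK" using extend_endo(3)[OF assms(1)] assms(4) by simp
qed

lemma extend_endo_comp:
  assumes "alg_hom cst1 cst1 \<sigma>" "alg_hom cst1 cst1 \<tau>"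
  shows "extend_endo (\<sigma> \<circ> \<tau>) = extend_endo \<sigma> \<circ> extend_endo \<tau>"
  using assms by (intro extend_endo_unique alg_hom_comp[of _ cst1] alg_hom_comp[of _ cst2] extend_endo(1))
    (simp_all add: extend_endo(2,3) flip: emb(3))

lemma extend_endo_id: "extend_endo id = id"
  by (intro extend_endo_unique alg_hom_id) (simp_all add: emb(3))

lemma extend_endo_bij: assumes "alg_hom cst1 cst1 \<sigma>" "bij \<sigma>" shows "bij (extend_endo \<sigma>)"
proof -
  define \<tau> where "\<tau> = inv_into UNIV \<sigma>"
  have t: "alg_hom cst1 cst1 \<tau>" unfolding \<tau>_def using assms by (rule alg_hom_inv)
  have "\<sigma> \<circ> \<tau> = id" "\<tau> \<circ> \<sigma> = id" unfolding \<tau>_def using assms(2)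
    by (simp_all add: fun_eq_iff surj_f_inv_f bij_is_surj bij_is_inj)
  then have "extend_endo \<sigma> \<circ> extend_endo \<tau> = id" "extend_endo \<tau> \<circ> extend_endo \<sigma> = id"
    using extend_endo_comp[OF assms(1) t] extend_endo_comp[OF t assms(1)] extend_endo_id by simp_all
  then show ?thesis using o_bij by blast
qed

lemma poly_homogeneous:
  fixes a b :: "'k::field"
  assumes "b \<noteq> 0"
  shows "b ^ degree p * poly p (a / b) = (\<Sum>i\<le>degree p. coeff p i * a ^ i * b ^ (degree p - i))"
proof -
  have "b ^ degree p * poly p (a / b) = (\<Sum>i\<le>degree p. b ^ degree p * (coeff p i * (a / b) ^ i))"
    by (simp add: poly_altdef sum_distrib_left)
  also have "\<dots> = (\<Sum>i\<le>degree p. coeff p i * a ^ i * b ^ (degree p - i))"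
    using assms by (intro sum.cong refl) (simp add: power_divide power_diff field_simps)
  finally show ?thesis .
qed

text \<open>The rational root theorem: the denominator divides the leading coefficient. The coefficients do not contain
\<open>y\<close>, so the denominator does not contain it either.\<close>

lemma root_denominator:
  fixes p :: "complex poly poly" and a b :: "complex poly poly"
  assumes root: "poly (map_poly (\<lambda>q. to_fract [:q:]) p) (to_fract a / to_fract b) = 0"
    and "p \<noteq> 0" "b \<noteq> 0" "coprime a b"
  shows "degree b = 0"
proof -
  define P where "P = map_poly (\<lambda>q. to_fract [:q:]) p"
  define n where "n = degree p"
  have deg: "degree P = n" unfolding P_def n_def by (rule Polynomial.degree_map_poly) simp
  have cf: "coeff P i = to_fract [:coeff p i:]" for i unfolding P_def by (simp add: coeff_map_poly)
  have "(\<Sum>i\<le>n. coeff P i * to_fract a ^ i * to_fract b ^ (n - i)) = 0"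
    using poly_homogeneous[of "to_fract b" P "to_fract a"] root assms(3) unfolding deg P_def[symmetric] by simp
  moreover have pow: "to_fract (c ^ k) = to_fract c ^ k" for c :: "complex poly poly" and k by (induction k) simp_all
  ultimately have "to_fract (\<Sum>i\<le>n. [:coeff p i:] * a ^ i * b ^ (n - i)) = 0"
    unfolding cf to_fract_sum to_fract_mult pow by simp
  then have 0: "(\<Sum>i\<le>n. [:coeff p i:] * a ^ i * b ^ (n - i)) = 0" by (simp only: to_fract_eq_0_iff)
  have "(\<Sum>i\<le>n. [:coeff p i:] * a ^ i * b ^ (n - i)) = (\<Sum>i<n. [:coeff p i:] * a ^ i * b ^ (n - i)) + [:coeff p n:] * a ^ n"
    by (simp add: lessThan_Suc_atMost[symmetric])
  then have "[:coeff p n:] * a ^ n = - (\<Sum>i<n. [:coeff p i:] * a ^ i * b ^ (n - i))" using 0 by (simp add: eq_neg_iff_add_eq_0 add.commute)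
  moreover have "b dvd (\<Sum>i<n. [:coeff p i:] * a ^ i * b ^ (n - i))"
  proof (rule dvd_sum)
    fix i assume "i \<in> {..<n}"
    then have "b dvd b ^ (n - i)" by (intro dvd_power) simp
    then show "b dvd [:coeff p i:] * a ^ i * b ^ (n - i)" by (rule dvd_mult)
  qed
  ultimately have "b dvd [:coeff p n:] * a ^ n" by simp
  moreover have "coprime b (a ^ n)" using assms(4) by (simp add: coprime_commute)
  ultimately have "b dvd [:coeff p n:]" using coprime_dvd_mult_left_iff by blast
  moreover have "coeff p n \<noteq> 0" using assms(2) by (simp add: n_def)
  ultimately show ?thesis using dvd_imp_degree_le[of b "[:coeff p n:]"] by simp
qed

text \<open>\<open>C(x)\<close> is algebraically closed in \<open>C(x,y)\<close>: by the rational root theorem for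
\<open>f\<close> and for \<open>1/f\<close>, neither the denominator nor the numerator of \<open>f\<close> contains
\<open>y\<close>.\<close>

lemma root_over_emb:
  assumes "p \<noteq> 0" "poly (map_poly emb p) f = 0"
  shows "f \<in> range emb"
proof (cases "f = 0")
  case True
  then show ?thesis using emb_eq_0_iff[of 0] by (metis rangeI)
next
  case False
  obtain d U where d: "d \<noteq> 0" "smult (to_fract d) p = fract_poly U" by (rule clear_denominators)
  have "U \<noteq> 0" using d assms(1) by auto
  define W where "W = map_poly (\<lambda>q. to_fract [:q:]) U"
  have "W = map_poly emb (fract_poly U)" unfolding W_def
    by (rule poly_eqI) (simp add: coeff_map_poly emb(2) emb_eq_0_iff)
  then have W0: "poly W f = 0" unfolding d(2)[symmetric] map_poly_hom_simps(3)[OF field_hom_emb] using assms(2) by simp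
  define a b where "a = fst (quot_of_fract f)" and "b = snd (quot_of_fract f)"
  have f: "f = to_fract a / to_fract b" using Fract_quot_of_fract[of f] by (simp add: a_def b_def Fract_conv_to_fract)
  have b: "b \<noteq> 0" unfolding b_def by (rule snd_quot_of_fract_nonzero)
  have co: "coprime a b" unfolding a_def b_def by (rule coprime_quot_of_fract)
  have a: "a \<noteq> 0" using f False by auto
  have "degree b = 0" using root_denominator[of U a b] W0 f \<open>U \<noteq> 0\<close> b co unfolding W_def by simp
  moreover have "degree a = 0"
  proof (rule root_denominator[of "reflect_poly U" b a])
    have "map_poly (\<lambda>q. to_fract [:q:]) (reflect_poly U) = reflect_poly W"
      unfolding W_def by (rule poly_eqI) (simp add: coeff_map_poly coeff_reflect_poly Polynomial.degree_map_poly)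
    moreover have "poly (reflect_poly W) (inverse f) = 0" using W0 False by (subst poly_reflect_poly_nz) simp_all
    moreover have "inverse f = to_fract b / to_fract a" by (simp add: f)
    ultimately show "poly (map_poly (\<lambda>q. to_fract [:q:]) (reflect_poly U)) (to_fract b / to_fract a) = 0" by simp
    show "reflect_poly U \<noteq> 0" using \<open>U \<noteq> 0\<close> by simp
    show "coprime b a" using co by (simp add: coprime_commute)
  qed (rule a)
  ultimately obtain a0 b0 where "a = [:a0:]" "b = [:b0:]" by (metis degree_eq_zeroE)
  note [simp] = this
  interpret e: field_hom emb by (rule field_hom_emb)
  have "f = emb (to_fract a0 / to_fract b0)"
    using f by (simp add: emb(2) e.hom_div)
  then show ?thesis by simp
qed

lemma poly_cst1_tK: "poly (map_poly cst1 p) tK = to_fract p"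
  using ev1_gen[of p] by (simp add: ev1_eq gen1_def tK_def)

text \<open>Comparing the coefficients of a power of \<open>y\<close> in numerator and denominator shows that an element of
\<open>C(G(x), y)\<close> that does not depend on \<open>y\<close> lies in \<open>C(G(x))\<close>.\<close>

lemma emb_mem_range_extend:
  assumes g: "alg_hom cst1 cst1 \<gamma>"
  shows "emb f \<in> range (extend_endo \<gamma>) \<longleftrightarrow> f \<in> range \<gamma>"
proof
  have gh: "field_hom \<gamma>" using g by (rule alg_homD)
  interpret g: field_hom \<gamma> by (rule gh)
  interpret e: field_hom "extend_endo \<gamma>" by (rule alg_homD(1)[OF extend_endo(1)[OF g]])
  assume "emb f \<in> range (extend_endo \<gamma>)"
  then obtain h where h: "emb f = extend_endo \<gamma> h" by blast
  obtain a b where ab: "h = to_fract a / to_fract b" "b \<noteq> 0" by (rule fract_as_quotient)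
  have "extend_endo \<gamma> (to_fract b) \<noteq> 0"
    using ab(2) field_hom_eq_0_iff[OF alg_homD(1)[OF extend_endo(1)[OF g]]] by simp
  then have "emb f * extend_endo \<gamma> (to_fract b) = extend_endo \<gamma> (to_fract a)" unfolding h ab(1) by (simp add: e.hom_div)
  then have "poly (map_poly emb (smult f (coeff_map \<gamma> b) - coeff_map \<gamma> a)) yK = 0"
    by (simp add: extend_endo(4)[OF g] map_poly_hom_simps[OF field_hom_emb])
  then have eq: "smult f (coeff_map \<gamma> b) = coeff_map \<gamma> a" using y_transcendental by fastforce
  obtain j where j: "coeff b j \<noteq> 0" using ab(2) by (meson leading_coeff_0_iff)
  have "f * \<gamma> (to_fract (coeff b j)) = \<gamma> (to_fract (coeff a j))"
    using arg_cong[OF eq, of "\<lambda>p. coeff p j"] by (simp add: coeff_map(3)[OF gh])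
  moreover have "\<gamma> (to_fract (coeff b j)) \<noteq> 0" using j field_hom_eq_0_iff[OF gh] by simp
  ultimately have "f = \<gamma> (to_fract (coeff a j) / to_fract (coeff b j))" by (simp add: g.hom_div field_simps)
  then show "f \<in> range \<gamma>" by simp
next
  assume "f \<in> range \<gamma>"
  then obtain h where "f = \<gamma> h" by blast
  then have "emb f = extend_endo \<gamma> (emb h)" using extend_endo(2)[OF g] by simp
  then show "emb f \<in> range (extend_endo \<gamma>)" by simp
qed

text \<open>If \<open>\<gamma> x = a / b\<close>, then \<open>x\<close> is a zero of the polynomial \<open>a(T) - (\<gamma> x)
b(T)\<close>, which is non-zero because \<open>\<gamma> x\<close> is not constant.\<close>

lemma tK_algebraic:
  assumes g: "alg_hom cst1 cst1 \<gamma>"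
  obtains F where "F \<in> polys_over (range \<gamma>)" "F \<noteq> 0" "poly F tK = 0"
proof -
  have gh: "field_hom \<gamma>" using g by (rule alg_homD)
  obtain a b where ab: "\<gamma> tK = to_fract a / to_fract b" "b \<noteq> 0" by (rule fract_as_quotient)
  define F where "F = map_poly cst1 a - smult (\<gamma> tK) (map_poly cst1 b)"
  have cF: "coeff F i = cst1 (coeff a i) - \<gamma> tK * cst1 (coeff b i)" for i
    by (simp add: F_def coeff_map_poly)
  note sub = subfieldCD[OF subfieldC_range[OF g]]
  have "coeff F i \<in> range \<gamma>" for i unfolding cF by (intro sub(6) sub(3) sub(1) rangeI)
  then have "F \<in> polys_over (range \<gamma>)" by (simp add: polys_over_def)
  moreover have "poly F tK = 0" using ab(2) by (simp add: F_def poly_cst1_tK ab(1))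
  moreover have "F \<noteq> 0"
  proof
    assume "F = 0"
    obtain j where j: "coeff b j \<noteq> 0" using ab(2) by (meson leading_coeff_0_iff)
    have "cst1 (coeff a j) = \<gamma> tK * cst1 (coeff b j)" using cF[of j] \<open>F = 0\<close> by simp
    moreover have "cst1 (coeff b j) \<noteq> 0" using j by (simp add: cst1_def)
    ultimately have "\<gamma> tK = cst1 (coeff a j) / cst1 (coeff b j)" by (simp add: field_simps)
    also have "\<dots> = cst1 (coeff a j / coeff b j)"
      using j by (simp add: cst1_def divide_simps flip: to_fract_mult)
    also have "\<dots> = \<gamma> (cst1 (coeff a j / coeff b j))" using alg_homD(2)[OF g] by simp
    finally have "tK = cst1 (coeff a j / coeff b j)" using field_hom_eq_iff[OF gh] by simp
    then show False by (simp add: tK_def cst1_def)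
  qed
  ultimately show thesis using that by blast
qed

lemma map_poly_fixed:
  assumes "field_hom \<sigma>" "p \<in> polys_over M" "\<forall>x\<in>M. \<sigma> x = x"
  shows "map_poly \<sigma> p = p"
  using assms(2,3) by (intro poly_eqI) (simp add: map_poly_hom_simps(10)[OF assms(1)] polys_over_def)

lemma map_emb_polys_over:
  assumes g: "alg_hom cst1 cst1 \<gamma>"
  shows "map_poly emb p \<in> polys_over (range (extend_endo \<gamma>)) \<longleftrightarrow> p \<in> polys_over (range \<gamma>)"
  unfolding polys_over_def by (simp add: map_poly_hom_simps(10)[OF field_hom_emb] emb_mem_range_extend[OF g])

lemma yK_mem_range_extend: "alg_hom cst1 cst1 \<gamma> \<Longrightarrow> yK \<in> range (extend_endo \<gamma>)"
  using extend_endo(3) by (metis rangeI)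

lemma extend_fixes_iff:
  assumes g: "alg_hom cst1 cst1 \<gamma>" and s: "alg_hom cst1 cst1 \<sigma>"
  shows "(\<forall>x\<in>range (extend_endo \<gamma>). extend_endo \<sigma> x = x) \<longleftrightarrow> (\<forall>x\<in>range \<gamma>. \<sigma> x = x)"
proof
  assume *: "\<forall>x\<in>range \<gamma>. \<sigma> x = x"
  then have "\<sigma> \<circ> \<gamma> = \<gamma>" by (simp add: fun_eq_iff)
  then have "extend_endo \<sigma> \<circ> extend_endo \<gamma> = extend_endo \<gamma>" using extend_endo_comp[OF s g] by simp
  then show "\<forall>x\<in>range (extend_endo \<gamma>). extend_endo \<sigma> x = x" by (auto simp: fun_eq_iff)
next
  assume *: "\<forall>x\<in>range (extend_endo \<gamma>). extend_endo \<sigma> x = x"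
  show "\<forall>x\<in>range \<gamma>. \<sigma> x = x"
  proof
    fix x assume "x \<in> range \<gamma>"
    then have "extend_endo \<sigma> (emb x) = emb x" using * emb_mem_range_extend[OF g] by blast
    then show "\<sigma> x = x" by (simp add: extend_endo(2)[OF s] emb_eq_iff)
  qed
qed

text \<open>The element \<open>x\<close> is algebraic over \<open>C(G)\<close>, which is fixed. So its image is algebraic over
\<open>C(x)\<close>, hence lies in \<open>C(x)\<close>, which is algebraically closed in \<open>C(x,y)\<close>.\<close>

lemma restrict_automorphism:
  assumes g: "alg_hom cst1 cst1 \<gamma>" and s: "alg_hom cst2 cst2 \<sigma>" and fx: "\<forall>x\<in>range (extend_endo \<gamma>). \<sigma> x = x"
  obtains \<sigma>\<^sub>0 where "alg_hom cst1 cst1 \<sigma>\<^sub>0" "extend_endo \<sigma>\<^sub>0 = \<sigma>"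
proof -
  have sh: "field_hom \<sigma>" using s by (rule alg_homD)
  interpret s: field_hom \<sigma> by (rule sh)
  obtain F where F: "F \<in> polys_over (range \<gamma>)" "F \<noteq> 0" "poly F tK = 0" using g by (rule tK_algebraic)
  have "map_poly \<sigma> (map_poly emb F) = map_poly emb F"
    using map_poly_fixed[OF sh _ fx] map_emb_polys_over[OF g] F(1) by blast
  moreover have "poly (map_poly emb F) (emb tK) = 0"
    using F(3) by (simp add: map_poly_hom_simps(5)[OF field_hom_emb] emb_eq_0_iff)
  ultimately have "poly (map_poly emb F) (\<sigma> (emb tK)) = 0"
    using map_poly_hom_simps(5)[OF sh, of "map_poly emb F" "emb tK"] by simp
  then have "\<sigma> (emb tK) \<in> range emb" using root_over_emb F(2) by blast
  then have "range (\<sigma> \<circ> emb) \<subseteq> range emb"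
    using range_subset1[OF alg_hom_comp[OF emb(1) s] subfieldC_range[OF emb(1)]] by simp
  then have "\<forall>h. \<exists>h'. \<sigma> (emb h) = emb h'" by auto
  then obtain \<sigma>\<^sub>0 where s0: "\<And>h. \<sigma> (emb h) = emb (\<sigma>\<^sub>0 h)" by metis
  interpret e: field_hom emb by (rule field_hom_emb)
  have "field_hom \<sigma>\<^sub>0"
  proof (rule field_homI)
    fix a b
    have "emb (\<sigma>\<^sub>0 (a + b)) = emb (\<sigma>\<^sub>0 a + \<sigma>\<^sub>0 b)" "emb (\<sigma>\<^sub>0 (a * b)) = emb (\<sigma>\<^sub>0 a * \<sigma>\<^sub>0 b)"
      unfolding e.hom_add e.hom_mult s0[symmetric] s.hom_add s.hom_mult by (rule refl)+
    then show "\<sigma>\<^sub>0 (a + b) = \<sigma>\<^sub>0 a + \<sigma>\<^sub>0 b" "\<sigma>\<^sub>0 (a * b) = \<sigma>\<^sub>0 a * \<sigma>\<^sub>0 b" by (simp_all only: emb_eq_iff)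
  next
    have "emb (\<sigma>\<^sub>0 1) = emb 1" unfolding s0[symmetric] by (simp add: s.hom_one)
    then show "\<sigma>\<^sub>0 1 = 1" by (simp only: emb_eq_iff)
  qed
  moreover have "\<sigma>\<^sub>0 (cst1 c) = cst1 c" for c
  proof -
    have "emb (\<sigma>\<^sub>0 (cst1 c)) = emb (cst1 c)" unfolding s0[symmetric] by (simp add: alg_homD(2)[OF emb(1)] alg_homD(2)[OF s])
    then show ?thesis by (simp only: emb_eq_iff)
  qed
  ultimately have a: "alg_hom cst1 cst1 \<sigma>\<^sub>0" by (simp add: alg_hom_def)
  have "\<sigma> yK = yK" using fx yK_mem_range_extend[OF g] by blast
  then have "extend_endo \<sigma>\<^sub>0 = \<sigma>" using s0[of tK] by (intro extend_endo_unique a s) (simp_all add: emb(3))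
  then show thesis using that a by blast
qed

text \<open>Extension by \<open>y \<mapsto> y\<close> and restriction to \<open>C(x)\<close> are inverse to each other. That the
restriction is bijective follows by restricting the inverse as well.\<close>

theorem Gal_group_extend:
  assumes g: "alg_hom cst1 cst1 \<gamma>"
  shows "Gal_group cst1 (range \<gamma>) \<cong> Gal_group cst2 (range (extend_endo \<gamma>))"
proof -
  let ?G = "Gal_group cst1 (range \<gamma>)" and ?H = "Gal_group cst2 (range (extend_endo \<gamma>))"
  have mem: "extend_endo \<sigma> \<in> carrier ?H" if "\<sigma> \<in> carrier ?G" for \<sigma>
    using that extend_endo(1) extend_endo_bij extend_fixes_iff[OF g] unfolding Gal_group_simps by blast
  have inj: "\<sigma> = \<rho>" if "alg_hom cst1 cst1 \<sigma>" "alg_hom cst1 cst1 \<rho>" "extend_endo \<sigma> = extend_endo \<rho>" for \<sigma> \<rho>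
  proof
    fix h
    have "emb (\<sigma> h) = emb (\<rho> h)" using extend_endo(2)[OF that(1), of h] extend_endo(2)[OF that(2), of h] that(3) by simp
    then show "\<sigma> h = \<rho> h" by (simp only: emb_eq_iff)
  qed
  have surj: "\<exists>\<sigma>\<in>carrier ?G. \<rho> = extend_endo \<sigma>" if r: "\<rho> \<in> carrier ?H" for \<rho>
  proof -
    have r': "alg_hom cst2 cst2 \<rho>" "bij \<rho>" "\<forall>x\<in>range (extend_endo \<gamma>). \<rho> x = x" using r unfolding Gal_group_simps by blast+
    obtain \<sigma> where s: "alg_hom cst1 cst1 \<sigma>" "extend_endo \<sigma> = \<rho>" by (rule restrict_automorphism[OF g r'(1,3)])
    have i: "alg_hom cst2 cst2 (inv_into UNIV \<rho>)" "\<forall>x\<in>range (extend_endo \<gamma>). inv_into UNIV \<rho> x = x"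
      using r' alg_hom_inv bij_inv_into_eq by (blast, metis)
    obtain \<tau> where t: "alg_hom cst1 cst1 \<tau>" "extend_endo \<tau> = inv_into UNIV \<rho>" by (rule restrict_automorphism[OF g i])
    have "extend_endo (\<sigma> \<circ> \<tau>) = extend_endo id" "extend_endo (\<tau> \<circ> \<sigma>) = extend_endo id"
      unfolding extend_endo_comp[OF s(1) t(1)] extend_endo_comp[OF t(1) s(1)] s(2) t(2) extend_endo_id
      using r'(2) by (simp_all add: fun_eq_iff surj_f_inv_f bij_is_surj bij_is_inj)
    then have "\<sigma> \<circ> \<tau> = id" "\<tau> \<circ> \<sigma> = id"
      using inj[OF alg_hom_comp alg_hom_id] s(1) t(1) by blast+
    then have "bij \<sigma>" using o_bij by blast
    moreover have "\<forall>x\<in>range \<gamma>. \<sigma> x = x" using extend_fixes_iff[OF g s(1)] r'(3) s(2) by simp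
    ultimately have "\<sigma> \<in> carrier ?G" using s(1) by simp
    then show ?thesis using s(2) by blast
  qed
  have "extend_endo \<in> iso ?G ?H"
  proof (rule isoI)
    show "extend_endo \<in> hom ?G ?H"
    proof (rule homI)
      show "extend_endo \<sigma> \<in> carrier ?H" if "\<sigma> \<in> carrier ?G" for \<sigma> using mem[OF that] .
      show "extend_endo (\<sigma> \<otimes>\<^bsub>?G\<^esub> \<rho>) = extend_endo \<sigma> \<otimes>\<^bsub>?H\<^esub> extend_endo \<rho>" if "\<sigma> \<in> carrier ?G" "\<rho> \<in> carrier ?G" for \<sigma> \<rho>
        using that extend_endo_comp[of \<rho> \<sigma>] by simp
    qed
    have "inj_on extend_endo (carrier ?G)" by (rule inj_onI) (use inj in simp)
    moreover have "extend_endo ` carrier ?G = carrier ?H" using mem surj by blast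
    ultimately show "bij_betw extend_endo (carrier ?G) (carrier ?H)" unfolding bij_betw_def by blast
  qed
  then show ?thesis unfolding is_iso_def by blast
qed

text \<open>An algebraic relation over \<open>C(G(x), y)\<close>, freed of denominators, is a polynomial in the transcendental
\<open>y\<close>. All its coefficients vanish, and one of them that involves the leading coefficient of the relation
is an algebraic relation over \<open>C(G(x))\<close>.\<close>

lemma algebraic_over_subfield:
  assumes g: "alg_hom cst1 cst1 \<gamma>"
    and A: "A \<in> polys_over (range (extend_endo \<gamma>))" "A \<noteq> 0" "poly A (emb \<beta>) = 0"
  obtains p where "p \<in> polys_over (range \<gamma>)" "p \<noteq> 0" "poly p \<beta> = 0"
proof -
  have gh: "field_hom \<gamma>" using g by (rule alg_homD)
  have Gh: "field_hom (extend_endo \<gamma>)" using extend_endo(1)[OF g] by (rule alg_homD)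
  obtain A0 where A0: "A = map_poly (extend_endo \<gamma>) A0" using A(1) polys_over_range[OF Gh] by blast
  obtain d U where d: "d \<noteq> 0" "smult (to_fract d) A0 = fract_poly U" by (rule clear_denominators)
  have "A0 \<noteq> 0" using A(2) A0 by auto
  then have "U \<noteq> 0" using d by auto
  have cU: "coeff (fract_poly U) i = to_fract (coeff U i)" for i by (simp add: coeff_map_poly)
  have degU: "degree (fract_poly U) = degree U" by (rule Polynomial.degree_map_poly) simp
  have "poly (map_poly (extend_endo \<gamma>) (fract_poly U)) (emb \<beta>) = 0"
    unfolding d(2)[symmetric] map_poly_hom_simps(3)[OF Gh] A0[symmetric] using A(3) by simp
  then have 0: "(\<Sum>i\<le>degree U. extend_endo \<gamma> (to_fract (coeff U i)) * emb \<beta> ^ i) = 0"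
    unfolding Polynomial.poly_altdef map_poly_hom_simps(7,10)[OF Gh] degU cU .
  interpret e: field_hom emb by (rule field_hom_emb)
  interpret em: map_poly_idom_hom emb ..
  define R where "R = (\<Sum>i\<le>degree U. smult (\<beta> ^ i) (coeff_map \<gamma> (coeff U i)))"
  have "poly (map_poly emb R) yK = (\<Sum>i\<le>degree U. emb \<beta> ^ i * extend_endo \<gamma> (to_fract (coeff U i)))"
    unfolding R_def by (simp add: em.hom_sum poly_sum map_poly_hom_simps(3)[OF field_hom_emb] extend_endo(4)[OF g] e.hom_power)
  also have "\<dots> = 0" using 0 by (simp add: mult.commute)
  finally have "R = 0" by (rule y_transcendental)
  obtain j where j: "coeff (coeff U (degree U)) j \<noteq> 0" using \<open>U \<noteq> 0\<close> by (metis leading_coeff_0_iff)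
  \<comment> \<open>The coefficient of \<open>y\<^sup>j\<close> in the relation, where \<open>j\<close> occurs in its leading coefficient.\<close>
  define p where "p = map_poly (\<lambda>u. \<gamma> (to_fract (coeff u j))) U"
  have cp: "coeff p i = \<gamma> (to_fract (coeff (coeff U i) j))" for i
    unfolding p_def using field_hom_eq_0_iff[OF gh, of 0] by (simp add: coeff_map_poly)
  have "p \<in> polys_over (range \<gamma>)" unfolding polys_over_def by (simp add: cp)
  moreover have "coeff p (degree U) \<noteq> 0" unfolding cp using j field_hom_eq_0_iff[OF gh] by simp
  then have "p \<noteq> 0" by auto
  moreover have "poly p \<beta> = 0"
  proof -
    have "degree p \<le> degree U" unfolding p_def by (rule degree_map_poly_le)
    then have "poly p \<beta> = (\<Sum>i\<le>degree U. coeff p i * \<beta> ^ i)"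
      unfolding Polynomial.poly_altdef by (intro sum.mono_neutral_left) (auto simp: coeff_eq_0)
    also have "\<dots> = coeff R j" unfolding R_def cp by (simp add: coeff_sum coeff_map(3)[OF gh] mult.commute)
    finally show ?thesis using \<open>R = 0\<close> by simp
  qed
  ultimately show thesis using that by blast
qed

text \<open>The minimal polynomial \<open>m\<close> of \<open>\<beta>\<close> over \<open>C(G(x), y)\<close> splits. It divides
the minimal polynomial \<open>p\<close> over \<open>C(G(x))\<close>, so its roots are algebraic over
\<open>C(x)\<close> and lie in \<open>C(x)\<close>; its coefficients, once it is made monic, lie in
\<open>C(x)\<close> and in \<open>C(G(x), y)\<close>, hence in \<open>C(G(x))\<close>. So \<open>p\<close> divides the
monic form of \<open>m\<close> and splits with it.\<close>

lemma normal_ext_of_extension: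
  assumes g: "alg_hom cst1 cst1 \<gamma>" and n: "normal_ext (range (extend_endo \<gamma>))"
  shows "normal_ext (range \<gamma>)"
proof -
  have gh: "field_hom \<gamma>" using g by (rule alg_homD)
  have Gh: "field_hom (extend_endo \<gamma>)" using extend_endo(1)[OF g] by (rule alg_homD)
  note sub = subfieldCD[OF subfieldC_range[OF extend_endo(1)[OF g]]]
  have alg: "algebraic_ext (range \<gamma>)" unfolding algebraic_ext_def
  proof
    fix \<beta>
    obtain A where A: "A \<in> polys_over (range (extend_endo \<gamma>))" "A \<noteq> 0" "poly A (emb \<beta>) = 0"
      using n unfolding normal_ext_def algebraic_ext_def by blast
    obtain p where "p \<in> polys_over (range \<gamma>)" "p \<noteq> 0" "poly p \<beta> = 0" by (rule algebraic_over_subfield[OF g A])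
    then show "\<exists>p\<in>polys_over (range \<gamma>). p \<noteq> 0 \<and> poly p \<beta> = 0" by blast
  qed
  have "splits p" if p: "irreducible_over (range \<gamma>) p" "poly p \<beta> = 0" for p \<beta>
  proof -
    have p': "p \<in> polys_over (range \<gamma>)" "p \<noteq> 0" using p(1) unfolding irreducible_over_def by auto
    have ep: "map_poly emb p \<in> polys_over (range (extend_endo \<gamma>))" "map_poly emb p \<noteq> 0" "poly (map_poly emb p) (emb \<beta>) = 0"
      using p' p(2) map_emb_polys_over[OF g] map_poly_hom_simps(5,8)[OF field_hom_emb] emb_eq_0_iff by simp_all
    obtain m where m: "irreducible_over (range (extend_endo \<gamma>)) m" "poly m (emb \<beta>) = 0"
      by (rule minimal_polynomial[OF Gh ep])
    have m': "m \<in> polys_over (range (extend_endo \<gamma>))" "m \<noteq> 0" using m(1) unfolding irreducible_over_def by auto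
    have "m dvd map_poly emb p" by (rule irreducible_over_dvd[OF Gh m(1) ep(1) m(2) ep(3)])
    then have roots: "\<rho> \<in> range emb" if "poly m \<rho> = 0" for \<rho>
      using that p'(2) root_over_emb[of p \<rho>] by (auto elim!: dvdE)
    obtain c xs where cxs: "m = smult c (\<Prod>x\<leftarrow>xs. [:-x, 1:])"
      using n m unfolding normal_ext_splits splits_def by blast
    have "set xs \<subseteq> range emb"
    proof
      fix x assume "x \<in> set xs"
      then have "poly m x = 0" unfolding cxs by (auto simp: poly_prod_list prod_list_zero_iff o_def)
      then show "x \<in> range emb" by (rule roots)
    qed
    then obtain rs where rs: "xs = map emb rs" by (metis ex_map_conv subsetD rangeE)
    define q where "q = (\<Prod>r\<leftarrow>rs. [:-r, 1:])"
    have "map_poly emb q = (\<Prod>x\<leftarrow>xs. [:-x, 1:])" unfolding q_def rs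
    proof (induction rs)
      case Nil
      show ?case by (simp add: map_poly_hom_simps(9)[OF field_hom_emb])
    next
      case (Cons a rs)
      interpret e: field_hom emb by (rule field_hom_emb)
      have "map_poly emb [:-a, 1:] = [:- emb a, 1:]" by (simp add: map_poly_hom_simps(4)[OF field_hom_emb] e.hom_uminus)
      then show ?case using Cons.IH by (simp only: list.map prod_list.Cons map_poly_hom_simps(2)[OF field_hom_emb])
    qed
    then have mq: "m = smult c (map_poly emb q)" unfolding cxs by simp
    have c0: "c \<noteq> 0" using mq m'(2) by auto
    have monic: "lead_coeff q = 1" unfolding q_def by (induction rs) (simp_all add: lead_coeff_mult del: mult_pCons_left)
    have "coeff m (degree q) = c"
      unfolding mq using monic by (simp add: map_poly_hom_simps(10)[OF field_hom_emb]) (metis emb(2) one_pCons to_fract_1)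
    then have cM: "c \<in> range (extend_endo \<gamma>)" using m'(1) unfolding polys_over_def by blast
    have "coeff (map_poly emb q) i \<in> range (extend_endo \<gamma>)" for i
    proof -
      have "coeff (map_poly emb q) i = coeff m i / c" unfolding mq using c0 by simp
      moreover have "coeff m i \<in> range (extend_endo \<gamma>)" using m'(1) unfolding polys_over_def by blast
      ultimately show ?thesis using sub(7) cM by metis
    qed
    then have "map_poly emb q \<in> polys_over (range (extend_endo \<gamma>))" unfolding polys_over_def by blast
    then have qM: "q \<in> polys_over (range \<gamma>)" using map_emb_polys_over[OF g] by blast
    have "emb (poly q \<beta>) = 0" using m(2) c0 unfolding mq by (simp add: map_poly_hom_simps(5)[OF field_hom_emb])
    then have "poly q \<beta> = 0" by (simp only: emb_eq_0_iff)
    then have "p dvd q" using irreducible_over_dvd[OF gh p(1) qM p(2)] by blast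
    moreover have "splits q" unfolding splits_def q_def by (intro exI[of _ 1] exI[of _ rs]) simp
    moreover have "q \<noteq> 0" using monic by auto
    ultimately show ?thesis by (intro splits_dvd[of p q])
  qed
  then show ?thesis using alg unfolding normal_ext_splits by blast
qed

text \<open>A non-zero polynomial in \<open>\<alpha>\<close> is a product of factors \<open>\<alpha> - c\<close> with complex
numbers \<open>c\<close>, none of which vanishes.\<close>

lemma P1_dominant_nonconstant:
  assumes "\<alpha> \<notin> range cst1" shows "P1.dominant (vector [\<alpha>, 1])"
  unfolding P1.dominant_def
proof (intro conjI allI impI)
  show "vector [\<alpha>, 1] \<noteq> (0 :: complex poly fract ^ 2)" by (auto simp: vec_eq_iff forall_2)
  fix p :: "complex poly" assume "p \<noteq> 0"
  then have "poly (map_poly cst1 p) \<alpha> \<noteq> 0"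
  proof (induction "degree p" arbitrary: p rule: less_induct)
    case less
    interpret k: comm_ring_hom cst1 by (rule comm_ring_hom_cst1)
    interpret m: comm_ring_hom "\<lambda>p. poly (map_poly cst1 p) \<alpha>" by (rule comm_ring_hom_eval[OF comm_ring_hom_cst1])
    show ?case
    proof (cases "degree p = 0")
      case True
      then obtain c where "p = [:c:]" by (rule degree_eq_zeroE)
      then show ?thesis using less.prems by (simp add: Polynomial.map_poly_pCons cst1_def)
    next
      case False
      then obtain c where "poly p c = 0" using fundamental_theorem_of_algebra_alt[of p] by (metis degree_pCons_0)
      then obtain q where q: "p = [:-c, 1:] * q" unfolding poly_eq_0_iff_dvd by (rule dvdE)
      then have "q \<noteq> 0" using less.prems by auto
      moreover have "degree p = Suc (degree q)" unfolding q using \<open>q \<noteq> 0\<close> by (subst degree_mult_eq) simp_all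
      ultimately have "poly (map_poly cst1 q) \<alpha> \<noteq> 0" using less.hyps by simp
      moreover have "poly (map_poly cst1 [:-c, 1:]) \<alpha> = \<alpha> - cst1 c"
        by (simp add: Polynomial.map_poly_pCons k.hom_uminus k.hom_one)
      ultimately show ?thesis unfolding q m.hom_mult using assms by auto
    qed
  qed
  then show "ev1 (vector [\<alpha>, 1]) p \<noteq> 0" by (simp add: ev1_eq)
qed

section \<open>Adjoining a variable: normality\<close>

text \<open>If \<open>\<gamma> x = p / q\<close>, then \<open>p(T) - (\<gamma> x) q(T)\<close> is a multiple of the minimal
polynomial \<open>F\<close> of \<open>x\<close>. So every other root \<open>\<alpha>\<close> of \<open>F\<close>
satisfies \<open>p(\<alpha>) / q(\<alpha>) = \<gamma> x\<close>, and the substitution \<open>x \<mapsto>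
\<alpha>\<close> fixes the range of \<open>\<gamma>\<close>.\<close>

lemma endo_to_root:
  assumes g: "alg_hom cst1 cst1 \<gamma>" and F: "irreducible_over (range \<gamma>) F" "poly F tK = 0" and a: "poly F \<alpha> = 0"
  shows "alg_hom cst1 cst1 (subst1 \<alpha>)" "subst1 \<alpha> tK = \<alpha>" "\<forall>x\<in>range \<gamma>. subst1 \<alpha> x = x"
proof -
  have gh: "field_hom \<gamma>" using g by (rule alg_homD)
  note sub = subfieldCD[OF subfieldC_range[OF g]]
  \<comment> \<open>A constant root would make the linear polynomial in it a multiple of the minimal polynomial.\<close>
  have "\<alpha> \<notin> range cst1"
  proof
    assume "\<alpha> \<in> range cst1"
    then obtain c where c: "\<alpha> = cst1 c" by blast
    have "[:- cst1 c, 1:] \<in> polys_over (range \<gamma>)"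
      unfolding polys_over_def using sub(1)[of c] sub(4)[OF sub(1)[of c]] sub(1)[of 0] sub(1)[of 1]
      by (auto simp: coeff_pCons cst1_def simp flip: one_pCons split: nat.splits)
    then have "F dvd [:- cst1 c, 1:]" using irreducible_over_dvd[OF gh F(1) _ a, of "[:- cst1 c, 1:]"] c by simp
    then obtain k where "[:- cst1 c, 1:] = F * k" by (rule dvdE)
    then have "poly [:- cst1 c, 1:] tK = poly F tK * poly k tK" by (simp only: poly_mult)
    also have "\<dots> = 0" using F(2) by simp
    finally have "poly [:- cst1 c, 1:] tK = 0" .
    then have "tK = cst1 c" by simp
    then show False by (simp add: tK_def cst1_def)
  qed
  then have dom: "P1.dominant (vector [\<alpha>, 1])" by (rule P1_dominant_nonconstant)
  show s: "alg_hom cst1 cst1 (subst1 \<alpha>)" "subst1 \<alpha> tK = \<alpha>" using subst1[OF dom] by simp_all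
  interpret s: field_hom "subst1 \<alpha>" using s(1) by (rule alg_homD)
  have val: "subst1 \<alpha> (to_fract p) = poly (map_poly cst1 p) \<alpha>" for p
    using alg_hom_ev1[OF s(1), of p tK] by (simp add: poly_cst1_tK s(2))
  obtain p q where pq: "\<gamma> tK = to_fract p / to_fract q" "q \<noteq> 0" by (rule fract_as_quotient)
  define G where "G = map_poly cst1 p - smult (\<gamma> tK) (map_poly cst1 q)"
  have "coeff G i \<in> range \<gamma>" for i
    unfolding G_def by (simp add: coeff_map_poly) (intro sub(6) sub(3) sub(1) rangeI)
  then have "G \<in> polys_over (range \<gamma>)" by (simp add: polys_over_def)
  moreover have "poly G tK = 0" using pq(2) by (simp add: G_def poly_cst1_tK pq(1))
  ultimately have "F dvd G" using irreducible_over_dvd[OF gh F(1) _ F(2)] by blast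
  then have "poly G \<alpha> = 0" using a by (auto elim!: dvdE)
  then have "subst1 \<alpha> (to_fract p) = \<gamma> tK * subst1 \<alpha> (to_fract q)" by (simp add: G_def val)
  moreover have "subst1 \<alpha> (to_fract q) \<noteq> 0" using pq(2) field_hom_eq_0_iff[OF alg_homD(1)[OF s(1)]] by simp
  ultimately have "subst1 \<alpha> (\<gamma> tK) = \<gamma> tK" by (simp add: pq(1) s.hom_div)
  then have "subst1 \<alpha> \<circ> \<gamma> = \<gamma>" by (intro alg_hom_ext1[OF alg_hom_comp[OF g s(1)] g]) simp
  then show "\<forall>x\<in>range \<gamma>. subst1 \<alpha> x = x" by (auto simp: fun_eq_iff)
qed

text \<open>A repeated linear factor would divide the polynomial and its derivative.\<close>

lemma card_roots_separable:
  fixes F :: "'k::field poly"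
  assumes "splits F" "coprime F (pderiv F)" "F \<noteq> 0"
  shows "finite {\<alpha>. poly F \<alpha> = 0}" "card {\<alpha>. poly F \<alpha> = 0} = degree F"
proof -
  obtain c xs where F: "F = smult c (\<Prod>x\<leftarrow>xs. [:-x, 1:])" using assms(1) unfolding splits_def by blast
  have c: "c \<noteq> 0" using F assms(3) by auto
  have roots: "{\<alpha>. poly F \<alpha> = 0} = set xs"
    unfolding F using c by (auto simp: poly_prod_list prod_list_zero_iff o_def)
  have "distinct xs"
  proof (rule ccontr)
    assume "\<not> distinct xs"
    then obtain ys zs ws y where xs: "xs = ys @ [y] @ zs @ [y] @ ws" using not_distinct_decomp by blast
    define R where "R = smult c ((\<Prod>x\<leftarrow>ys. [:-x, 1:]) * (\<Prod>x\<leftarrow>zs. [:-x, 1:]) * (\<Prod>x\<leftarrow>ws. [:-x, 1:]))"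
    have "F = [:-y, 1:] * ([:-y, 1:] * R)" unfolding F xs R_def
      by (simp add: mult_ac del: mult_pCons_left mult_pCons_right)
    then have "poly F y = 0" "poly (pderiv F) y = 0"
      by (simp_all add: pderiv_mult del: mult_pCons_left mult_pCons_right)
    then have "[:-y, 1:] dvd F" "[:-y, 1:] dvd pderiv F" by (simp_all add: poly_eq_0_iff_dvd)
    then have "is_unit [:-y, 1:]" using assms(2) coprime_common_divisor by blast
    then show False by (simp add: is_unit_poly_iff)
  qed
  moreover have "degree F = length xs"
  proof -
    have "degree (\<Prod>x\<leftarrow>xs. [:-x, 1:]) = length xs"
    proof (induction xs)
      case (Cons a xs)
      have "(\<Prod>x\<leftarrow>xs. [:-x, 1:]) \<noteq> 0" by (auto simp: prod_list_zero_iff)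
      then show ?case using Cons.IH by (simp add: degree_mult_eq del: mult_pCons_left)
    qed simp
    then show ?thesis unfolding F using c by simp
  qed
  ultimately show "finite {\<alpha>. poly F \<alpha> = 0}" "card {\<alpha>. poly F \<alpha> = 0} = degree F"
    unfolding roots by (simp_all add: distinct_card)
qed

text \<open>A polynomial in \<open>x\<close> and \<open>y\<close> as a polynomial in \<open>x\<close> over \<open>C(y)\<close>;
its coefficients lie in every subfield that contains \<open>y\<close>.\<close>

definition x_poly :: "complex poly poly \<Rightarrow> complex poly poly fract poly" where
  "x_poly a = poly (map_poly (map_poly cst2) a) [:yK:]"

lemma poly_x_poly:
  assumes "alg_hom cst2 cst2 \<sigma>" "\<sigma> yK = yK"
  shows "poly (x_poly a) (\<sigma> xK) = \<sigma> (to_fract a)"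
proof -
  have "\<sigma> (to_fract a) = \<sigma> (poly (map_poly (\<lambda>q. poly (map_poly cst2 q) xK) a) yK)"
    using ev2_gen[of a] by (simp add: ev2_eq gen2_comp)
  also have "\<dots> = poly (map_poly (\<lambda>q. poly (map_poly cst2 q) (\<sigma> xK)) a) yK"
    using alg_hom_ev2[OF assms(1)] assms(2) by simp
  also have "\<dots> = poly (x_poly a) (\<sigma> xK)" unfolding x_poly_def
    by (induction a) (simp_all add: Polynomial.map_poly_pCons)
  finally show ?thesis ..
qed

lemma x_poly_polys_over:
  assumes M: "subfieldC cst2 M" "yK \<in> M" shows "x_poly a \<in> polys_over M"
proof (induction a)
  case 0
  then show ?case using subfieldCD(1)[OF M(1), of 0] by (simp add: x_poly_def polys_over_def)
next
  case (pCons q a)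
  have "x_poly (pCons q a) = map_poly cst2 q + smult yK (x_poly a)"
    by (simp add: x_poly_def Polynomial.map_poly_pCons)
  then have "coeff (x_poly (pCons q a)) i = cst2 (coeff q i) + yK * coeff (x_poly a) i" for i
    by (simp add: coeff_map_poly)
  then show ?case using pCons.IH subfieldCD(1-3)[OF M(1)] M(2) unfolding polys_over_def by simp
qed

text \<open>Let \<open>S\<close> be the set of roots of the minimal polynomial \<open>F\<close> of \<open>x\<close> over
\<open>C(G(x))\<close>; normality provides as many of them as the degree of \<open>F\<close>. The substitutions
\<open>x \<mapsto> \<alpha>\<close> for \<open>\<alpha> \<in> S\<close> are closed under composition and fix only
\<open>C(G(x), y)\<close>. So each element of \<open>C(x,y)\<close> is a root of the split polynomial whose roots are
its images under them, and the coefficients of this polynomial lie in \<open>C(G(x), y)\<close>.\<close>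

lemma extension_of_normal_ext:
  assumes g: "alg_hom cst1 cst1 \<gamma>" and n: "normal_ext (range \<gamma>)"
  shows "normal_ext (range (extend_endo \<gamma>))"
proof -
  define M where "M = range (extend_endo \<gamma>)"
  have gh: "field_hom \<gamma>" using g by (rule alg_homD)
  have Gh: "field_hom (extend_endo \<gamma>)" using extend_endo(1)[OF g] by (rule alg_homD)
  have subM: "subfieldC cst2 M" unfolding M_def by (rule subfieldC_range[OF extend_endo(1)[OF g]])
  note sub = subfieldCD[OF subM]
  have yM: "yK \<in> M" unfolding M_def by (rule yK_mem_range_extend[OF g])
  obtain F0 where F0: "F0 \<in> polys_over (range \<gamma>)" "F0 \<noteq> 0" "poly F0 tK = 0"
    using n unfolding normal_ext_def algebraic_ext_def by blast
  obtain F where F: "irreducible_over (range \<gamma>) F" "poly F tK = 0" by (rule minimal_polynomial[OF gh F0])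
  have F': "F \<in> polys_over (range \<gamma>)" "degree F > 0" "F \<noteq> 0" using F(1) unfolding irreducible_over_def by auto
  have "splits F" using n F unfolding normal_ext_splits by blast
  define S where "S = {\<alpha>. poly F \<alpha> = 0}"
  have S: "finite S" "card S = degree F"
    unfolding S_def using card_roots_separable[OF \<open>splits F\<close> irreducible_over_separable[OF gh F(1)] F'(3)] by simp_all
  have tS: "tK \<in> S" using F(2) by (simp add: S_def)
  define \<sigma> where "\<sigma> \<alpha> = extend_endo (subst1 \<alpha>)" for \<alpha>
  have root: "alg_hom cst1 cst1 (subst1 \<alpha>)" "subst1 \<alpha> tK = \<alpha>" "\<forall>x\<in>range \<gamma>. subst1 \<alpha> x = x" if "\<alpha> \<in> S" for \<alpha>
    using endo_to_root[OF g F] that unfolding S_def by simp_all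
  have s: "alg_hom cst2 cst2 (\<sigma> \<alpha>)" "\<sigma> \<alpha> yK = yK" "\<sigma> \<alpha> xK = emb \<alpha>" "\<forall>x\<in>M. \<sigma> \<alpha> x = x" if a: "\<alpha> \<in> S" for \<alpha>
    unfolding \<sigma>_def M_def using extend_endo[OF root(1)[OF a]] root(2,3)[OF a] extend_fixes_iff[OF g root(1)[OF a]]
    by (simp_all flip: emb(3))
  have st: "\<sigma> tK = id"
  proof -
    have "subst1 tK = id" using root(1,2)[OF tS] alg_hom_id by (intro alg_hom_ext1) simp_all
    then show ?thesis unfolding \<sigma>_def using extend_endo_id by simp
  qed
  have comp: "\<sigma> \<alpha>' \<circ> \<sigma> \<alpha> = \<sigma> (subst1 \<alpha>' \<alpha>)" "subst1 \<alpha>' \<alpha> \<in> S" if a: "\<alpha> \<in> S" "\<alpha>' \<in> S" for \<alpha> \<alpha>'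
  proof -
    have h: "field_hom (subst1 \<alpha>')" using root(1)[OF a(2)] by (rule alg_homD)
    have "map_poly (subst1 \<alpha>') F = F" using map_poly_fixed[OF h F'(1) root(3)[OF a(2)]] .
    then have "poly F (subst1 \<alpha>' \<alpha>) = subst1 \<alpha>' (poly F \<alpha>)" using map_poly_hom_simps(5)[OF h, of F \<alpha>] by simp
    then show m: "subst1 \<alpha>' \<alpha> \<in> S" using a(1) field_hom_eq_0_iff[OF h] by (simp add: S_def)
    have "subst1 \<alpha>' \<circ> subst1 \<alpha> = subst1 (subst1 \<alpha>' \<alpha>)"
      using alg_hom_comp[OF root(1)[OF a(1)] root(1)[OF a(2)]] root(1)[OF m] root(2) a m by (intro alg_hom_ext1) simp_all
    then show "\<sigma> \<alpha>' \<circ> \<sigma> \<alpha> = \<sigma> (subst1 \<alpha>' \<alpha>)"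
      unfolding \<sigma>_def using extend_endo_comp[OF root(1)[OF a(2)] root(1)[OF a(1)]] by simp
  qed
  define \<Phi> where "\<Phi> = map_poly emb F"
  have \<Phi>: "\<Phi> \<in> polys_over M" "degree \<Phi> = degree F" "\<Phi> \<noteq> 0"
    unfolding \<Phi>_def M_def using map_emb_polys_over[OF g] F' map_poly_hom_simps(7,8)[OF field_hom_emb] by simp_all
  have \<Phi>root: "poly \<Phi> (emb \<alpha>) = 0" if "\<alpha> \<in> S" for \<alpha>
    using that unfolding \<Phi>_def map_poly_hom_simps(5)[OF field_hom_emb] by (simp add: S_def emb_eq_0_iff)
  \<comment> \<open>Artin: an element fixed by all these endomorphisms lies in the lower field.\<close>
  have fixed: "f \<in> M" if f: "\<forall>\<alpha>\<in>S. \<sigma> \<alpha> f = f" for f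
  proof -
    obtain a b where ab: "f = to_fract a / to_fract b" "b \<noteq> 0" by (rule fract_as_quotient)
    \<comment> \<open>Numerator and denominator are polynomials in \<open>x\<close> over \<open>M\<close>; reducing them modulo \<open>F\<close> does not change their values at the roots.\<close>
    have reduce: "\<exists>A'\<in>polys_over M. degree A' < degree F \<and> (\<forall>\<alpha>\<in>S. poly A' (emb \<alpha>) = \<sigma> \<alpha> (to_fract a))" for a
    proof -
      obtain A0 where A0: "x_poly a = map_poly (extend_endo \<gamma>) A0"
        using x_poly_polys_over[OF subM yM, of a] polys_over_range[OF Gh] unfolding M_def by blast
      obtain \<Phi>0 where \<Phi>0: "\<Phi> = map_poly (extend_endo \<gamma>) \<Phi>0"
        using \<Phi>(1) polys_over_range[OF Gh] unfolding M_def by blast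
      have d0: "degree \<Phi>0 = degree F" "\<Phi>0 \<noteq> 0"
        using \<Phi>(2,3) unfolding \<Phi>0 map_poly_hom_simps(7,8)[OF Gh] by simp_all
      define A' where "A' = map_poly (extend_endo \<gamma>) (A0 mod \<Phi>0)"
      have "A0 = (A0 div \<Phi>0) * \<Phi>0 + A0 mod \<Phi>0" by simp
      then have "x_poly a = map_poly (extend_endo \<gamma>) (A0 div \<Phi>0) * \<Phi> + A'"
        unfolding A0 \<Phi>0 A'_def map_poly_hom_simps(1,2)[OF Gh, symmetric] by simp
      then have "poly A' (emb \<alpha>) = poly (x_poly a) (emb \<alpha>)" if "\<alpha> \<in> S" for \<alpha> using \<Phi>root[OF that] by simp
      then have "poly A' (emb \<alpha>) = \<sigma> \<alpha> (to_fract a)" if "\<alpha> \<in> S" for \<alpha>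
        using poly_x_poly[OF s(1,2)[OF that], of a] s(3)[OF that] that by simp
      moreover have "degree (A0 mod \<Phi>0) < degree F"
        using degree_mod_less[of \<Phi>0 A0] d0 F'(2) by auto
      then have "degree A' < degree F" unfolding A'_def map_poly_hom_simps(7)[OF Gh] .
      moreover have "A' \<in> polys_over M" unfolding A'_def M_def polys_over_range[OF Gh] by blast
      ultimately show ?thesis by blast
    qed
    obtain A where A: "A \<in> polys_over M" "degree A < degree F" "\<And>\<alpha>. \<alpha> \<in> S \<Longrightarrow> poly A (emb \<alpha>) = \<sigma> \<alpha> (to_fract a)" using reduce[of a] by blast
    obtain B where B: "B \<in> polys_over M" "degree B < degree F" "\<And>\<alpha>. \<alpha> \<in> S \<Longrightarrow> poly B (emb \<alpha>) = \<sigma> \<alpha> (to_fract b)" using reduce[of b] by blast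
    \<comment> \<open>\<open>D\<close> vanishes at more points than its degree allows, so \<open>f\<close> is a quotient of coefficients of \<open>A\<close> and \<open>B\<close>.\<close>
    define D where "D = A - smult f B"
    have "poly D (emb \<alpha>) = 0" if a: "\<alpha> \<in> S" for \<alpha>
    proof -
      interpret h: field_hom "\<sigma> \<alpha>" using s(1)[OF a] by (rule alg_homD)
      have "\<sigma> \<alpha> (to_fract b) \<noteq> 0" using ab(2) field_hom_eq_0_iff[OF alg_homD(1)[OF s(1)[OF a]]] by simp
      moreover have "f = \<sigma> \<alpha> (to_fract a) / \<sigma> \<alpha> (to_fract b)" using f a ab(1) h.hom_div by metis
      ultimately show ?thesis using A(3)[OF a] B(3)[OF a] by (simp add: D_def)
    qed
    then have rts: "emb ` S \<subseteq> {x. poly D x = 0}" by blast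
    have "card (emb ` S) = degree F" using S emb_eq_iff by (simp add: card_image inj_on_def)
    moreover have "degree D < degree F" unfolding D_def using A(2) B(2) F'(2)
      by (meson degree_diff_less degree_smult_le le_less_trans)
    ultimately have "D = 0" using card_mono[OF poly_roots_finite rts] poly_roots_degree[of D] by fastforce
    have "poly B (emb tK) \<noteq> 0" using B(3)[OF tS] ab(2) by (simp add: st)
    then have "B \<noteq> 0" by auto
    then obtain i where i: "coeff B i \<noteq> 0" by (meson leading_coeff_0_iff)
    have "coeff A i = f * coeff B i" using \<open>D = 0\<close> unfolding D_def by simp
    then have "f = coeff A i / coeff B i" using i by simp
    moreover have "coeff A i \<in> M" "coeff B i \<in> M" using A(1) B(1) unfolding polys_over_def by blast+
    ultimately show ?thesis using sub(7) by simp
  qed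
  \<comment> \<open>Every element is a root of its orbit polynomial, which splits and has coefficients in the lower field.\<close>
  have orbit: "\<exists>R\<in>polys_over M. R \<noteq> 0 \<and> splits R \<and> poly R \<beta> = 0" for \<beta>
  proof -
    define Orb where "Orb = (\<lambda>\<alpha>. \<sigma> \<alpha> \<beta>) ` S"
    define R where "R = (\<Prod>\<rho>\<in>Orb. [:-\<rho>, 1:])"
    have Orb: "finite Orb" "\<beta> \<in> Orb" unfolding Orb_def using S(1) tS st by (auto intro!: image_eqI[of _ _ tK])
    have "map_poly (\<sigma> \<alpha>) R = R" if a: "\<alpha> \<in> S" for \<alpha>
    proof -
      have h: "field_hom (\<sigma> \<alpha>)" using s(1)[OF a] by (rule alg_homD)
      interpret h: field_hom "\<sigma> \<alpha>" by (rule h)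
      have "\<sigma> \<alpha> ` Orb \<subseteq> Orb"
      proof
        fix x assume "x \<in> \<sigma> \<alpha> ` Orb"
        then obtain \<alpha>' where a': "\<alpha>' \<in> S" "x = (\<sigma> \<alpha> \<circ> \<sigma> \<alpha>') \<beta>" unfolding Orb_def by auto
        then show "x \<in> Orb" unfolding Orb_def using comp[OF a'(1) a] by auto
      qed
      then have perm: "\<sigma> \<alpha> ` Orb = Orb" using Orb(1) field_hom_inj[OF h] by (intro endo_inj_surj) (auto intro: inj_on_subset)
      have "map_poly (\<sigma> \<alpha>) (\<Prod>\<rho>\<in>X. [:-\<rho>, 1:]) = (\<Prod>\<rho>\<in>X. [:- \<sigma> \<alpha> \<rho>, 1:])" if "finite X" for X
        using that
      proof (induction X rule: finite_induct)
        case empty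
        show ?case by (simp add: map_poly_hom_simps(9)[OF h])
      next
        case (insert x X)
        have "map_poly (\<sigma> \<alpha>) [:-x, 1:] = [:- \<sigma> \<alpha> x, 1:]" by (simp add: map_poly_hom_simps(4)[OF h] h.hom_uminus)
        then show ?case using insert by (simp only: prod.insert[OF insert(1,2)] map_poly_hom_simps(2)[OF h])
      qed
      then have "map_poly (\<sigma> \<alpha>) R = (\<Prod>\<rho>\<in>Orb. [:- \<sigma> \<alpha> \<rho>, 1:])" unfolding R_def using Orb(1) by blast
      also have "\<dots> = (\<Prod>\<rho>\<in>\<sigma> \<alpha> ` Orb. [:-\<rho>, 1:])"
        using field_hom_inj[OF h] by (subst prod.reindex) (auto intro: inj_on_subset)
      finally show ?thesis unfolding perm R_def .
    qed
    then have "\<sigma> \<alpha> (coeff R i) = coeff R i" if "\<alpha> \<in> S" for \<alpha> i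
      using map_poly_hom_simps(10)[OF alg_homD(1)[OF s(1)[OF that]], of R i] that by simp
    then have "R \<in> polys_over M" unfolding polys_over_def using fixed by blast
    moreover have "R \<noteq> 0" unfolding R_def using Orb(1) by simp
    moreover have "splits R" unfolding R_def using Orb(1) by (rule splits_prod_set)
    moreover have "poly R \<beta> = 0" unfolding R_def using Orb by (auto simp: poly_prod)
    ultimately show ?thesis by blast
  qed
  have "splits p" if p: "irreducible_over M p" "poly p \<beta> = 0" for p \<beta>
  proof -
    obtain R where R: "R \<in> polys_over M" "R \<noteq> 0" "splits R" "poly R \<beta> = 0" using orbit by blast
    have "p dvd R" using irreducible_over_dvd[OF Gh, folded M_def, OF p(1) R(1) p(2) R(4)] .
    then show ?thesis using R(2,3) by (rule splits_dvd)
  qed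
  moreover have "algebraic_ext M" unfolding algebraic_ext_def using orbit by blast
  ultimately show ?thesis unfolding normal_ext_splits M_def by blast
qed

text \<open>Both extensions are separable, so that being Galois means being normal.\<close>

theorem galois_ext_extend:
  assumes "alg_hom cst1 cst1 \<gamma>"
  shows "galois_ext (range (extend_endo \<gamma>)) \<longleftrightarrow> galois_ext (range \<gamma>)"
  unfolding galois_ext_iff_normal_ext[OF alg_homD(1)[OF assms]] galois_ext_iff_normal_ext[OF alg_homD(1)[OF extend_endo(1)[OF assms]]]
  using normal_ext_of_extension[OF assms] extension_of_normal_ext[OF assms] by blast

section \<open>Rational functions invariant under an affine vector field\<close>

definition derivation :: "(complex \<Rightarrow> 'k::field) \<Rightarrow> ('k \<Rightarrow> 'k) \<Rightarrow> bool" where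
  "derivation k D \<longleftrightarrow> (\<forall>a b. D (a + b) = D a + D b) \<and> (\<forall>a b. D (a * b) = a * D b + b * D a) \<and> (\<forall>c. D (k c) = 0)"

lemma derivationD:
  assumes "derivation k D"
  shows "D (a + b) = D a + D b" "D (a * b) = a * D b + b * D a" "D (k c) = 0" "D 0 = 0" "D 1 = 0" "D (- a) = - D a" "D (a - b) = D a - D b"
    "b \<noteq> 0 \<Longrightarrow> D (a / b) = (D a - (a / b) * D b) / b"
proof -
  show add: "D (a + b) = D a + D b" and mult: "D (a * b) = a * D b + b * D a" and "D (k c) = 0" for a b c
    using assms by (simp_all add: derivation_def)
  have "D 0 + 0 = D 0 + D 0" using add[of 0 0] by (simp only: add_0_left add_0_right)
  then show z: "D 0 = 0" by (simp only: add_left_cancel)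
  have "D 1 + 0 = D 1 + D 1" using mult[of 1 1] by (simp only: mult_1_left mult_1_right add_0_right)
  then show one: "D 1 = 0" by (simp only: add_left_cancel)
  show neg: "D (- a) = - D a" for a using add[of a "- a"] z by (simp add: eq_neg_iff_add_eq_0 add.commute)
  show "D (a - b) = D a - D b" using add[of a "- b"] neg[of b] by simp
  show "D (a / b) = (D a - (a / b) * D b) / b" if "b \<noteq> 0"
    using mult[of "a / b" b] that by (simp add: field_simps)
qed

lemma derivation_conj:
  assumes D: "derivation k D" and t: "alg_hom k k \<tau>" "bij \<tau>"
  shows "derivation k (inv_into UNIV \<tau> \<circ> D \<circ> \<tau>)"
proof -
  have i: "alg_hom k k (inv_into UNIV \<tau>)" using t by (rule alg_hom_inv)
  interpret i: field_hom "inv_into UNIV \<tau>" using i by (rule alg_homD)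
  interpret t: field_hom \<tau> using t(1) by (rule alg_homD)
  have [simp]: "inv_into UNIV \<tau> (\<tau> a) = a" for a using t(2) by (simp add: bij_is_inj)
  show ?thesis unfolding derivation_def
    by (simp add: t.hom_add t.hom_mult i.hom_add i.hom_mult derivationD[OF D] alg_homD(2)[OF t(1)])
qed

text \<open>The quotient rule does not depend on the fraction that represents the element.\<close>

lemma derivation_fract:
  fixes d :: "'r::{factorial_ring_gcd,semiring_gcd_mult_normalize} \<Rightarrow> 'r"
  assumes add: "\<And>p q. d (p + q) = d p + d q" and mult: "\<And>p q. d (p * q) = p * d q + q * d p"
  obtains D where "\<And>a b. D (a + b) = D a + D b" "\<And>a b. D (a * b) = a * D b + b * D a" "\<And>p. D (to_fract p) = to_fract (d p)"
proof -
  define D where "D f = (case quot_of_fract f of (p, q) \<Rightarrow> (to_fract (d p) - f * to_fract (d q)) / to_fract q)" for f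
  have D: "D f = (to_fract (d a) - f * to_fract (d b)) / to_fract b" if f: "f = to_fract a / to_fract b" "b \<noteq> 0" for f a b
  proof -
    obtain p q where pq: "quot_of_fract f = (p, q)" by (cases "quot_of_fract f")
    have q: "q \<noteq> 0" using snd_quot_of_fract_nonzero[of f] pq by simp
    have f': "f = to_fract p / to_fract q"
      using Fract_quot_of_fract[of f] pq by (simp add: Fract_conv_to_fract)
    have "to_fract (a * q) = to_fract (p * b)" using f f' q by (simp add: frac_eq_eq)
    then have "a * q = p * b" by (simp only: to_fract_eq_iff)
    then have "d (a * q) = d (p * b)" by simp
    then have "to_fract (a * d q + q * d a) = to_fract (p * d b + b * d p)" unfolding mult by simp
    moreover have "to_fract a = f * to_fract b" unfolding f(1) using f(2) by simp
    moreover have "to_fract p = f * to_fract q" unfolding f' using q by simp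
    ultimately have "to_fract q * (to_fract (d a) - f * to_fract (d b)) = to_fract b * (to_fract (d p) - f * to_fract (d q))"
      by (simp add: algebra_simps)
    then show ?thesis unfolding D_def pq using q f(2) by (simp add: frac_eq_eq mult.commute)
  qed
  have "D (f + g) = D f + D g \<and> D (f * g) = f * D g + g * D f" for f g
  proof -
    obtain a b where f: "f = to_fract a / to_fract b" "b \<noteq> 0" by (rule fract_as_quotient)
    obtain c e where g: "g = to_fract c / to_fract e" "e \<noteq> 0" by (rule fract_as_quotient)
    define A B C E dA dB dC dE where "A = to_fract a" "B = to_fract b" "C = to_fract c" "E = to_fract e"
      "dA = to_fract (d a)" "dB = to_fract (d b)" "dC = to_fract (d c)" "dE = to_fract (d e)"
    note defs = this
    have nz: "B \<noteq> 0" "E \<noteq> 0" using f g by (simp_all add: defs)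
    have AC: "A = f * B" "C = g * E" using f g by (simp_all add: defs)
    have "f + g = to_fract (a * e + c * b) / to_fract (b * e)" "f * g = to_fract (a * c) / to_fract (b * e)" "b * e \<noteq> 0"
      using f g by (simp_all add: add_frac_eq)
    note eqs = D[OF this(1,3)] D[OF this(2,3)] D[OF f] D[OF g]
    have 1: "D (f + g) = (A * dE + E * dA + (C * dB + B * dC) - (f + g) * (B * dE + E * dB)) / (B * E)"
      unfolding eqs(1) by (simp add: add mult defs)
    have 2: "D (f * g) = (A * dC + C * dA - (f * g) * (B * dE + E * dB)) / (B * E)"
      unfolding eqs(2) by (simp add: add mult defs)
    have 3: "D f = (dA - f * dB) / B" "D g = (dC - g * dE) / E" unfolding eqs(3,4) defs by simp_all
    have "D f + D g = (E * (dA - f * dB) + B * (dC - g * dE)) / (B * E)" unfolding 3 using nz by (simp add: field_simps)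
    moreover have "f * D g + g * D f = (f * B * (dC - g * dE) + g * E * (dA - f * dB)) / (B * E)" unfolding 3 using nz by (simp add: field_simps)
    ultimately show ?thesis unfolding 1 2 AC by (simp add: algebra_simps)
  qed
  moreover have "D (to_fract p) = to_fract (d p)" for p
  proof -
    have "d 1 + 0 = d 1 + d 1" using mult[of 1 1] by (simp only: mult_1_left mult_1_right add_0_right)
    then have "d 1 = 0" by (simp only: add_left_cancel)
    then show ?thesis using D[of "to_fract p" p 1] by simp
  qed
  ultimately show thesis using that by blast
qed

lemma derivation_to_fract:
  assumes D: "derivation cst2 D" "D xK = to_fract V" "D yK = to_fract W"
  shows "D (to_fract p) = to_fract (V * map_poly pderiv p + W * pderiv p)"
proof -
  note d = derivationD[OF D(1)]
  have 1: "D (to_fract [:q:]) = to_fract (V * [:pderiv q:])" for q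
  proof (induction q)
    case 0
    then show ?case by (simp add: d(4))
  next
    case (pCons a q)
    have "to_fract [:pCons a q:] = cst2 a + xK * to_fract [:q:]"
      by (simp add: cst2_def xK_def flip: to_fract_add to_fract_mult)
    then have "D (to_fract [:pCons a q:]) = xK * to_fract (V * [:pderiv q:]) + to_fract [:q:] * to_fract V"
      by (simp add: d(1,2,3) pCons.IH D(2))
    also have "\<dots> = to_fract (polyX * (V * [:pderiv q:]) + [:q:] * V)" unfolding xK_def by (simp only: to_fract_add to_fract_mult)
    also have "polyX * (V * [:pderiv q:]) + [:q:] * V = V * [:pderiv (pCons a q):]"
    proof -
      have "[:pderiv (pCons a q):] = [:q:] + polyX * [:pderiv q:]" by (simp add: pderiv_pCons)
      then show ?thesis by (simp only: distrib_left mult_ac add_ac)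
    qed
    finally show ?case .
  qed
  show ?thesis
  proof (induction p)
    case 0
    then show ?case by (simp add: d(4))
  next
    case (pCons q p)
    have "to_fract (pCons q p) = to_fract [:q:] + yK * to_fract p"
      by (simp add: yK_def flip: to_fract_add to_fract_mult)
    then have "D (to_fract (pCons q p)) = to_fract (V * [:pderiv q:]) + (yK * to_fract (V * map_poly pderiv p + W * pderiv p) + to_fract p * to_fract W)"
      by (simp only: d(1,2) 1 pCons.IH D(3))
    also have "\<dots> = to_fract (V * [:pderiv q:] + (polyY * (V * map_poly pderiv p + W * pderiv p) + p * W))"
      unfolding yK_def by (simp only: to_fract_add to_fract_mult)
    also have "V * [:pderiv q:] + (polyY * (V * map_poly pderiv p + W * pderiv p) + p * W) = V * map_poly pderiv (pCons q p) + W * pderiv (pCons q p)"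
    proof -
      have "map_poly pderiv (pCons q p) = [:pderiv q:] + polyY * map_poly pderiv p" "pderiv (pCons q p) = p + polyY * pderiv p"
        by (simp_all add: Polynomial.map_poly_pCons pderiv_pCons)
      then show ?thesis by (simp only: distrib_left mult_ac add_ac)
    qed
    finally show ?case .
  qed
qed

text \<open>The vector field \<open>\<alpha> x \<partial>\<^sub>x + (\<beta> y + \<epsilon>) \<partial>\<^sub>y\<close> acting on
polynomials.\<close>

definition affine_op :: "complex \<Rightarrow> complex \<Rightarrow> complex \<Rightarrow> complex poly poly \<Rightarrow> complex poly poly" where
  "affine_op \<alpha> \<beta> \<epsilon> p = [:[:0, \<alpha>:]:] * map_poly pderiv p + [:[:\<epsilon>:], [:\<beta>:]:] * pderiv p"

lemma coeff_affine_op: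
  "coeff (affine_op \<alpha> \<beta> \<epsilon> p) j = [:0, \<alpha>:] * pderiv (coeff p j) + smult (\<beta> * of_nat j) (coeff p j) + smult (\<epsilon> * of_nat (Suc j)) (coeff p (Suc j))"
  unfolding affine_op_def by (cases j) (simp_all add: coeff_map_poly coeff_pderiv of_nat_poly algebra_simps smult_add_left)

lemma coeff_coeff_affine_op:
  "coeff (coeff (affine_op \<alpha> \<beta> \<epsilon> p) j) i = (\<alpha> * of_nat i + \<beta> * of_nat j) * coeff (coeff p j) i + \<epsilon> * of_nat (Suc j) * coeff (coeff p (Suc j)) i"
  unfolding coeff_affine_op by (cases i) (simp_all add: coeff_pderiv algebra_simps)

text \<open>The field raises neither the degree in \<open>y\<close> nor the degree in \<open>x\<close> of the leading coefficient,
so multiplication by \<open>\<mu>\<close> does not raise them.\<close>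

lemma affine_op_eigenvalue_constant:
  assumes "affine_op \<alpha> \<beta> \<epsilon> p = \<mu> * p" "p \<noteq> 0"
  obtains l where "\<mu> = [:[:l:]:]"
proof (cases "\<mu> = 0")
  case True
  then show thesis using that[of 0] by simp
next
  case False
  have "degree (affine_op \<alpha> \<beta> \<epsilon> p) \<le> degree p" by (rule degree_le) (simp add: coeff_affine_op coeff_eq_0)
  then have "degree \<mu> = 0" using assms False by (simp add: degree_mult_eq)
  then obtain r where r: "\<mu> = [:r:]" by (rule degree_eq_zeroE)
  define c where "c = coeff p (degree p)"
  have c: "c \<noteq> 0" "r \<noteq> 0" using assms(2) False r by (simp_all add: c_def)
  have "coeff (affine_op \<alpha> \<beta> \<epsilon> p) (degree p) = r * c" unfolding assms(1) r by (simp add: c_def)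
  then have eq: "[:0, \<alpha>:] * pderiv c + smult (\<beta> * of_nat (degree p)) c = r * c"
    unfolding coeff_affine_op by (simp add: c_def coeff_eq_0)
  have "degree ([:0, \<alpha>:] * pderiv c + smult (\<beta> * of_nat (degree p)) c) \<le> degree c"
  proof (rule degree_le, intro allI impI)
    fix i assume "degree c < i"
    then show "coeff ([:0, \<alpha>:] * pderiv c + smult (\<beta> * of_nat (degree p)) c) i = 0"
      by (cases i) (simp_all add: coeff_pderiv coeff_eq_0)
  qed
  then have "degree r = 0" unfolding eq using c by (simp add: degree_mult_eq)
  then obtain l where "r = [:l:]" by (rule degree_eq_zeroE)
  then show thesis using that r by simp
qed

text \<open>In lowest terms \<open>f = a / b\<close>, invariance means \<open>b (D a) = a (D b)\<close>. So \<open>b\<close>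
divides \<open>D b\<close>, and \<open>a\<close> and \<open>b\<close> are eigenvectors with the same eigenvalue, which
is a constant. The conclusion spells this out for the coefficients.\<close>

lemma invariant_fraction:
  assumes D: "derivation cst2 D" "D xK = cst2 \<alpha> * xK" "D yK = cst2 \<beta> * yK + cst2 \<epsilon>" and f: "D f = 0" "f \<noteq> 0"
  obtains a b l where "f = to_fract a / to_fract b" "a \<noteq> 0" "b \<noteq> 0"
    "\<forall>i j. (\<alpha> * of_nat i + \<beta> * of_nat j) * coeff (coeff a j) i + \<epsilon> * of_nat (Suc j) * coeff (coeff a (Suc j)) i = l * coeff (coeff a j) i"
    "\<forall>i j. (\<alpha> * of_nat i + \<beta> * of_nat j) * coeff (coeff b j) i + \<epsilon> * of_nat (Suc j) * coeff (coeff b (Suc j)) i = l * coeff (coeff b j) i"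
proof -
  have "cst2 \<alpha> * xK = to_fract ([:[:\<alpha>:]:] * polyX)" unfolding cst2_def xK_def by (simp only: to_fract_mult)
  then have 1: "cst2 \<alpha> * xK = to_fract [:[:0, \<alpha>:]:]" by simp
  have "cst2 \<beta> * yK + cst2 \<epsilon> = to_fract ([:[:\<beta>:]:] * polyY + [:[:\<epsilon>:]:])" unfolding cst2_def yK_def by (simp only: to_fract_mult to_fract_add)
  then have 2: "cst2 \<beta> * yK + cst2 \<epsilon> = to_fract [:[:\<epsilon>:], [:\<beta>:]:]" by simp
  have Dp: "D (to_fract p) = to_fract (affine_op \<alpha> \<beta> \<epsilon> p)" for p
    unfolding affine_op_def by (rule derivation_to_fract[OF D(1) D(2)[unfolded 1] D(3)[unfolded 2]])
  define a b where "a = fst (quot_of_fract f)" and "b = snd (quot_of_fract f)"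
  have fab: "f = to_fract a / to_fract b" using Fract_quot_of_fract[of f] by (simp add: a_def b_def Fract_conv_to_fract)
  have b: "b \<noteq> 0" unfolding b_def by (rule snd_quot_of_fract_nonzero)
  have co: "coprime a b" unfolding a_def b_def by (rule coprime_quot_of_fract)
  have a: "a \<noteq> 0" using fab f(2) by auto
  have "D (to_fract a) = f * D (to_fract b)"
    using derivationD(2)[OF D(1), of f "to_fract b"] f(1) fab b by simp
  then have "to_fract b * D (to_fract a) = to_fract a * D (to_fract b)" using b fab by simp
  then have "to_fract (b * affine_op \<alpha> \<beta> \<epsilon> a) = to_fract (a * affine_op \<alpha> \<beta> \<epsilon> b)" unfolding Dp by simp
  then have eq: "b * affine_op \<alpha> \<beta> \<epsilon> a = a * affine_op \<alpha> \<beta> \<epsilon> b" by (simp only: to_fract_eq_iff)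
  then have "b dvd a * affine_op \<alpha> \<beta> \<epsilon> b" by (metis dvd_triv_left)
  then have "b dvd affine_op \<alpha> \<beta> \<epsilon> b" using co by (simp add: coprime_commute coprime_dvd_mult_right_iff)
  then obtain \<mu> where lb: "affine_op \<alpha> \<beta> \<epsilon> b = \<mu> * b" by (metis dvdE mult.commute)
  then have "b * affine_op \<alpha> \<beta> \<epsilon> a = b * (\<mu> * a)" using eq by (simp add: mult_ac)
  then have la: "affine_op \<alpha> \<beta> \<epsilon> a = \<mu> * a" using b by simp
  obtain l where l: "\<mu> = [:[:l:]:]" using lb b by (rule affine_op_eigenvalue_constant)
  show thesis
  proof (rule that[OF fab a b])
    show "\<forall>i j. (\<alpha> * of_nat i + \<beta> * of_nat j) * coeff (coeff a j) i + \<epsilon> * of_nat (Suc j) * coeff (coeff a (Suc j)) i = l * coeff (coeff a j) i"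
      "\<forall>i j. (\<alpha> * of_nat i + \<beta> * of_nat j) * coeff (coeff b j) i + \<epsilon> * of_nat (Suc j) * coeff (coeff b (Suc j)) i = l * coeff (coeff b j) i"
      unfolding coeff_coeff_affine_op[symmetric] la lb l by simp_all
  qed
qed

lemma nonzero_coeff_coeff: assumes "(p :: complex poly poly) \<noteq> 0" obtains i j where "coeff (coeff p j) i \<noteq> 0"
  using assms by (metis leading_coeff_0_iff)

text \<open>Two multiples of the same monomial have a constant quotient.\<close>

lemma single_monomial_constant:
  assumes "\<And>i j. coeff (coeff a j) i \<noteq> 0 \<Longrightarrow> i = i0 \<and> j = j0" "\<And>i j. coeff (coeff b j) i \<noteq> 0 \<Longrightarrow> i = i0 \<and> j = j0"
    and "b \<noteq> 0"
  shows "to_fract a / to_fract b \<in> range cst2"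
proof -
  define s t where "s = coeff (coeff a j0) i0" and "t = coeff (coeff b j0) i0"
  obtain i j where ij: "coeff (coeff b j) i \<noteq> 0" using assms(3) by (rule nonzero_coeff_coeff)
  from assms(2)[OF ij] have "i = i0" by (rule conjunct1)
  moreover from assms(2)[OF ij] have "j = j0" by (rule conjunct2)
  ultimately have "t \<noteq> 0" using ij unfolding t_def by (simp only: not_False_eq_True)
  have "smult [:t:] a = smult [:s:] b"
  proof (intro poly_eqI)
    fix j i
    show "coeff (coeff (smult [:t:] a) j) i = coeff (coeff (smult [:s:] b) j) i"
    proof (cases "i = i0 \<and> j = j0")
      case True
      then show ?thesis by (simp add: s_def t_def)
    next
      case False
      then have "coeff (coeff a j) i = 0" "coeff (coeff b j) i = 0" using assms(1,2) by blast+
      then show ?thesis by simp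
    qed
  qed
  then have "to_fract ([:[:t:]:] * a) = to_fract ([:[:s:]:] * b)" by simp
  then have "cst2 t * to_fract a = cst2 s * to_fract b" by (simp only: to_fract_mult cst2_def)
  moreover have "cst2 t \<noteq> 0" using \<open>t \<noteq> 0\<close> by (simp add: cst2_def)
  ultimately have "to_fract a / to_fract b = cst2 s / cst2 t" using assms(3) by (simp add: field_simps)
  also have "\<dots> = cst2 (s / t)"
  proof -
    have "cst2 (s / t) * cst2 t = cst2 s" unfolding cst2_def to_fract_mult[symmetric] using \<open>t \<noteq> 0\<close> by simp
    then show ?thesis using \<open>cst2 t \<noteq> 0\<close> by (simp add: field_simps)
  qed
  finally show ?thesis by simp
qed

lemma cst2_0_mem: "0 \<in> range cst2" by (rule range_eqI[of _ _ 0]) simp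

text \<open>Let \<open>p\<close> be the numerator or the denominator. Among the terms of \<open>p\<close> with a fixed power
\<open>x\<^sup>i\<close>, the one of highest degree in \<open>y\<close> shows that the eigenvalue is \<open>\<alpha>
i\<close>. The other equations for this \<open>i\<close> then say that all terms which contain \<open>y\<close>
vanish. Since \<open>\<alpha> \<noteq> 0\<close>, only one \<open>i\<close> occurs, so both polynomials are multiples
of the same monomial \<open>x\<^sup>i\<close>.\<close>

lemma invariants_constant_additive:
  assumes D: "derivation cst2 D" "D xK = cst2 \<alpha> * xK" "D yK = 1" and "\<alpha> \<noteq> 0" "D f = 0"
  shows "f \<in> range cst2"
proof (cases "f = 0")
  case False
  have D': "D yK = cst2 0 * yK + cst2 1" using D(3) by (simp add: cst2_def flip: one_pCons)
  obtain a b l where f: "f = to_fract a / to_fract b" "a \<noteq> 0" "b \<noteq> 0"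
    "\<forall>i j. (\<alpha> * of_nat i + 0 * of_nat j) * coeff (coeff a j) i + 1 * of_nat (Suc j) * coeff (coeff a (Suc j)) i = l * coeff (coeff a j) i"
    "\<forall>i j. (\<alpha> * of_nat i + 0 * of_nat j) * coeff (coeff b j) i + 1 * of_nat (Suc j) * coeff (coeff b (Suc j)) i = l * coeff (coeff b j) i"
    by (rule invariant_fraction[OF D(1,2) D' assms(5) False])
  have supp: "\<alpha> * of_nat i = l \<and> j = 0"
    if eq: "\<forall>i j. (\<alpha> * of_nat i + 0 * of_nat j) * coeff (coeff p j) i + 1 * of_nat (Suc j) * coeff (coeff p (Suc j)) i = l * coeff (coeff p j) i"
      and nz: "coeff (coeff p j) i \<noteq> 0" for p i j
  proof -
    have fin: "\<forall>k. coeff (coeff p k) i \<noteq> 0 \<longrightarrow> k \<le> degree p" by (metis coeff_0 coeff_eq_0 not_le)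
    obtain k where k: "coeff (coeff p k) i \<noteq> 0" "\<forall>m. coeff (coeff p m) i \<noteq> 0 \<longrightarrow> m \<le> k"
      using Nat.ex_has_greatest_nat[of "\<lambda>k. coeff (coeff p k) i \<noteq> 0" j "degree p"] nz fin by auto
    have "coeff (coeff p (Suc k)) i = 0" using k(2) by (meson not_less_eq_eq order_refl)
    then have l: "\<alpha> * of_nat i = l" using eq[rule_format, of i k] k(1) by simp
    have "coeff (coeff p (Suc m)) i = 0" for m
    proof -
      have "of_nat (Suc m) * coeff (coeff p (Suc m)) i = 0" using eq[rule_format, of i m] l by (simp del: of_nat_Suc)
      then show ?thesis by (simp del: of_nat_Suc)
    qed
    then show ?thesis using l nz by (cases j) auto
  qed
  obtain i0 j0 where "coeff (coeff b j0) i0 \<noteq> 0" using f(3) by (rule nonzero_coeff_coeff)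
  then have i0: "\<alpha> * of_nat i0 = l" using supp[OF f(5)] by blast
  have "to_fract a / to_fract b \<in> range cst2"
  proof (rule single_monomial_constant[of _ i0 0])
    fix i j
    show "coeff (coeff a j) i \<noteq> 0 \<Longrightarrow> i = i0 \<and> j = 0" "coeff (coeff b j) i \<noteq> 0 \<Longrightarrow> i = i0 \<and> j = 0"
      using supp[OF f(4), of j i] supp[OF f(5), of j i] i0 assms(4) by auto
  qed (rule f(3))
  then show ?thesis using f(1) by simp
qed (simp add: cst2_0_mem)

text \<open>The monomials \<open>x\<^sup>i y\<^sup>j\<close> are eigenvectors with pairwise distinct eigenvalues, so numerator and
denominator are multiples of the same monomial.\<close>

lemma invariants_constant_torus:
  assumes D: "derivation cst2 D" "D xK = cst2 \<alpha> * xK" "D yK = cst2 \<beta> * yK"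
    and indep: "\<And>i j :: int. \<alpha> * of_int i + \<beta> * of_int j = 0 \<Longrightarrow> i = 0 \<and> j = 0" and "D f = 0"
  shows "f \<in> range cst2"
proof (cases "f = 0")
  case False
  have D': "D yK = cst2 \<beta> * yK + cst2 0" using D(3) by simp
  obtain a b l where f: "f = to_fract a / to_fract b" "a \<noteq> 0" "b \<noteq> 0"
    "\<forall>i j. (\<alpha> * of_nat i + \<beta> * of_nat j) * coeff (coeff a j) i + 0 * of_nat (Suc j) * coeff (coeff a (Suc j)) i = l * coeff (coeff a j) i"
    "\<forall>i j. (\<alpha> * of_nat i + \<beta> * of_nat j) * coeff (coeff b j) i + 0 * of_nat (Suc j) * coeff (coeff b (Suc j)) i = l * coeff (coeff b j) i"
    by (rule invariant_fraction[OF D(1,2) D' assms(5) False])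
  obtain i0 j0 where ij: "coeff (coeff b j0) i0 \<noteq> 0" using f(3) by (rule nonzero_coeff_coeff)
  then have l: "l = \<alpha> * of_nat i0 + \<beta> * of_nat j0" using f(5)[rule_format, of i0 j0] by simp
  have uniq: "i = i0 \<and> j = j0" if "\<alpha> * of_nat i + \<beta> * of_nat j = l" for i j
    using indep[of "int i - int i0" "int j - int j0"] that l by (simp add: algebra_simps)
  have "to_fract a / to_fract b \<in> range cst2"
  proof (rule single_monomial_constant[of _ i0 j0])
    fix i j
    show "coeff (coeff a j) i \<noteq> 0 \<Longrightarrow> i = i0 \<and> j = j0" "coeff (coeff b j) i \<noteq> 0 \<Longrightarrow> i = i0 \<and> j = j0"
      using uniq[of i j] f(4)[rule_format, of i j] f(5)[rule_format, of i j] by auto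
  qed (rule f(3))
  then show ?thesis using f(1) by simp
qed (simp add: cst2_0_mem)

text \<open>Both numerator and denominator are a polynomial in \<open>x\<close> times the same power of \<open>y\<close>, so that
\<open>y\<close> cancels.\<close>

lemma invariants_in_emb:
  assumes D: "derivation cst2 D" "D xK = 0" "D yK = cst2 \<beta> * yK + cst2 \<epsilon>" and be: "\<beta> \<noteq> 0 \<and> \<epsilon> = 0 \<or> \<beta> = 0 \<and> \<epsilon> \<noteq> 0"
    and "D f = 0"
  shows "f \<in> range emb"
proof (cases "f = 0")
  case False
  have D': "D xK = cst2 0 * xK" using D(2) by simp
  obtain a b l where f: "f = to_fract a / to_fract b" "a \<noteq> 0" "b \<noteq> 0"
    "\<forall>i j. (0 * of_nat i + \<beta> * of_nat j) * coeff (coeff a j) i + \<epsilon> * of_nat (Suc j) * coeff (coeff a (Suc j)) i = l * coeff (coeff a j) i"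
    "\<forall>i j. (0 * of_nat i + \<beta> * of_nat j) * coeff (coeff b j) i + \<epsilon> * of_nat (Suc j) * coeff (coeff b (Suc j)) i = l * coeff (coeff b j) i"
    by (rule invariant_fraction[OF D(1) D' D(3) assms(5) False])
  have "\<exists>j0. (\<forall>j. coeff a j \<noteq> 0 \<longrightarrow> j = j0) \<and> (\<forall>j. coeff b j \<noteq> 0 \<longrightarrow> j = j0)"
  proof (cases "\<beta> = 0")
    case False
    then have e: "\<epsilon> = 0" using be by simp
    obtain i0 j0 where ij: "coeff (coeff b j0) i0 \<noteq> 0" using f(3) by (rule nonzero_coeff_coeff)
    then have l: "l = \<beta> * of_nat j0" using f(5)[rule_format, of i0 j0] e by simp
    have "j = j0" if p: "\<forall>i j. (0 * of_nat i + \<beta> * of_nat j) * coeff (coeff p j) i + \<epsilon> * of_nat (Suc j) * coeff (coeff p (Suc j)) i = l * coeff (coeff p j) i"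
      and nz: "coeff p j \<noteq> 0" for p j
    proof -
      have "coeff (coeff p j) (degree (coeff p j)) \<noteq> 0" using nz by simp
      then have "\<beta> * of_nat j = l" using p[rule_format, of "degree (coeff p j)" j] e by simp
      then show ?thesis using l False by simp
    qed
    then show ?thesis using f(4,5) by blast
  next
    case True
    then have e: "\<epsilon> \<noteq> 0" using be by simp
    have "j = 0" if p: "\<forall>i j. (0 * of_nat i + \<beta> * of_nat j) * coeff (coeff p j) i + \<epsilon> * of_nat (Suc j) * coeff (coeff p (Suc j)) i = l * coeff (coeff p j) i"
      and nz: "coeff p j \<noteq> 0" for p j
    proof -
      have "p \<noteq> 0" using nz by auto
      then obtain i where i: "coeff (coeff p (degree p)) i \<noteq> 0" by (metis leading_coeff_0_iff)
      have "l = 0" using p[rule_format, of i "degree p"] i True by (simp add: coeff_eq_0)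
      have "coeff (coeff p (Suc m)) i = 0" for m i
      proof -
        have "\<epsilon> * of_nat (Suc m) * coeff (coeff p (Suc m)) i = 0" using p[rule_format, of i m] True \<open>l = 0\<close> by (simp del: of_nat_Suc)
        then show ?thesis using e by (simp del: of_nat_Suc)
      qed
      then have "coeff p (Suc m) = 0" for m by (intro poly_eqI) simp
      then show ?thesis using nz by (cases j) auto
    qed
    then show ?thesis using f(4,5) by blast
  qed
  then obtain j0 where j0: "\<forall>j. coeff a j \<noteq> 0 \<longrightarrow> j = j0" "\<forall>j. coeff b j \<noteq> 0 \<longrightarrow> j = j0" by blast
  define s t where "s = coeff a j0" and "t = coeff b j0"
  have "t \<noteq> 0" unfolding t_def using j0(2) f(3) by (metis leading_coeff_0_iff)
  have "[:t:] * a = [:s:] * b"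
  proof (rule poly_eqI)
    fix j
    show "coeff ([:t:] * a) j = coeff ([:s:] * b) j"
    proof (cases "j = j0")
      case False
      then have "coeff a j = 0" "coeff b j = 0" using j0 by blast+
      then show ?thesis by simp
    qed (simp add: s_def t_def)
  qed
  then have "to_fract [:t:] * to_fract a = to_fract [:s:] * to_fract b" by (simp only: to_fract_mult[symmetric])
  moreover have "to_fract a = f * to_fract b" using f(1,3) by simp
  ultimately have "(to_fract [:t:] * f) * to_fract b = to_fract [:s:] * to_fract b" by (simp only: mult.assoc)
  then have "to_fract [:t:] * f = to_fract [:s:]" using f(3) by (subst (asm) mult_right_cancel) simp_all
  then have "f = to_fract [:s:] / to_fract [:t:]" using \<open>t \<noteq> 0\<close> by (simp add: eq_divide_eq mult.commute)
  also have "\<dots> = emb (to_fract s / to_fract t)"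
  proof -
    interpret e: field_hom emb by (rule field_hom_emb)
    show ?thesis by (simp only: e.hom_div emb(2))
  qed
  finally show ?thesis by simp
next
  case True
  then show ?thesis using emb_eq_0_iff[of 0] by (metis rangeI)
qed

section \<open>The Gauss map in normal form coordinates\<close>

text \<open>There are generators \<open>t, s\<close> of \<open>C(x,y)\<close> over the complex numbers, namely the images of
\<open>x\<close> and \<open>y\<close> under \<open>\<tau>\<close>, and a non-constant \<open>G\<close>, the image of
\<open>x\<close> under \<open>\<gamma>\<close>, such that \<open>M = C(G(t), s)\<close>.\<close>

definition rational_quotient :: "complex poly poly fract set \<Rightarrow> bool" where
  "rational_quotient M \<longleftrightarrow> (\<exists>\<tau> \<gamma>. alg_hom cst2 cst2 \<tau> \<and> bij \<tau> \<and> alg_hom cst1 cst1 \<gamma> \<and> M = \<tau> ` range (extend_endo \<gamma>))"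

lemma rational_quotient_image:
  assumes "rational_quotient M" "alg_hom cst2 cst2 \<tau>" "bij \<tau>"
  shows "rational_quotient (\<tau> ` M)"
proof -
  obtain \<tau>' \<gamma> where *: "alg_hom cst2 cst2 \<tau>'" "bij \<tau>'" "alg_hom cst1 cst1 \<gamma>" "M = \<tau>' ` range (extend_endo \<gamma>)"
    using assms(1) unfolding rational_quotient_def by blast
  have "\<tau> ` M = (\<tau> \<circ> \<tau>') ` range (extend_endo \<gamma>)" unfolding *(4) by (simp add: image_comp)
  moreover have "alg_hom cst2 cst2 (\<tau> \<circ> \<tau>')" "bij (\<tau> \<circ> \<tau>')"
    using alg_hom_comp[OF *(1) assms(2)] bij_comp[OF *(2) assms(3)] by simp_all
  ultimately show ?thesis unfolding rational_quotient_def using *(3) by blast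
qed

lemma alg_hom_bijI:
  assumes "alg_hom cst2 cst2 \<tau>" "xK \<in> range \<tau>" "yK \<in> range \<tau>" shows "bij \<tau>"
  using gen2_subfield[OF subfieldC_range[OF assms(1)] assms(2,3)] field_hom_inj[OF alg_homD(1)[OF assms(1)]]
  unfolding bij_def by blast

text \<open>The change \<open>y \<mapsto> h(x) y + c(x)\<close> of the generator over \<open>C(x)\<close>.\<close>

lemma affine_automorphism:
  assumes "h \<noteq> 0"
  obtains \<tau> where "alg_hom cst2 cst2 \<tau>" "bij \<tau>" "\<forall>f. \<tau> (emb f) = emb f" "\<tau> yK = emb h * yK + emb c"
proof -
  define z where "z = emb h * yK + emb c"
  define \<rho> where "\<rho> p = poly (map_poly emb (fract_poly p)) z" for p
  interpret e: field_hom emb by (rule field_hom_emb)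
  have comp: "poly (map_poly emb (pcompose q [:c, h:])) yK = poly (map_poly emb q) z" for q
  proof (induction q)
    case (pCons a q)
    then show ?case
      by (simp add: pcompose_pCons map_poly_hom_simps[OF field_hom_emb] z_def Polynomial.map_poly_pCons algebra_simps)
  qed (simp)
  have nz: "\<rho> p \<noteq> 0" if "p \<noteq> 0" for p
  proof
    assume "\<rho> p = 0"
    then have "pcompose (fract_poly p) [:c, h:] = 0" unfolding \<rho>_def comp[symmetric] by (rule y_transcendental)
    then have "fract_poly p = 0" by (rule pcompose_eq_0) (use assms in simp)
    then show False using that by simp
  qed
  have hom: "comm_ring_hom \<rho>" unfolding \<rho>_def
    by unfold_locales (simp_all add: map_poly_hom_simps[OF field_hom_emb])
  define \<tau> where "\<tau> = fract_lift \<rho>"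
  have val: "\<tau> (to_fract p) = \<rho> p" for p unfolding \<tau>_def by (rule fract_lift(2)[OF hom nz])
  have fh: "field_hom \<tau>" unfolding \<tau>_def by (rule fract_lift(3)[OF hom nz])
  interpret t: field_hom \<tau> by (rule fh)
  have q: "\<tau> (to_fract [:q:]) = to_fract [:q:]" for q unfolding val \<rho>_def by (simp add: Polynomial.map_poly_pCons emb(2))
  have emb': "\<tau> (emb f) = emb f" for f
  proof -
    obtain a b where f: "f = to_fract a / to_fract b" "b \<noteq> 0" by (rule fract_as_quotient)
    show ?thesis unfolding f(1) e.hom_div t.hom_div emb(2) q ..
  qed
  have alg: "alg_hom cst2 cst2 \<tau>" unfolding alg_hom_def using fh q by (simp add: cst2_def)
  have y: "\<tau> yK = z" unfolding yK_def val \<rho>_def by (simp add: Polynomial.map_poly_pCons)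
  note sub = subfieldCD[OF subfieldC_range[OF alg]]
  have er: "emb f \<in> range \<tau>" for f using emb'[of f] by (metis rangeI)
  have "yK = (z - emb c) / emb h" using assms emb_eq_0_iff by (simp add: z_def)
  moreover have "z \<in> range \<tau>" using y by (metis rangeI)
  ultimately have "yK \<in> range \<tau>" using sub(6,7) er by metis
  moreover have "xK \<in> range \<tau>" using er[of tK] by (simp add: emb(3))
  ultimately have "bij \<tau>" using alg by (intro alg_hom_bijI)
  then show thesis using emb' y unfolding z_def by (intro that[OF alg]) simp_all
qed

text \<open>The range is \<open>C(G(x), h(x) y + c(x))\<close>, and an affine change of the second generator brings it into the
standard form. The last assumption says that these two elements generate the range.\<close>

lemma rational_quotientI:
  assumes s: "alg_hom cst2 cst2 \<sigma>" and G: "G \<notin> range cst1" and "h \<noteq> 0"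
    and mem: "emb G \<in> range \<sigma>" "emb h * yK + emb c \<in> range \<sigma>"
    and gen: "\<And>M. subfieldC cst2 M \<Longrightarrow> emb G \<in> M \<Longrightarrow> emb h * yK + emb c \<in> M \<Longrightarrow> \<sigma> xK \<in> M \<and> \<sigma> yK \<in> M"
  shows "rational_quotient (range \<sigma>)"
proof -
  obtain \<tau> where t: "alg_hom cst2 cst2 \<tau>" "bij \<tau>" "\<forall>f. \<tau> (emb f) = emb f" "\<tau> yK = emb h * yK + emb c"
    using assms(3) by (rule affine_automorphism)
  have g: "alg_hom cst1 cst1 (subst1 G)" "subst1 G tK = G" using subst1[OF P1_dominant_nonconstant[OF G]] by simp_all
  define \<rho> where "\<rho> = \<tau> \<circ> extend_endo (subst1 G)"
  have r: "alg_hom cst2 cst2 \<rho>" unfolding \<rho>_def using extend_endo(1)[OF g(1)] t(1) by (rule alg_hom_comp)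
  have "extend_endo (subst1 G) xK = emb G" using extend_endo(2)[OF g(1), of tK] by (simp add: g(2) emb(3))
  then have rx: "\<rho> xK = emb G" by (simp add: \<rho>_def t(3))
  have ry: "\<rho> yK = emb h * yK + emb c" by (simp add: \<rho>_def extend_endo(3)[OF g(1)] t(4))
  have "range \<rho> \<subseteq> range \<sigma>" using mem rx ry by (intro range_subset2[OF r subfieldC_range[OF s]]) simp_all
  moreover have "emb G \<in> range \<rho>" "emb h * yK + emb c \<in> range \<rho>" using rx ry by (metis rangeI)+
  then have "range \<sigma> \<subseteq> range \<rho>"
    using gen[OF subfieldC_range[OF r]] by (intro range_subset2[OF s subfieldC_range[OF r]]) simp_all
  ultimately have "range \<sigma> = \<tau> ` range (extend_endo (subst1 G))" by (auto simp: \<rho>_def image_comp)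
  then show ?thesis unfolding rational_quotient_def using t(1,2) g(1) by blast
qed

lemma cst2_field: "cst2 1 = 1" "cst2 (a + b) = cst2 a + cst2 b" "cst2 (a * b) = cst2 a * cst2 b" "cst2 (- a) = - cst2 a" "cst2 a = 0 \<longleftrightarrow> a = 0"
proof -
  interpret c: comm_ring_hom cst2 by (rule comm_ring_hom_cst2)
  show "cst2 1 = 1" "cst2 (a + b) = cst2 a + cst2 b" "cst2 (a * b) = cst2 a * cst2 b" "cst2 (- a) = - cst2 a"
    by (rule c.hom_one c.hom_add c.hom_mult c.hom_uminus)+
  show "cst2 a = 0 \<longleftrightarrow> a = 0" by (simp add: cst2_def)
qed

lemma emb_cst1: "emb (cst1 c) = cst2 c" using emb(1) by (rule alg_homD)

lemma nonconstant_generators: "xK \<noteq> cst2 c" "yK \<noteq> cst2 c" "xK \<noteq> 0" "yK \<noteq> 0"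
  by (simp_all add: xK_def yK_def cst2_def)

lemma hom_reflects_constants:
  assumes "alg_hom k l \<sigma>" "\<sigma> f \<in> range l" shows "f \<in> range k"
proof -
  obtain c where "\<sigma> f = l c" using assms(2) by blast
  then have "\<sigma> f = \<sigma> (k c)" using alg_homD(2)[OF assms(1)] by simp
  then show ?thesis using field_hom_eq_iff[OF alg_homD(1)[OF assms(1)]] by simp
qed

lemma range_UNIVI:
  assumes "alg_hom cst2 cst2 \<sigma>" "xK \<in> range \<sigma>" "yK \<in> range \<sigma>" shows "range \<sigma> = UNIV"
  using alg_hom_bijI[OF assms] by (simp add: bij_is_surj)

lemma conj_by_automorphism:
  assumes t: "alg_hom cst2 cst2 \<tau>" "bij \<tau>" and s: "alg_hom cst2 cst2 \<sigma>"
    and "rational_quotient (range (inv_into UNIV \<tau> \<circ> \<sigma>))"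
  shows "rational_quotient (range \<sigma>)"
proof -
  have "\<tau> ` range (inv_into UNIV \<tau> \<circ> \<sigma>) = range \<sigma>"
    using surj_f_inv_f[OF bij_is_surj[OF t(2)]] by (auto simp: image_iff)
  then show ?thesis using rational_quotient_image[OF assms(4) t] by simp
qed

text \<open>The element \<open>x (\<sigma> x)\<close> is invariant. If \<open>\<alpha> \<noteq> 0\<close>, it is constant, so that
\<open>x\<close> lies in the range of \<open>\<sigma>\<close>, and by the incidence relation also \<open>y\<close>. If
\<open>\<alpha> = 0\<close>, then \<open>\<sigma> x\<close> itself is invariant, hence of the form
\<open>G(x)\<close>, and the incidence relation gives \<open>- \<sigma> y = y + x G(x)\<close>.\<close>

lemma quotient_of_J12:
  assumes D: "derivation cst2 D" "D xK = cst2 \<alpha> * xK" "D yK = 1"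
    and s: "alg_hom cst2 cst2 \<sigma>" "D (\<sigma> xK) = - cst2 \<alpha> * \<sigma> xK" "D (\<sigma> yK) = - 1" "xK * \<sigma> xK + yK + \<sigma> yK = 0"
    and ns: "range \<sigma> \<noteq> UNIV"
  shows "rational_quotient (range \<sigma>)"
proof -
  note d = derivationD[OF D(1)]
  note sub = subfieldCD[OF subfieldC_range[OF s(1)]]
  have mem: "\<sigma> xK \<in> range \<sigma>" "\<sigma> yK \<in> range \<sigma>" by simp_all
  have sx: "\<sigma> xK \<noteq> 0" using field_hom_eq_0_iff[OF alg_homD(1)[OF s(1)]] nonconstant_generators(3) by simp
  have rel: "yK = - \<sigma> yK - xK * \<sigma> xK" using s(4) by (simp add: eq_neg_iff_add_eq_0 algebra_simps)
  have inv: "D (xK * \<sigma> xK) = 0" by (simp add: d(2) D(2) s(2))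
  show ?thesis
  proof (cases "\<alpha> = 0")
    case False
    then obtain c where c: "xK * \<sigma> xK = cst2 c" using invariants_constant_additive[OF D False inv] by blast
    have "xK = cst2 c / \<sigma> xK" unfolding c[symmetric] using sx by simp
    then have "xK \<in> range \<sigma>" using sub(7)[OF sub(1) mem(1)] by metis
    moreover have "yK \<in> range \<sigma>" by (subst rel) (intro sub(6) sub(4) sub(3) mem calculation)
    ultimately have "range \<sigma> = UNIV" using s(1) by (intro range_UNIVI)
    then show ?thesis using ns by simp
  next
    case True
    have "D yK = cst2 0 * yK + cst2 1" by (simp add: D(3) cst2_field)
    moreover have "D xK = 0" "D (\<sigma> xK) = 0" using D(2) s(2) True by (simp_all add: cst2_field)
    ultimately have "\<sigma> xK \<in> range emb" using invariants_in_emb[OF D(1), of 0 1 "\<sigma> xK"] by simp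
    then obtain G where G: "\<sigma> xK = emb G" by blast
    have "G \<notin> range cst1"
    proof
      assume "G \<in> range cst1"
      then have "\<sigma> xK \<in> range cst2" using G emb_cst1 by auto
      then have "xK \<in> range cst2" using hom_reflects_constants[OF s(1)] by blast
      then show False using nonconstant_generators(1) by auto
    qed
    moreover have e: "emb 1 * yK + emb (tK * G) = - \<sigma> yK"
    proof -
      interpret e: field_hom emb by (rule field_hom_emb)
      show ?thesis by (subst rel) (simp add: e.hom_mult e.hom_one emb(3) G)
    qed
    moreover have "- \<sigma> yK \<in> range \<sigma>" using sub(4)[OF mem(2)] .
    moreover have "\<sigma> xK \<in> M \<and> \<sigma> yK \<in> M" if M: "subfieldC cst2 M" "emb G \<in> M" "- \<sigma> yK \<in> M" for M
      using M(2) G subfieldCD(4)[OF M(1) M(3)] by simp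
    ultimately show ?thesis using s(1) mem(1) G by (intro rational_quotientI[of \<sigma> G 1 "tK * G"]) simp_all
  qed
qed

lemma two_K: "(2 :: complex poly poly fract) = cst2 2" "(2 :: complex poly fract) = cst1 2"
proof -
  interpret c: comm_ring_hom cst2 by (rule comm_ring_hom_cst2)
  interpret d: comm_ring_hom cst1 by (rule comm_ring_hom_cst1)
  show "(2 :: complex poly poly fract) = cst2 2" using c.hom_add[of 1 1] by (simp add: c.hom_one)
  show "(2 :: complex poly fract) = cst1 2" using d.hom_add[of 1 1] by (simp add: d.hom_one)
qed

text \<open>In the coordinates \<open>t = x - y\<^sup>2/2\<close> and \<open>y\<close> the field becomes
\<open>\<partial>\<^sub>y\<close>, with invariants \<open>C(t)\<close>. The invariant \<open>y + \<sigma> x\<close> is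
some \<open>c(t)\<close>, and the incidence relation turns \<open>(\<sigma> x)\<^sup>2/2 - \<sigma> y\<close> into
\<open>t + c(t)\<^sup>2/2\<close>.\<close>

lemma quotient_of_J3:
  assumes D: "derivation cst2 D" "D xK = yK" "D yK = 1"
    and s: "alg_hom cst2 cst2 \<sigma>" "D (\<sigma> xK) = - 1" "D (\<sigma> yK) = - \<sigma> xK" "xK + yK * \<sigma> xK + \<sigma> yK = 0"
  shows "rational_quotient (range \<sigma>)"
proof -
  have dom: "P2.dominant (vector [xK - yK ^ 2 / 2, yK, 1])"
  proof (rule dominant_pairI[of 1])
    fix u v :: complex
    define a where "a = u + v ^ 2 / 2"
    have hx: "has_value xK a v a" unfolding xK_def using has_value_to_fract[of polyX a v] by simp
    have hy: "has_value yK a v v" unfolding yK_def using has_value_to_fract[of polyY a v] by simp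
    have "has_value (yK ^ 2) a v (v ^ 2)" unfolding power2_eq_square by (rule has_value_mult[OF hy hy])
    then have "has_value (yK ^ 2 * cst2 (- 1 / 2)) a v (v ^ 2 * (- 1 / 2))" using has_value_cst by (rule has_value_mult)
    with hx have "has_value (xK + yK ^ 2 * cst2 (- 1 / 2)) a v (a + v ^ 2 * (- 1 / 2))" by (rule has_value_add)
    then have "has_value (xK + yK ^ 2 * cst2 (- 1 / 2)) a v u" by (simp add: a_def)
    moreover have eq: "xK - yK ^ 2 / 2 = xK + yK ^ 2 * cst2 (- 1 / 2)"
    proof -
      have "cst2 (- 1 / 2) * 2 = - 1" unfolding two_K cst2_field(3)[symmetric] by (simp add: cst2_field)
      then have "cst2 (- 1 / 2) = (- 1) / 2" by (subst nonzero_eq_divide_eq) simp_all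
      then show ?thesis by simp
    qed
    ultimately show "\<exists>a b. has_value (xK - yK ^ 2 / 2) a b u \<and> has_value yK a b v"
      using hy unfolding eq by blast
  qed simp
  define \<tau> where "\<tau> = subst2 (xK - yK ^ 2 / 2) yK"
  have t: "alg_hom cst2 cst2 \<tau>" "\<tau> xK = xK - yK ^ 2 / 2" "\<tau> yK = yK"
    unfolding \<tau>_def using subst2[OF dom] by simp_all
  interpret t: field_hom \<tau> using t(1) by (rule alg_homD)
  have t2: "\<tau> 2 = 2" using alg_homD(2)[OF t(1), of 2] by (simp add: two_K)
  have tx: "\<tau> (xK + yK ^ 2 / 2) = xK" by (simp add: t.hom_add t.hom_div t.hom_power t2 t(2,3))
  have bij: "bij \<tau>"
    using tx t(3) by (intro alg_hom_bijI t(1)) (metis rangeI)+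
  define \<tau>' where "\<tau>' = inv_into UNIV \<tau>"
  have t': "alg_hom cst2 cst2 \<tau>'" unfolding \<tau>'_def using t(1) bij by (rule alg_hom_inv)
  have inv: "\<tau>' (\<tau> f) = f" for f unfolding \<tau>'_def using bij by (simp add: bij_is_inj)
  interpret t': field_hom \<tau>' using t' by (rule alg_homD)
  define D' where "D' = \<tau>' \<circ> D \<circ> \<tau>"
  have D': "derivation cst2 D'" unfolding D'_def \<tau>'_def using D(1) t(1) bij by (rule derivation_conj)
  note d = derivationD[OF D(1)] and d' = derivationD[OF D']
  have "D 2 = 0" using d(3)[of 2] by (simp add: two_K)
  then have D2: "D (yK ^ 2 / 2) = yK" by (simp add: d(2,8) D(3) power2_eq_square)
  have D'x: "D' xK = 0" by (simp add: D'_def t(2) d(7) D(2) D2)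
  have D'y: "D' yK = cst2 0 * yK + cst2 1" by (simp add: D'_def t(3) D(3) cst2_field)
  define q r where "q = \<tau>' (\<sigma> xK)" and "r = \<tau>' (\<sigma> yK)"
  have tt: "\<tau> (\<tau>' f) = f" for f unfolding \<tau>'_def using bij by (simp add: surj_f_inv_f bij_is_surj)
  have D'q: "D' q = - 1" by (simp add: D'_def q_def tt s(2) t'.hom_uminus)
  have "\<tau>' (xK + yK * \<sigma> xK + \<sigma> yK) = 0" using s(4) by simp
  moreover have "\<tau>' xK = xK + yK ^ 2 / 2" "\<tau>' yK = yK" using inv[of "xK + yK ^ 2 / 2"] inv[of yK] tx t(3) by simp_all
  ultimately have rel: "xK + yK ^ 2 / 2 + yK * q + r = 0" by (simp add: q_def r_def t'.hom_add t'.hom_mult)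
  have "D' (q + yK) = 0" using D'y by (simp add: d'(1) D'q cst2_field)
  then have "q + yK \<in> range emb" using invariants_in_emb[OF D' D'x D'y, of "q + yK"] by simp
  then obtain c where c: "q + yK = emb c" by blast
  define \<sigma>' where "\<sigma>' = \<tau>' \<circ> \<sigma>"
  have s': "alg_hom cst2 cst2 \<sigma>'" unfolding \<sigma>'_def using s(1) t' by (rule alg_hom_comp)
  have qr: "\<sigma>' xK = q" "\<sigma>' yK = r" by (simp_all add: \<sigma>'_def q_def r_def)
  define G where "G = tK + c ^ 2 / 2"
  interpret e: field_hom emb by (rule field_hom_emb)
  have e2: "emb 2 = 2" using emb_cst1[of 2] by (simp add: two_K)
  have q: "q = emb c - yK" using c by (simp add: eq_diff_eq)
  have r: "r = - xK - yK ^ 2 / 2 - yK * q" using rel by (simp add: eq_neg_iff_add_eq_0 algebra_simps)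
  have G': "emb G = q ^ 2 / 2 - r"
  proof -
    have "emb G = xK + emb c ^ 2 / 2" by (simp add: G_def e.hom_add e.hom_div e.hom_power e2 emb(3))
    moreover have "q ^ 2 / 2 - r = xK + emb c ^ 2 / 2" unfolding r q by (simp add: power2_eq_square field_simps)
    ultimately show ?thesis by simp
  qed
  have ym: "emb (- 1) * yK + emb c = q" by (simp add: q e.hom_uminus e.hom_one)
  note sub = subfieldCD[OF subfieldC_range[OF s']]
  have memqr: "q \<in> range \<sigma>'" "r \<in> range \<sigma>'" using qr by (metis rangeI)+
  have two: "2 \<in> M" if "subfieldC cst2 M" for M using subfieldCD(1)[OF that, of 2] by (simp add: two_K)
  have "rational_quotient (range \<sigma>')"
  proof (rule rational_quotientI[of \<sigma>' G "- 1" c])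
    show "emb G \<in> range \<sigma>'" unfolding G' power2_eq_square
      by (intro sub(6) sub(7) sub(3) memqr two subfieldC_range[OF s'])
    show "emb (- 1) * yK + emb c \<in> range \<sigma>'" unfolding ym by (rule memqr)
    show "\<sigma>' xK \<in> M \<and> \<sigma>' yK \<in> M" if M: "subfieldC cst2 M" "emb G \<in> M" "emb (- 1) * yK + emb c \<in> M" for M
    proof -
      have qM: "q \<in> M" using M(3) unfolding ym .
      have "r = q * q / 2 - emb G" unfolding G' by (simp add: power2_eq_square)
      also have "\<dots> \<in> M" by (intro subfieldCD(6,7,3)[OF M(1)] qM two[OF M(1)] M(2))
      finally show ?thesis using qM unfolding qr by blast
    qed
    show "G \<notin> range cst1"
    proof
      assume "G \<in> range cst1"
      then have "emb G \<in> range cst2" using emb_cst1 by auto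
      moreover interpret s': field_hom \<sigma>' using s' by (rule alg_homD)
      have s2: "\<sigma>' 2 = 2" using alg_homD(2)[OF s', of 2] by (simp add: two_K)
      have "\<sigma>' (xK ^ 2 / 2 - yK) = emb G" by (simp add: s'.hom_minus s'.hom_div s'.hom_power s2 qr G')
      ultimately have "xK ^ 2 / 2 - yK \<in> range cst2" using hom_reflects_constants[OF s'] by metis
      then obtain k where "xK ^ 2 / 2 - yK = cst2 k" by blast
      then have "xK * xK - cst2 2 * yK = cst2 (2 * k)" by (simp add: power2_eq_square two_K(1)[symmetric] cst2_field(3) field_simps)
      then have "to_fract (polyX * polyX - [:[:2:]:] * polyY) = to_fract [:[:2 * k:]:]" unfolding xK_def yK_def cst2_def by (simp only: to_fract_diff to_fract_mult)
      then have "polyX * polyX - [:[:2:]:] * polyY = [:[:2 * k:]:]" by (simp only: to_fract_eq_iff)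
      then show False by (simp add: one_pCons)
    qed
  qed (use s' in simp_all)
  then show ?thesis using conj_by_automorphism[OF t(1) bij s(1)] unfolding \<sigma>'_def \<tau>'_def by blast
qed

lemma monomial_power_int:
  fixes a b :: "'k::field" assumes "a \<noteq> 0" "b \<noteq> 0"
  shows "(a powi i * b powi j) powi m * (a powi i' * b powi j') powi m' = a powi (i * m + i' * m') * b powi (j * m + j' * m')"
  using assms by (simp add: power_int_mult_distrib power_int_mult power_int_add)

lemma hom_power_int: "field_hom \<sigma> \<Longrightarrow> \<sigma> (a powi n) = \<sigma> a powi n"
proof -
  assume "field_hom \<sigma>"
  then interpret s: field_hom \<sigma> .
  show ?thesis by (simp add: power_int_def s.hom_power s.hom_inverse)
qed

lemma has_value_power_int:
  assumes "has_value f a b c" "c \<noteq> 0" shows "has_value (f powi n) a b (c powi n)"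
proof -
  have pow: "has_value (g ^ m) a b (e ^ m)" if g: "has_value g a b e" for g e m
  proof (induction m)
    case 0
    show ?case using has_value_cst[of 1 a b] by (simp add: cst2_field)
  next
    case (Suc m)
    show ?case unfolding power_Suc by (rule has_value_mult[OF g Suc.IH])
  qed
  show ?thesis unfolding power_int_def using pow[OF assms(1)] pow[OF has_value_inverse[OF assms]] by simp
qed

lemma derivation_power_int:
  assumes D: "derivation cst2 D" and a: "D a = w * a" "a \<noteq> 0"
  shows "D (a powi n) = of_int n * w * a powi n"
proof -
  note d = derivationD[OF D]
  have pow: "D (b ^ m) = of_nat m * v * b ^ m" if b: "D b = v * b" for b v m
    by (induction m) (simp_all add: d(2,5) b algebra_simps)
  have "D (inverse a) = - w * inverse a" using d(8)[of a 1] d(5) a by (simp add: divide_inverse)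
  then show ?thesis unfolding power_int_def using pow[OF a(1)] pow[of "inverse a" "- w"] by simp
qed

lemma cst2_of_int: "cst2 (of_int n) = of_int n"
proof -
  interpret c: comm_ring_hom cst2 by (rule comm_ring_hom_cst2)
  have nat: "cst2 (of_nat m) = of_nat m" for m by (induction m) (simp_all add: c.hom_add c.hom_one)
  show ?thesis by (cases n) (simp_all add: nat c.hom_minus c.hom_uminus c.hom_add c.hom_one del: of_nat_Suc)
qed

text \<open>A primitive relation \<open>(l, - k)\<close> completed to a unimodular matrix. The vector \<open>(u, v)\<close> cannot
be a relation as well, since otherwise both weights would vanish.\<close>

lemma integer_relation:
  fixes \<alpha> \<beta> :: complex
  assumes "\<alpha> * of_int i + \<beta> * of_int j = 0" "i \<noteq> 0 \<or> j \<noteq> 0" "\<alpha> \<noteq> 0 \<or> \<beta> \<noteq> 0"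
  obtains k l u v :: int where "l * v + k * u = 1" "\<alpha> * of_int l = \<beta> * of_int k" "\<alpha> * of_int u + \<beta> * of_int v \<noteq> 0"
proof -
  define g where "g = gcd i j"
  have g: "g \<noteq> 0" using assms(2) by (simp add: g_def)
  define l k where "l = i div g" and "k = - (j div g)"
  have ij: "i = g * l" "j = - g * k" by (simp_all add: l_def k_def g_def)
  obtain s t where "s * i + t * j = g" using bezout_int[of i j] unfolding g_def by blast
  then have "g * (l * s + k * (- t)) = g * 1" by (simp add: ij algebra_simps)
  then have bez: "l * s + k * (- t) = 1" using g by (subst (asm) mult_left_cancel)
  have "of_int g * (\<alpha> * of_int l - \<beta> * of_int k) = 0" using assms(1) by (simp add: ij algebra_simps)
  then have rel: "\<alpha> * of_int l = \<beta> * of_int k" using g by simp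
  define \<kappa> where "\<kappa> = \<alpha> * of_int (- t) + \<beta> * of_int s"
  have bezC: "of_int l * of_int s + of_int k * of_int (- t) = (1 :: complex)" using arg_cong[OF bez, of "of_int :: int \<Rightarrow> complex"] by simp
  have "\<alpha> = \<alpha> * (of_int l * of_int s + of_int k * of_int (- t))" unfolding bezC by simp
  also have "\<dots> = (\<alpha> * of_int l) * of_int s + \<alpha> * of_int k * of_int (- t)" by (simp add: algebra_simps)
  also have "\<dots> = of_int k * \<kappa>" unfolding rel \<kappa>_def by (simp add: algebra_simps)
  finally have a: "\<alpha> = of_int k * \<kappa>" .
  have "\<beta> = \<beta> * (of_int l * of_int s + of_int k * of_int (- t))" unfolding bezC by simp
  also have "\<dots> = (\<beta> * of_int k) * of_int (- t) + \<beta> * of_int l * of_int s" by (simp add: algebra_simps)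
  also have "\<dots> = of_int l * \<kappa>" unfolding rel[symmetric] \<kappa>_def by (simp add: algebra_simps)
  finally have b: "\<beta> = of_int l * \<kappa>" .
  have "\<kappa> \<noteq> 0" using a b assms(3) by auto
  then show thesis using that[OF bez rel] unfolding \<kappa>_def by blast
qed

text \<open>The exponents form a unimodular matrix, so that the monomial with the inverse exponents inverts the substitution.\<close>

lemma monomial_automorphism:
  fixes k l u v :: int
  assumes "l * v + k * u = 1"
  obtains \<tau> where "alg_hom cst2 cst2 \<tau>" "bij \<tau>" "\<tau> xK = xK powi l * yK powi (- k)" "\<tau> yK = xK powi u * yK powi v"
    "\<tau> (xK powi v * yK powi k) = xK" "\<tau> (xK powi (- u) * yK powi l) = yK"
proof -
  have e: "l * v + u * k = 1" "- k * v + v * k = 0" "l * (- u) + u * l = 0" "- k * (- u) + v * l = 1"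
    "v * l + k * u = 1" using assms by (simp_all add: algebra_simps)
  have dom: "P2.dominant (vector [xK powi l * yK powi (- k), xK powi u * yK powi v, 1])"
  proof (rule dominant_pairI[of "polyX * polyY"])
    fix s t :: complex assume "eval2 (polyX * polyY) s t \<noteq> 0"
    then have st: "s \<noteq> 0" "t \<noteq> 0" by auto
    define a b where "a = s powi v * t powi k" and "b = s powi (- u) * t powi l"
    have nz: "a \<noteq> 0" "b \<noteq> 0" using st by (simp_all add: a_def b_def)
    have x: "has_value xK a b a" unfolding xK_def using has_value_to_fract[of polyX a b] by simp
    have y: "has_value yK a b b" unfolding yK_def using has_value_to_fract[of polyY a b] by simp
    have "a powi l * b powi (- k) = s powi (v * l + - u * - k) * t powi (k * l + l * - k)"
      unfolding a_def b_def by (rule monomial_power_int[OF st])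
    also have "\<dots> = s" using e by (simp add: algebra_simps)
    finally have 1: "a powi l * b powi (- k) = s" .
    have "a powi u * b powi v = s powi (v * u + - u * v) * t powi (k * u + l * v)"
      unfolding a_def b_def by (rule monomial_power_int[OF st])
    also have "\<dots> = t" using assms by (simp add: algebra_simps)
    finally have 2: "a powi u * b powi v = t" .
    have "has_value (xK powi l * yK powi (- k)) a b s" "has_value (xK powi u * yK powi v) a b t"
      unfolding 1[symmetric] 2[symmetric] by (intro has_value_mult has_value_power_int x y nz)+
    then show "\<exists>a b. has_value (xK powi l * yK powi (- k)) a b s \<and> has_value (xK powi u * yK powi v) a b t" by blast
  qed simp
  define \<tau> where "\<tau> = subst2 (xK powi l * yK powi (- k)) (xK powi u * yK powi v)"
  have t: "alg_hom cst2 cst2 \<tau>" "\<tau> xK = xK powi l * yK powi (- k)" "\<tau> yK = xK powi u * yK powi v"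
    unfolding \<tau>_def using subst2[OF dom] by simp_all
  have th: "field_hom \<tau>" using t(1) by (rule alg_homD)
  interpret t: field_hom \<tau> by (rule th)
  have "\<tau> (xK powi v * yK powi k) = xK powi (l * v + u * k) * yK powi (- k * v + v * k)"
    unfolding t.hom_mult hom_power_int[OF th] t(2,3) by (rule monomial_power_int) (rule nonconstant_generators)+
  then have 1: "\<tau> (xK powi v * yK powi k) = xK" unfolding e by simp
  have "\<tau> (xK powi (- u) * yK powi l) = xK powi (l * (- u) + u * l) * yK powi (- k * (- u) + v * l)"
    unfolding t.hom_mult hom_power_int[OF th] t(2,3) by (rule monomial_power_int) (rule nonconstant_generators)+
  then have 2: "\<tau> (xK powi (- u) * yK powi l) = yK" unfolding e by simp
  have "bij \<tau>" using 1 2 by (intro alg_hom_bijI t(1)) (metis rangeI)+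
  then show thesis using that t 1 2 by blast
qed

text \<open>The element \<open>x (\<sigma> x)\<close> is invariant. If the weights \<open>\<alpha>, \<beta>\<close> are
independent over the integers, it is constant, and with the incidence relation so is \<open>y (\<sigma> y)\<close>;
hence \<open>x\<close> and \<open>y\<close> lie in the range of \<open>\<sigma>\<close>. Otherwise a monomial change
of coordinates makes the first weight zero. Then \<open>x (\<sigma> x) = f\<close> is a function of the first new
coordinate \<open>t\<close> alone, and so is \<open>y (\<sigma> y) = - 1 - f\<close>. Taking the same monomials of
\<open>\<sigma> x\<close> and \<open>\<sigma> y\<close> as of \<open>x\<close> and \<open>y\<close> yields two
generators of the range, a function \<open>G(t)\<close> and a function of \<open>t\<close> divided by the second new
coordinate.\<close>

lemma quotient_of_torus:
  assumes D: "derivation cst2 D" "D xK = cst2 \<alpha> * xK" "D yK = cst2 \<beta> * yK" and ab: "\<alpha> \<noteq> 0 \<or> \<beta> \<noteq> 0"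
    and s: "alg_hom cst2 cst2 \<sigma>" "D (\<sigma> xK) = - cst2 \<alpha> * \<sigma> xK" "D (\<sigma> yK) = - cst2 \<beta> * \<sigma> yK" "xK * \<sigma> xK + yK * \<sigma> yK + 1 = 0"
    and ns: "range \<sigma> \<noteq> UNIV"
  shows "rational_quotient (range \<sigma>)"
proof -
  note d = derivationD[OF D(1)]
  have snz: "\<sigma> xK \<noteq> 0" "\<sigma> yK \<noteq> 0"
    using field_hom_eq_0_iff[OF alg_homD(1)[OF s(1)]] nonconstant_generators(3,4) by simp_all
  have inv: "D (xK * \<sigma> xK) = 0" by (simp add: d(2) D(2) s(2))
  have rel: "yK * \<sigma> yK = - 1 - xK * \<sigma> xK" using s(4) by (simp add: eq_diff_eq eq_neg_iff_add_eq_0 algebra_simps)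
  show ?thesis
  proof (cases "\<forall>i j :: int. \<alpha> * of_int i + \<beta> * of_int j = 0 \<longrightarrow> i = 0 \<and> j = 0")
    case True
    note sub = subfieldCD[OF subfieldC_range[OF s(1)]]
    have "xK * \<sigma> xK \<in> range cst2" by (rule invariants_constant_torus[OF D _ inv]) (use True in blast)
    then obtain c where c: "xK * \<sigma> xK = cst2 c" by blast
    have "xK = cst2 c / \<sigma> xK" unfolding c[symmetric] using snz by simp
    then have "xK \<in> range \<sigma>" using sub(7)[OF sub(1) rangeI] by metis
    moreover have "yK = cst2 (- 1 + - c) / \<sigma> yK" unfolding cst2_field c[symmetric] using rel snz by (simp add: eq_divide_eq)
    then have "yK \<in> range \<sigma>" using sub(7)[OF sub(1) rangeI] by metis
    ultimately have "range \<sigma> = UNIV" using s(1) by (intro range_UNIVI)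
    then show ?thesis using ns by simp
  next
    case False
    then obtain i j :: int where "\<alpha> * of_int i + \<beta> * of_int j = 0" "i \<noteq> 0 \<or> j \<noteq> 0" by blast
    then obtain k l u v :: int where klu: "l * v + k * u = 1" "\<alpha> * of_int l = \<beta> * of_int k" "\<alpha> * of_int u + \<beta> * of_int v \<noteq> 0"
      using ab by (rule integer_relation)
    obtain \<tau> where t: "alg_hom cst2 cst2 \<tau>" "bij \<tau>" "\<tau> xK = xK powi l * yK powi (- k)" "\<tau> yK = xK powi u * yK powi v"
      "\<tau> (xK powi v * yK powi k) = xK" "\<tau> (xK powi (- u) * yK powi l) = yK"
      using klu(1) by (rule monomial_automorphism)
    define \<tau>' where "\<tau>' = inv_into UNIV \<tau>"
    have t': "alg_hom cst2 cst2 \<tau>'" unfolding \<tau>'_def using t(1,2) by (rule alg_hom_inv)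
    have tinv: "\<tau>' (\<tau> f) = f" "\<tau> (\<tau>' f) = f" for f unfolding \<tau>'_def using t(2) by (simp_all add: bij_is_inj surj_f_inv_f bij_is_surj)
    interpret t': field_hom \<tau>' using t' by (rule alg_homD)
    define D' where "D' = \<tau>' \<circ> D \<circ> \<tau>"
    have D': "derivation cst2 D'" unfolding D'_def \<tau>'_def using D(1) t(1,2) by (rule derivation_conj)
    have mono: "D (xK powi i * yK powi j) = cst2 (\<alpha> * of_int i + \<beta> * of_int j) * (xK powi i * yK powi j)" for i j
      by (simp add: d(2) derivation_power_int[OF D(1) D(2)] derivation_power_int[OF D(1) D(3)] nonconstant_generators
          cst2_field cst2_of_int algebra_simps)
    have "D' xK = \<tau>' (cst2 (\<alpha> * of_int l + \<beta> * of_int (- k)) * \<tau> xK)" unfolding D'_def o_def t(3) mono ..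
    also have "\<alpha> * of_int l + \<beta> * of_int (- k) = 0" using klu(2) by simp
    finally have D'x: "D' xK = 0" by simp
    define \<kappa> where "\<kappa> = \<alpha> * of_int u + \<beta> * of_int v"
    have "D' yK = \<tau>' (cst2 \<kappa> * \<tau> yK)" unfolding D'_def o_def t(4) mono \<kappa>_def ..
    then have D'y: "D' yK = cst2 \<kappa> * yK + cst2 0" by (simp add: t'.hom_mult tinv alg_homD(2)[OF t'])
    define p q where "p = \<tau>' (\<sigma> xK)" and "q = \<tau>' (\<sigma> yK)"
    have pq0: "p \<noteq> 0" "q \<noteq> 0" unfolding p_def q_def using snz field_hom_eq_0_iff[OF alg_homD(1)[OF t']] by simp_all
    define X Y where "X = xK powi v * yK powi k" and "Y = xK powi (- u) * yK powi l"
    have XY: "\<tau>' xK = X" "\<tau>' yK = Y" using tinv(1)[of X] tinv(1)[of Y] t(5,6) by (simp_all add: X_def Y_def)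
    have XY0: "X \<noteq> 0" "Y \<noteq> 0" by (simp_all add: X_def Y_def nonconstant_generators)
    have "D' (X * p) = \<tau>' (D (xK * \<sigma> xK))" by (simp add: D'_def p_def flip: XY t'.hom_mult) (simp add: tinv)
    then have "D' (X * p) = 0" by (simp add: inv)
    then have "X * p \<in> range emb" using invariants_in_emb[OF D' D'x D'y, of "X * p"] klu(3) by (simp add: \<kappa>_def)
    then obtain f where f: "X * p = emb f" by blast
    interpret e: field_hom emb by (rule field_hom_emb)
    have "\<tau>' (yK * \<sigma> yK) = \<tau>' (- 1 - xK * \<sigma> xK)" unfolding rel ..
    then have "Y * q = - 1 - X * p" by (simp add: t'.hom_mult t'.hom_minus t'.hom_uminus t'.hom_one XY p_def q_def)
    then have g: "Y * q = emb (- 1 - f)" by (simp add: f e.hom_minus e.hom_uminus e.hom_one)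
    have fg0: "f \<noteq> 0" "- 1 - f \<noteq> 0" using f g XY0 pq0 emb_eq_0_iff by (metis mult_eq_0_iff)+
    have p: "p = emb f / X" and q: "q = emb (- 1 - f) / Y" using f g XY0 by (simp_all add: field_simps)
    have pow: "p powi i * q powi j = emb (f powi i * (- 1 - f) powi j) / (X powi i * Y powi j)" for i j
      unfolding p q by (simp add: power_int_divide_distrib e.hom_mult hom_power_int[OF field_hom_emb])
    have "X powi l * Y powi (- k) = xK powi (v * l + - u * - k) * yK powi (k * l + l * - k)"
      unfolding X_def Y_def by (rule monomial_power_int) (rule nonconstant_generators)+
    also have "\<dots> = xK" using klu(1) by (simp add: algebra_simps)
    finally have X1: "X powi l * Y powi (- k) = xK" .
    have "X powi u * Y powi v = xK powi (v * u + - u * v) * yK powi (k * u + l * v)"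
      unfolding X_def Y_def by (rule monomial_power_int) (rule nonconstant_generators)+
    also have "\<dots> = yK" using klu(1) by (simp add: algebra_simps)
    finally have X2: "X powi u * Y powi v = yK" .
    define G h where "G = f powi l * (- 1 - f) powi (- k) / tK" and "h = inverse (f powi u * (- 1 - f) powi v)"
    have h0: "h \<noteq> 0" using fg0 by (simp add: h_def)
    define \<sigma>' where "\<sigma>' = \<tau>' \<circ> \<sigma>"
    have s': "alg_hom cst2 cst2 \<sigma>'" unfolding \<sigma>'_def using s(1) t' by (rule alg_hom_comp)
    have pqs: "\<sigma>' xK = p" "\<sigma>' yK = q" by (simp_all add: \<sigma>'_def p_def q_def)
    \<comment> \<open>The first and second new coordinates, with \<open>p, q\<close> in place of \<open>x, y\<close>; they are invertible monomials in \<open>p\<close> and \<open>q\<close>.\<close>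
    define R S where "R = p powi l * q powi (- k)" and "S = p powi u * q powi v"
    have R: "emb G = R" unfolding R_def pow X1 G_def by (simp add: e.hom_div emb(3))
    have "S = inverse (emb h) * inverse yK" unfolding S_def pow X2 h_def e.hom_inverse
      by (simp only: inverse_inverse_eq divide_inverse)
    then have S: "emb h * yK + emb 0 = inverse S" by simp
    have RS: "R powi v * S powi k = p" "R powi (- u) * S powi l = q"
    proof -
      have "R powi v * S powi k = p powi (l * v + u * k) * q powi (- k * v + v * k)"
        unfolding R_def S_def by (rule monomial_power_int[OF pq0])
      also have "\<dots> = p" using klu(1) by (simp add: algebra_simps)
      finally show "R powi v * S powi k = p" .
      have "R powi (- u) * S powi l = p powi (l * (- u) + u * l) * q powi (- k * (- u) + v * l)"
        unfolding R_def S_def by (rule monomial_power_int[OF pq0])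
      also have "\<dots> = q" using klu(1) by (simp add: algebra_simps)
      finally show "R powi (- u) * S powi l = q" .
    qed
    have pi: "a powi n \<in> M" if "subfieldC cst2 M" "a \<in> M" for M a n
      using subfieldC_power_int[OF that(1) cst2_field(1) that(2)] .
    have "rational_quotient (range \<sigma>')"
    proof (rule rational_quotientI[OF s' _ h0])
      have memp: "p \<in> range \<sigma>'" "q \<in> range \<sigma>'" using pqs by (metis rangeI)+
      note M = subfieldC_range[OF s']
      show "emb G \<in> range \<sigma>'" unfolding R R_def by (intro subfieldCD(3)[OF M] pi[OF M] memp)
      show "emb h * yK + emb 0 \<in> range \<sigma>'" unfolding S S_def by (intro subfieldCD(5)[OF M] subfieldCD(3)[OF M] pi[OF M] memp)
      show "\<sigma>' xK \<in> M \<and> \<sigma>' yK \<in> M" if M: "subfieldC cst2 M" "emb G \<in> M" "emb h * yK + emb 0 \<in> M" for M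
      proof -
        have RM: "R \<in> M" using M(2) unfolding R .
        have SM: "S \<in> M" using subfieldCD(5)[OF M(1) M(3)] unfolding S by simp
        show ?thesis unfolding pqs RS(1)[symmetric] RS(2)[symmetric] using subfieldCD(3)[OF M(1)] pi[OF M(1)] RM SM by blast
      qed
      show "G \<notin> range cst1"
      proof
        assume "G \<in> range cst1"
        then have "R \<in> range cst2" using R emb_cst1 by auto
        moreover have "R = \<sigma>' (\<tau> xK)"
        proof -
          interpret s': field_hom \<sigma>' using s' by (rule alg_homD)
          show ?thesis unfolding t(3) s'.hom_mult hom_power_int[OF alg_homD(1)[OF s']] pqs R_def ..
        qed
        ultimately have "\<tau> xK \<in> range cst2" using hom_reflects_constants[OF s'] by metis
        then have "xK \<in> range cst2" by (rule hom_reflects_constants[OF t(1)])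
        then show False using nonconstant_generators(1) by auto
      qed
    qed
    then show ?thesis using conj_by_automorphism[OF t(1,2) s(1)] unfolding \<sigma>'_def \<tau>'_def by blast
  qed
qed

section \<open>Coordinates adapted to the vector field\<close>

definition mat_K :: "complex ^ 3 ^ 3 \<Rightarrow> complex poly poly fract ^ 3 ^ 3" where
  "mat_K B = (\<chi> i j. cst2 (B $ i $ j))"

lemma mat_K_mult: "mat_K (A ** B) = mat_K A ** mat_K B"
  by (simp add: mat_K_def vec_eq_iff matrix_matrix_mult_def sum_3 cst2_field)

lemma mat_K_one: "mat_K (mat 1) = mat 1"
  by (simp add: mat_K_def vec_eq_iff mat_def cst2_field)

lemma mat_K_transpose: "mat_K (transpose A) = transpose (mat_K A)"
  by (simp add: mat_K_def transpose_def)

lemma mat_K_gen: "(mat_K B *v gen2) $ i = to_fract (lin_poly B i)"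
proof -
  have "(mat_K B *v gen2) $ i = cst2 (B $ i $ 1) * xK + cst2 (B $ i $ 2) * yK + cst2 (B $ i $ 3)"
    by (simp add: mat_K_def matrix_vector_mult_def sum_3 gen2_comp)
  also have "\<dots> = to_fract (lin_poly B i)" unfolding lin_poly_def cst2_def xK_def yK_def by (simp only: to_fract_add to_fract_mult)
  finally show ?thesis .
qed

lemma lin_poly_nonzero:
  assumes "B ** C = mat 1" shows "lin_poly B i \<noteq> 0"
proof
  assume 0: "lin_poly B i = 0"
  have val: "B $ i $ 1 * a + B $ i $ 2 * b + B $ i $ 3 = 0" for a b
    using eval2_lin_poly[of B i a b] unfolding 0 by simp
  have "B $ i $ 3 = 0" "B $ i $ 1 = 0" "B $ i $ 2 = 0" using val[of 0 0] val[of 1 0] val[of 0 1] by simp_all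
  then have "(B ** C) $ i $ i = 0" by (simp add: matrix_matrix_mult_def sum_3)
  then show False unfolding assms by (simp add: mat_def)
qed

text \<open>The linear substitution is dominant because the point \<open>C (u, v, 1)\<^sup>T\<close> is mapped to \<open>(u,
v)\<close>, if its third coordinate is not zero. Applying \<open>C\<close> to the images of the coordinates also shows
that it is surjective on functions.\<close>

lemma projective_automorphism:
  assumes BC: "B ** C = mat 1" "C ** B = mat 1"
  obtains \<tau> where "alg_hom cst2 cst2 \<tau>" "bij \<tau>"
    "\<tau> xK = (mat_K B *v gen2) $ 1 / (mat_K B *v gen2) $ 3" "\<tau> yK = (mat_K B *v gen2) $ 2 / (mat_K B *v gen2) $ 3"
proof -
  define z where "z = mat_K B *v gen2"
  have z3: "z $ 3 \<noteq> 0" unfolding z_def mat_K_gen using lin_poly_nonzero[OF BC(1)] by simp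
  have dom: "P2.dominant (vector [z $ 1 / z $ 3, z $ 2 / z $ 3, 1])"
  proof (rule dominant_pairI[of "lin_poly C 3"])
    show "lin_poly C 3 \<noteq> 0" using BC(2) by (rule lin_poly_nonzero)
    fix u v :: complex assume nz: "eval2 (lin_poly C 3) u v \<noteq> 0"
    define w where "w = C *v vector [u, v, 1]"
    have w: "eval2 (lin_poly C i) u v = w $ i" for i
      by (simp add: eval2_lin_poly w_def matrix_vector_mult_def sum_3)
    define a b where "a = w $ 1 / w $ 3" and "b = w $ 2 / w $ 3"
    have w3: "w $ 3 \<noteq> 0" using nz w by simp
    have Bw: "B *v w = vector [u, v, 1]" unfolding w_def by (simp add: matrix_vector_mul_assoc BC(1))
    have val: "eval2 (lin_poly B i) a b = (vector [u, v, 1] :: complex ^ 3) $ i / w $ 3" for i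
    proof -
      have "eval2 (lin_poly B i) a b = (B *v w) $ i / w $ 3"
        using w3 by (simp add: eval2_lin_poly matrix_vector_mult_def sum_3 a_def b_def field_simps)
      then show ?thesis unfolding Bw .
    qed
    have d: "eval2 (lin_poly B 3) a b \<noteq> 0" using w3 by (simp add: val)
    have "has_value (z $ 1 / z $ 3) a b u" "has_value (z $ 2 / z $ 3) a b v"
      using has_valueI[OF d, of "lin_poly B 1"] has_valueI[OF d, of "lin_poly B 2"] w3 unfolding z_def mat_K_gen val by simp_all
    then show "\<exists>a b. has_value (z $ 1 / z $ 3) a b u \<and> has_value (z $ 2 / z $ 3) a b v" by blast
  qed
  define \<tau> where "\<tau> = subst2 (z $ 1 / z $ 3) (z $ 2 / z $ 3)"
  have t: "alg_hom cst2 cst2 \<tau>" "\<tau> xK = z $ 1 / z $ 3" "\<tau> yK = z $ 2 / z $ 3"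
    unfolding \<tau>_def using subst2[OF dom] by simp_all
  note sub = subfieldCD[OF subfieldC_range[OF t(1)]]
  have "mat_K C *v z = gen2" unfolding z_def by (simp add: matrix_vector_mul_assoc mat_K_mult[symmetric] BC(2) mat_K_one)
  then have Cz: "cst2 (C $ i $ 1) * z $ 1 + cst2 (C $ i $ 2) * z $ 2 + cst2 (C $ i $ 3) * z $ 3 = gen2 $ i" for i
    by (auto simp: mat_K_def matrix_vector_mult_def sum_3 vec_eq_iff)
  have "cst2 (C $ i $ 1) * \<tau> xK + cst2 (C $ i $ 2) * \<tau> yK + cst2 (C $ i $ 3) = gen2 $ i / z $ 3" for i
    unfolding t(2,3) Cz[symmetric] using z3 by (simp add: field_simps)
  moreover have "cst2 (C $ i $ 1) * \<tau> xK + cst2 (C $ i $ 2) * \<tau> yK + cst2 (C $ i $ 3) \<in> range \<tau>" for i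
    by (intro sub(2) sub(3) sub(1) rangeI)
  ultimately have g: "gen2 $ i / z $ 3 \<in> range \<tau>" for i by metis
  have "xK \<in> range \<tau>" "yK \<in> range \<tau>"
    using sub(7)[OF g[of 1] g[of 3]] sub(7)[OF g[of 2] g[of 3]] z3 by (simp_all add: gen2_comp)
  then have "bij \<tau>" using t(1) by (intro alg_hom_bijI)
  then show thesis using that t unfolding z_def by blast
qed

lemma map_poly_pderiv_mult: "map_poly pderiv (p * q) = p * map_poly pderiv q + q * map_poly pderiv (p :: complex poly poly)"
proof (rule poly_eqI)
  fix n
  have "coeff (map_poly pderiv (p * q)) n = (\<Sum>i\<le>n. coeff p i * pderiv (coeff q (n - i)) + coeff q (n - i) * pderiv (coeff p i))"
    by (simp add: coeff_map_poly coeff_mult pderiv_sum pderiv_mult)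
  also have "\<dots> = coeff (p * map_poly pderiv q + map_poly pderiv p * q) n"
    unfolding coeff_mult coeff_add sum.distrib
    by (intro arg_cong2[where f = "(+)"] sum.cong refl) (simp_all add: coeff_map_poly mult.commute)
  finally show "coeff (map_poly pderiv (p * q)) n = coeff (p * map_poly pderiv q + q * map_poly pderiv p) n" by (simp only: mult.commute)
qed

lemma proj_field_derivation:
  obtains D where "derivation cst2 D" "\<forall>p. D (to_fract p) = to_fract (proj_field A p)"
proof -
  have add: "proj_field A (p + q) = proj_field A p + proj_field A q" for p q
  proof -
    have "map_poly pderiv (p + q) = map_poly pderiv p + map_poly pderiv q"
      by (rule poly_eqI) (simp add: coeff_map_poly pderiv_add)
    then show ?thesis unfolding proj_field_def by (simp only: pderiv_add distrib_left add_ac)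
  qed
  have mult: "proj_field A (p * q) = p * proj_field A q + q * proj_field A p" for p q
    unfolding proj_field_def by (simp only: pderiv_mult map_poly_pderiv_mult distrib_left distrib_right mult_ac add_ac)
  obtain D where D: "\<And>a b. D (a + b) = D a + D b" "\<And>a b. D (a * b) = a * D b + b * D a" "\<And>p. D (to_fract p) = to_fract (proj_field A p)"
    using derivation_fract[of "proj_field A"] add mult by metis
  have "D (cst2 c) = 0" for c
    unfolding cst2_def D(3) by (simp add: proj_field_def Polynomial.map_poly_pCons)
  then have "derivation cst2 D" using D(1,2) by (simp add: derivation_def)
  then show thesis by (rule that) (simp add: D(3))
qed

lemma derivation_mat_K:
  assumes D: "derivation cst2 D"
  shows "D ((mat_K B *v u) $ i) = (mat_K B *v (\<chi> j. D (u $ j))) $ i"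
  by (simp add: mat_K_def matrix_vector_mult_def sum_3 derivationD[OF D])

text \<open>Conjugation by the change of coordinates \<open>\<tau>\<close> moves the derivation and the endomorphism to the new
chart, and the shape of the range is preserved.\<close>

lemma transport_to_chart:
  assumes t: "alg_hom cst2 cst2 \<tau>" "bij \<tau>" and s: "alg_hom cst2 cst2 \<sigma>" and D: "derivation cst2 D" and ns: "range \<sigma> \<noteq> UNIV"
    and cases: "\<And>D' \<sigma>'. derivation cst2 D' \<Longrightarrow> alg_hom cst2 cst2 \<sigma>' \<Longrightarrow> range \<sigma>' \<noteq> UNIV \<Longrightarrow>
      (\<And>f. \<tau> (D' f) = D (\<tau> f)) \<Longrightarrow> (\<And>f. \<tau> (\<sigma>' f) = \<sigma> f) \<Longrightarrow> rational_quotient (range \<sigma>')"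
  shows "rational_quotient (range \<sigma>)"
proof -
  define \<tau>' where "\<tau>' = inv_into UNIV \<tau>"
  have t': "alg_hom cst2 cst2 \<tau>'" unfolding \<tau>'_def using t by (rule alg_hom_inv)
  have inv: "\<tau> (\<tau>' f) = f" for f unfolding \<tau>'_def using t(2) by (simp add: surj_f_inv_f bij_is_surj)
  have "rational_quotient (range (\<tau>' \<circ> \<sigma>))"
  proof (rule cases)
    show "derivation cst2 (\<tau>' \<circ> D \<circ> \<tau>)" unfolding \<tau>'_def using D t by (rule derivation_conj)
    show "alg_hom cst2 cst2 (\<tau>' \<circ> \<sigma>)" using s t' by (rule alg_hom_comp)
    show "range (\<tau>' \<circ> \<sigma>) \<noteq> UNIV"
    proof
      assume U: "range (\<tau>' \<circ> \<sigma>) = UNIV"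
      have "f \<in> range \<sigma>" for f
      proof -
        have "\<tau>' f \<in> range (\<tau>' \<circ> \<sigma>)" unfolding U by simp
        then obtain g where "\<tau>' f = \<tau>' (\<sigma> g)" by auto
        then show ?thesis using inv by (metis rangeI)
      qed
      then show False using ns by blast
    qed
    show "\<tau> ((\<tau>' \<circ> D \<circ> \<tau>) f) = D (\<tau> f)" "\<tau> ((\<tau>' \<circ> \<sigma>) f) = \<sigma> f" for f by (simp_all add: inv)
  qed
  then show ?thesis using conj_by_automorphism[OF t s] unfolding \<tau>'_def by blast
qed

text \<open>A linear change of the coordinates of the target is an automorphism composed with the pullback, which has the same
range.\<close>

lemma endo_of_coordinates:
  assumes g: "alg_hom cst2 cst2 \<gamma>" "\<gamma> xK = n $ 1 / n $ 3" "\<gamma> yK = n $ 2 / n $ 3" "n $ 3 \<noteq> 0"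
    and BC: "B ** C = mat 1" "C ** B = mat 1"
  obtains \<sigma> where "alg_hom cst2 cst2 \<sigma>" "range \<sigma> = range \<gamma>" "(mat_K B *v n) $ 3 \<noteq> 0"
    "\<sigma> xK = (mat_K B *v n) $ 1 / (mat_K B *v n) $ 3" "\<sigma> yK = (mat_K B *v n) $ 2 / (mat_K B *v n) $ 3"
proof -
  obtain \<tau> where t: "alg_hom cst2 cst2 \<tau>" "bij \<tau>"
    "\<tau> xK = (mat_K B *v gen2) $ 1 / (mat_K B *v gen2) $ 3" "\<tau> yK = (mat_K B *v gen2) $ 2 / (mat_K B *v gen2) $ 3"
    using BC by (rule projective_automorphism)
  interpret g: field_hom \<gamma> using g(1) by (rule alg_homD)
  have gl: "\<gamma> ((mat_K B *v gen2) $ i) = (mat_K B *v n) $ i / n $ 3" for i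
    using g(4) by (simp add: mat_K_def matrix_vector_mult_def sum_3 gen2_comp g.hom_add g.hom_mult alg_homD(2)[OF g(1)] g(2,3) field_simps)
  have "(mat_K B *v gen2) $ 3 \<noteq> 0" unfolding mat_K_gen using lin_poly_nonzero[OF BC(1)] by simp
  then have "\<gamma> ((mat_K B *v gen2) $ 3) \<noteq> 0" using field_hom_eq_0_iff[OF alg_homD(1)[OF g(1)]] by blast
  then have nz: "(mat_K B *v n) $ 3 \<noteq> 0" unfolding gl by auto
  have "range (\<gamma> \<circ> \<tau>) = range \<gamma>" using t(2) by (metis bij_is_surj fun.set_map image_comp)
  moreover have "(\<gamma> \<circ> \<tau>) xK = (mat_K B *v n) $ 1 / (mat_K B *v n) $ 3" "(\<gamma> \<circ> \<tau>) yK = (mat_K B *v n) $ 2 / (mat_K B *v n) $ 3"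
    using g(4) nz by (simp_all add: t(3,4) g.hom_div gl)
  ultimately show thesis using that[of "\<gamma> \<circ> \<tau>"] alg_hom_comp[OF t(1) g(1)] nz by blast
qed

lemma gauss_vec_comp: "(gauss_vec P Q) $ i = to_fract (gauss_poly P Q i)"
  using exhaust_3[of i] by (auto simp del: to_fract_uminus to_fract_diff to_fract_mult)

text \<open>With \<open>A = h J g\<close> take \<open>z = g X\<close> and \<open>m = h\<^sup>T N\<close>. The equations for
\<open>D z\<close> and \<open>D m\<close> are \<open>D X = A X - (A X)\<^sub>3 X\<close> and the invariance \<open>D N
= \<nu> N - A\<^sup>T N\<close> in these coordinates, and \<open>z \<bullet> m = X \<bullet> N = 0\<close> because
\<open>g\<close> and \<open>h\<close> are inverse to each other. The last conclusion leaves the choice of affine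
coordinates on the dual plane open, since the coordinate that is an eigenvector depends on \<open>J\<close>.\<close>

lemma adapted_frame:
  assumes F: "coprime P Q" "foliation_degree P Q d" "d \<ge> 3" and A: "A \<in> lie_algebra (Aut_SL P Q)" and J: "similar3 A J"
  obtains D \<tau> z m \<mu> \<nu> where "derivation cst2 D" "alg_hom cst2 cst2 \<tau>" "bij \<tau>"
    "\<tau> xK = z $ 1 / z $ 3" "\<tau> yK = z $ 2 / z $ 3" "z $ 3 \<noteq> 0"
    "\<forall>i. D (z $ i) = (mat_K J *v z) $ i - \<mu> * z $ i"
    "\<forall>i. D (m $ i) = \<nu> * m $ i - (transpose (mat_K J) *v m) $ i"
    "z $ 1 * m $ 1 + z $ 2 * m $ 2 + z $ 3 * m $ 3 = 0"
    "\<forall>B C. B ** C = mat 1 \<and> C ** B = mat 1 \<longrightarrow>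
      (\<exists>\<sigma>. alg_hom cst2 cst2 \<sigma> \<and> range \<sigma> = range (P2.pullback (gauss_vec P Q)) \<and> (mat_K B *v m) $ 3 \<noteq> 0 \<and>
        \<sigma> xK = (mat_K B *v m) $ 1 / (mat_K B *v m) $ 3 \<and> \<sigma> yK = (mat_K B *v m) $ 2 / (mat_K B *v m) $ 3)"
proof -
  define n where "n = gauss_vec P Q"
  have ni: "n $ i = to_fract (gauss_poly P Q i)" for i unfolding n_def by (rule gauss_vec_comp)
  define \<gamma> where "\<gamma> = P2.pullback n"
  have dom: "P2.dominant n" unfolding n_def using F by (rule gauss_dominant)
  have g: "alg_hom cst2 cst2 \<gamma>" unfolding \<gamma>_def using dom by (rule R2.pullback_hom)
  have gx: "\<gamma> xK = n $ 1 / n $ 3" "\<gamma> yK = n $ 2 / n $ 3"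
    using R2.pullback_to_fract[OF dom, of polyX] R2.pullback_to_fract[OF dom, of polyY] by (simp_all add: \<gamma>_def xK_def yK_def ev2_X ev2_Y)
  have n3: "n $ 3 \<noteq> 0"
  proof
    assume "n $ 3 = 0"
    then have "\<gamma> xK = 0" using gx by simp
    then show False using field_hom_eq_0_iff[OF alg_homD(1)[OF g]] nonconstant_generators(3) by simp
  qed
  obtain D where D: "derivation cst2 D" "\<forall>p. D (to_fract p) = to_fract (proj_field A p)" by (rule proj_field_derivation)
  note D = D(1) D(2)[rule_format]
  define a where "a = mat_K A *v gen2"
  have ai: "a $ i = to_fract (lin_poly A i)" for i unfolding a_def by (rule mat_K_gen)
  have "D xK = a $ 1 - a $ 3 * xK" "D yK = a $ 2 - a $ 3 * yK"
  proof -
    have one: "map_poly pderiv (1 :: complex poly poly) = 0"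
      by (rule poly_eqI) (simp add: coeff_map_poly coeff_1 pderiv_1)
    have "proj_field A polyX = lin_poly A 1 - lin_poly A 3 * polyX" "proj_field A polyY = lin_poly A 2 - lin_poly A 3 * polyY"
      by (simp_all add: proj_field_def Polynomial.map_poly_pCons pderiv_pCons mult.commute one flip: one_pCons)
    then show "D xK = a $ 1 - a $ 3 * xK" "D yK = a $ 2 - a $ 3 * yK"
      unfolding xK_def yK_def D(2) ai by (simp_all only: to_fract_diff to_fract_mult)
  qed
  then have DX: "(\<chi> j. D (gen2 $ j)) = a - a $ 3 *s gen2"
    by (simp add: vec_eq_iff forall_3 gen2_comp derivationD[OF D(1)])
  define W where "W i = proj_field A (gauss_poly P Q i) + (\<Sum>k\<in>UNIV. [:[:A $ k $ i:]:] * gauss_poly P Q k)" for i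
  have W: "W i * gauss_poly P Q j = W j * gauss_poly P Q i" for i j unfolding W_def by (rule invariance_polynomial[OF A])
  define \<nu> where "\<nu> = to_fract (W 3) / n $ 3"
  have Wn: "to_fract (W i) = \<nu> * n $ i" for i
  proof -
    have "to_fract (W i) * n $ 3 = to_fract (W 3) * n $ i" unfolding ni to_fract_mult[symmetric] W[of i 3] ..
    then show ?thesis using n3 by (simp add: \<nu>_def field_simps)
  qed
  have "D (n $ i) = \<nu> * n $ i - (transpose (mat_K A) *v n) $ i" for i
  proof -
    have "to_fract (W i) = D (n $ i) + (\<Sum>k\<in>UNIV. cst2 (A $ k $ i) * n $ k)"
      unfolding W_def ni D(2) cst2_def by (simp only: to_fract_add to_fract_sum to_fract_mult)
    then show ?thesis using Wn[of i] by (simp add: transpose_def mat_K_def matrix_vector_mult_def)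
  qed
  then have Dn: "(\<chi> j. D (n $ j)) = \<nu> *s n - transpose (mat_K A) *v n"
    by (simp add: vec_eq_iff)
  obtain g0 h where gh: "g0 ** h = mat 1" "h ** g0 = mat 1" "A = h ** J ** g0"
    using J unfolding similar3_def by blast
  have gA: "g0 ** A = J ** g0" unfolding gh(3) by (simp add: matrix_mul_assoc gh(1))
  have Ah: "A ** h = h ** J" unfolding gh(3) by (simp add: matrix_mul_assoc[symmetric] gh(1))
  define z where "z = mat_K g0 *v gen2"
  define m where "m = transpose (mat_K h) *v n"
  obtain \<tau> where t: "alg_hom cst2 cst2 \<tau>" "bij \<tau>" "\<tau> xK = z $ 1 / z $ 3" "\<tau> yK = z $ 2 / z $ 3"
    unfolding z_def using gh(1,2) by (rule projective_automorphism)
  have z3: "z $ 3 \<noteq> 0" unfolding z_def mat_K_gen using lin_poly_nonzero[OF gh(1)] by simp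
  have Dz: "D (z $ i) = (mat_K J *v z) $ i - a $ 3 * z $ i" for i
  proof -
    have "D (z $ i) = (mat_K g0 *v (a - a $ 3 *s gen2)) $ i" unfolding z_def derivation_mat_K[OF D(1)] DX ..
    also have "mat_K g0 *v (a - a $ 3 *s gen2) = mat_K g0 *v a - a $ 3 *s z"
      unfolding z_def by (simp add: matrix_vector_mult_diff_distrib vector_scalar_commute)
    also have "mat_K g0 *v a = mat_K J *v z"
      unfolding a_def z_def matrix_vector_mul_assoc mat_K_mult[symmetric] gA ..
    finally show ?thesis by simp
  qed
  have Dm: "D (m $ i) = \<nu> * m $ i - (transpose (mat_K J) *v m) $ i" for i
  proof -
    have "D (m $ i) = (mat_K (transpose h) *v (\<nu> *s n - transpose (mat_K A) *v n)) $ i"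
      unfolding m_def mat_K_transpose[symmetric] derivation_mat_K[OF D(1)] Dn ..
    also have "mat_K (transpose h) *v (\<nu> *s n - transpose (mat_K A) *v n) =
        \<nu> *s m - mat_K (transpose h) *v (mat_K (transpose A) *v n)"
      unfolding m_def mat_K_transpose by (simp add: matrix_vector_mult_diff_distrib vector_scalar_commute)
    also have "mat_K (transpose h) *v (mat_K (transpose A) *v n) =
        mat_K (transpose (A ** h)) *v n"
      unfolding matrix_vector_mul_assoc mat_K_mult[symmetric] matrix_transpose_mul ..
    also have "\<dots> = transpose (mat_K J) *v m"
      unfolding Ah matrix_transpose_mul mat_K_mult m_def mat_K_transpose matrix_vector_mul_assoc ..
    finally show ?thesis by simp
  qed
  have "n $ 1 * xK + n $ 2 * yK + n $ 3 = 0"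
    unfolding ni xK_def yK_def gauss_poly_simps to_fract_mult[symmetric] to_fract_add[symmetric] by (simp add: algebra_simps)
  then have "n $ 1 * gen2 $ 1 + n $ 2 * gen2 $ 2 + n $ 3 * gen2 $ 3 = 0" by (simp add: gen2_comp)
  moreover have "gen2 = mat_K h *v z" unfolding z_def matrix_vector_mul_assoc mat_K_mult[symmetric] gh(2) mat_K_one by simp
  ultimately have "n $ 1 * (mat_K h *v z) $ 1 + n $ 2 * (mat_K h *v z) $ 2 + n $ 3 * (mat_K h *v z) $ 3 = 0" by simp
  then have rel: "z $ 1 * m $ 1 + z $ 2 * m $ 2 + z $ 3 * m $ 3 = 0"
    unfolding m_def by (simp add: matrix_vector_mult_def sum_3 transpose_def algebra_simps)
  have "\<exists>\<sigma>. alg_hom cst2 cst2 \<sigma> \<and> range \<sigma> = range \<gamma> \<and> (mat_K B *v m) $ 3 \<noteq> 0 \<and>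
        \<sigma> xK = (mat_K B *v m) $ 1 / (mat_K B *v m) $ 3 \<and> \<sigma> yK = (mat_K B *v m) $ 2 / (mat_K B *v m) $ 3"
    if BC: "B ** C = mat 1" "C ** B = mat 1" for B C
  proof -
    define B' C' where "B' = B ** transpose h" and "C' = transpose g0 ** C"
    have "B' ** C' = B ** (transpose h ** transpose g0) ** C"
      unfolding B'_def C'_def by (simp only: matrix_mul_assoc)
    also have "\<dots> = mat 1" unfolding matrix_transpose_mul[symmetric] gh(1) transpose_mat by (simp add: BC(1))
    finally have 1: "B' ** C' = mat 1" .
    have "C' ** B' = transpose g0 ** (C ** B) ** transpose h"
      unfolding B'_def C'_def by (simp only: matrix_mul_assoc)
    also have "\<dots> = transpose (h ** g0)" unfolding BC(2) by (simp add: matrix_transpose_mul)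
    also have "\<dots> = mat 1" unfolding gh(2) by (simp add: transpose_mat)
    finally have 2: "C' ** B' = mat 1" .
    have e: "mat_K B' *v n = mat_K B *v m" unfolding B'_def m_def mat_K_mult mat_K_transpose by (rule matrix_vector_mul_assoc[symmetric])
    show ?thesis using endo_of_coordinates[OF g gx n3 1 2] unfolding e by metis
  qed
  then show thesis using that[OF D(1) t z3] Dz Dm rel unfolding \<gamma>_def n_def by blast
qed

lemma cst2_diff: "cst2 (a - b) = cst2 a - cst2 b"
  using cst2_field(2)[of a "- b"] cst2_field(4)[of b] by simp

text \<open>Each Jordan form is reduced to its normal form above. The affine coordinates of the dual plane are chosen with the
eigenvector of the transposed matrix as denominator.\<close>

lemma gauss_rational_quotient:
  assumes F: "coprime P Q" "foliation_degree P Q d" "d \<ge> 3" and "has_continuous_automorphisms P Q"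
  shows "rational_quotient (range (P2.pullback (gauss_vec P Q)))"
proof -
  obtain A where A: "A \<in> lie_algebra (Aut_SL P Q)" "A \<noteq> 0"
    using assms(4) unfolding has_continuous_automorphisms_def by blast
  have ns: "range (P2.pullback (gauss_vec P Q)) \<noteq> UNIV" using gauss_dominant(2)[OF F] .
  consider (diag) a b c where "similar3 A (vector [vector [a, 0, 0], vector [0, b, 0], vector [0, 0, c]])"
    | (block) a b where "similar3 A (vector [vector [a, 0, 0], vector [0, b, 1], vector [0, 0, b]])"
    | (nilp) a where "similar3 A (vector [vector [a, 1, 0], vector [0, a, 1], vector [0, 0, a]])"
    by (rule jordan_form3)
  then show ?thesis
  proof cases
    case diag
    \<comment> \<open>A scalar matrix of trace zero is zero.\<close>
    have "a - c \<noteq> 0 \<or> b - c \<noteq> 0"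
    proof (rule ccontr)
      assume "\<not> ?thesis"
      then have abc: "a = c" "b = c" by auto
      obtain g h where gh: "g ** h = mat 1" "h ** g = mat 1"
        "A = h ** (vector [vector [a, 0, 0], vector [0, b, 0], vector [0, 0, c]] :: complex ^ 3 ^ 3) ** g"
        using diag unfolding similar3_def by blast
      have "(h ** (vector [vector [c, 0, 0], vector [0, c, 0], vector [0, 0, c]] :: complex ^ 3 ^ 3) ** g) $ i $ j = c * (h ** g) $ i $ j" for i j
        by (simp add: matrix_matrix_mult_def sum_3 algebra_simps)
      then have Aij: "A $ i $ j = (if i = j then c else 0)" for i j
        unfolding gh(3) abc gh(2) by (simp add: mat_def)
      then have "c = 0" using lie_algebra_trace[OF A(1)] by simp
      then have "A = 0" using Aij by (simp add: vec_eq_iff)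
      then show False using A(2) by simp
    qed
    note ne = this
    obtain D \<tau> z m \<mu> \<nu> where D: "derivation cst2 D" and t: "alg_hom cst2 cst2 \<tau>" "bij \<tau>"
      and tz: "\<tau> xK = z $ 1 / z $ 3" "\<tau> yK = z $ 2 / z $ 3" "z $ 3 \<noteq> 0"
      and Dz: "\<forall>i. D (z $ i) = (mat_K (vector [vector [a, 0, 0], vector [0, b, 0], vector [0, 0, c]]) *v z) $ i - \<mu> * z $ i"
      and Dm: "\<forall>i. D (m $ i) = \<nu> * m $ i - (transpose (mat_K (vector [vector [a, 0, 0], vector [0, b, 0], vector [0, 0, c]])) *v m) $ i"
      and rel: "z $ 1 * m $ 1 + z $ 2 * m $ 2 + z $ 3 * m $ 3 = 0"
      and ex: "\<forall>B C. B ** C = mat 1 \<and> C ** B = mat 1 \<longrightarrow>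
        (\<exists>\<sigma>. alg_hom cst2 cst2 \<sigma> \<and> range \<sigma> = range (P2.pullback (gauss_vec P Q)) \<and> (mat_K B *v m) $ 3 \<noteq> 0 \<and>
        \<sigma> xK = (mat_K B *v m) $ 1 / (mat_K B *v m) $ 3 \<and> \<sigma> yK = (mat_K B *v m) $ 2 / (mat_K B *v m) $ 3)"
      by (rule adapted_frame[OF F A(1) diag])
    have z: "D (z $ 1) = (cst2 a - \<mu>) * z $ 1" "D (z $ 2) = (cst2 b - \<mu>) * z $ 2" "D (z $ 3) = (cst2 c - \<mu>) * z $ 3"
      using Dz by (simp_all add: mat_K_def matrix_vector_mult_def sum_3 algebra_simps)
    have m: "D (m $ 1) = (\<nu> - cst2 a) * m $ 1" "D (m $ 2) = (\<nu> - cst2 b) * m $ 2" "D (m $ 3) = (\<nu> - cst2 c) * m $ 3"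
      using Dm[rule_format, of 1] Dm[rule_format, of 2] Dm[rule_format, of 3] by (simp_all add: mat_K_def matrix_vector_mult_def sum_3 transpose_def algebra_simps)
    have "\<exists>\<sigma>. alg_hom cst2 cst2 \<sigma> \<and> range \<sigma> = range (P2.pullback (gauss_vec P Q)) \<and> m $ 3 \<noteq> 0 \<and>
        \<sigma> xK = m $ 1 / m $ 3 \<and> \<sigma> yK = m $ 2 / m $ 3"
      using ex[rule_format, of "mat 1" "mat 1"] by (simp add: mat_K_one)
    then obtain \<sigma> where s: "alg_hom cst2 cst2 \<sigma>" "range \<sigma> = range (P2.pullback (gauss_vec P Q))" "m $ 3 \<noteq> 0"
      "\<sigma> xK = m $ 1 / m $ 3" "\<sigma> yK = m $ 2 / m $ 3" by blast
    have "rational_quotient (range \<sigma>)"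
    proof (rule transport_to_chart[OF t s(1) D ns[folded s(2)]])
      fix D' \<sigma>' assume *: "derivation cst2 D'" "alg_hom cst2 cst2 \<sigma>'" "range \<sigma>' \<noteq> UNIV"
        "\<And>f. \<tau> (D' f) = D (\<tau> f)" "\<And>f. \<tau> (\<sigma>' f) = \<sigma> f"
      interpret t: field_hom \<tau> using t(1) by (rule alg_homD)
      have inj: "\<tau> f = \<tau> g \<Longrightarrow> f = g" for f g using field_hom_eq_iff[OF alg_homD(1)[OF t(1)]] by simp
      note hom = t.hom_add t.hom_mult t.hom_uminus t.hom_one t.hom_zero alg_homD(2)[OF t(1)] *(4,5) tz(1,2) s(4,5)
      show "rational_quotient (range \<sigma>')"
      proof (rule quotient_of_torus[OF *(1) _ _ ne *(2) _ _ _ *(3)])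
        show "D' xK = cst2 (a - c) * xK" "D' yK = cst2 (b - c) * yK"
          by (rule inj, simp only: hom, simp only: derivationD(8)[OF D tz(3)] z cst2_diff, simp add: tz(3) field_simps)+
        show "D' (\<sigma>' xK) = - cst2 (a - c) * \<sigma>' xK" "D' (\<sigma>' yK) = - cst2 (b - c) * \<sigma>' yK"
          by (rule inj, simp only: hom, simp only: derivationD(8)[OF D s(3)] m cst2_diff, simp add: s(3) field_simps)+
        show "xK * \<sigma>' xK + yK * \<sigma>' yK + 1 = 0"
        proof (rule inj, unfold hom)
          have "z $ 1 / z $ 3 * (m $ 1 / m $ 3) + z $ 2 / z $ 3 * (m $ 2 / m $ 3) + 1 = (z $ 1 * m $ 1 + z $ 2 * m $ 2 + z $ 3 * m $ 3) / (z $ 3 * m $ 3)"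
            using s(3) tz(3) by (simp add: field_simps)
          then show "z $ 1 / z $ 3 * (m $ 1 / m $ 3) + z $ 2 / z $ 3 * (m $ 2 / m $ 3) + 1 = 0" unfolding rel by simp
        qed
      qed
    qed
    then show ?thesis unfolding s(2) .
  next
    case block
    obtain D \<tau> z m \<mu> \<nu> where D: "derivation cst2 D" and t: "alg_hom cst2 cst2 \<tau>" "bij \<tau>"
      and tz: "\<tau> xK = z $ 1 / z $ 3" "\<tau> yK = z $ 2 / z $ 3" "z $ 3 \<noteq> 0"
      and Dz: "\<forall>i. D (z $ i) = (mat_K (vector [vector [a, 0, 0], vector [0, b, 1], vector [0, 0, b]]) *v z) $ i - \<mu> * z $ i"
      and Dm: "\<forall>i. D (m $ i) = \<nu> * m $ i - (transpose (mat_K (vector [vector [a, 0, 0], vector [0, b, 1], vector [0, 0, b]])) *v m) $ i"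
      and rel: "z $ 1 * m $ 1 + z $ 2 * m $ 2 + z $ 3 * m $ 3 = 0"
      and ex: "\<forall>B C. B ** C = mat 1 \<and> C ** B = mat 1 \<longrightarrow>
        (\<exists>\<sigma>. alg_hom cst2 cst2 \<sigma> \<and> range \<sigma> = range (P2.pullback (gauss_vec P Q)) \<and> (mat_K B *v m) $ 3 \<noteq> 0 \<and>
        \<sigma> xK = (mat_K B *v m) $ 1 / (mat_K B *v m) $ 3 \<and> \<sigma> yK = (mat_K B *v m) $ 2 / (mat_K B *v m) $ 3)"
      by (rule adapted_frame[OF F A(1) block])
    have z: "D (z $ 1) = (cst2 a - \<mu>) * z $ 1" "D (z $ 2) = (cst2 b - \<mu>) * z $ 2 + z $ 3" "D (z $ 3) = (cst2 b - \<mu>) * z $ 3"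
      using Dz by (simp_all add: mat_K_def matrix_vector_mult_def sum_3 cst2_field(1) algebra_simps)
    have m: "D (m $ 1) = (\<nu> - cst2 a) * m $ 1" "D (m $ 2) = (\<nu> - cst2 b) * m $ 2" "D (m $ 3) = (\<nu> - cst2 b) * m $ 3 - m $ 2"
      using Dm[rule_format, of 1] Dm[rule_format, of 2] Dm[rule_format, of 3] by (simp_all add: mat_K_def matrix_vector_mult_def sum_3 transpose_def cst2_field(1) algebra_simps)
    \<comment> \<open>Exchanging the last two dual coordinates makes \<open>m\<^sub>2\<close>, the eigenvector of the block, the denominator.\<close>
    define B :: "complex ^ 3 ^ 3" where "B = vector [vector [1, 0, 0], vector [0, 0, 1], vector [0, 1, 0]]"
    have BB: "B ** B = mat 1"
      by (simp add: B_def vec_eq_iff forall_3 matrix_matrix_mult_def sum_3 mat_def)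
    have Bm: "(mat_K B *v m) $ 1 = m $ 1" "(mat_K B *v m) $ 2 = m $ 3" "(mat_K B *v m) $ 3 = m $ 2"
      by (simp_all add: B_def mat_K_def matrix_vector_mult_def sum_3 cst2_field(1))
    obtain \<sigma> where s: "alg_hom cst2 cst2 \<sigma>" "range \<sigma> = range (P2.pullback (gauss_vec P Q))" "m $ 2 \<noteq> 0"
      "\<sigma> xK = m $ 1 / m $ 2" "\<sigma> yK = m $ 3 / m $ 2"
      using ex[rule_format, of B B] BB unfolding Bm by blast
    have "rational_quotient (range \<sigma>)"
    proof (rule transport_to_chart[OF t s(1) D ns[folded s(2)]])
      fix D' \<sigma>' assume *: "derivation cst2 D'" "alg_hom cst2 cst2 \<sigma>'" "range \<sigma>' \<noteq> UNIV"
        "\<And>f. \<tau> (D' f) = D (\<tau> f)" "\<And>f. \<tau> (\<sigma>' f) = \<sigma> f"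
      interpret t: field_hom \<tau> using t(1) by (rule alg_homD)
      have inj: "\<tau> f = \<tau> g \<Longrightarrow> f = g" for f g using field_hom_eq_iff[OF alg_homD(1)[OF t(1)]] by simp
      note hom = t.hom_add t.hom_mult t.hom_uminus t.hom_one t.hom_zero alg_homD(2)[OF t(1)] *(4,5) tz(1,2) s(4,5)
      show "rational_quotient (range \<sigma>')"
      proof (rule quotient_of_J12[OF *(1) _ _ *(2) _ _ _ *(3)])
        show "D' xK = cst2 (a - b) * xK" "D' yK = 1"
          by (rule inj, simp only: hom, simp only: derivationD(8)[OF D tz(3)] z cst2_diff, simp add: tz(3) field_simps)+
        show "D' (\<sigma>' xK) = - cst2 (a - b) * \<sigma>' xK" "D' (\<sigma>' yK) = - 1"
          by (rule inj, simp only: hom, simp only: derivationD(8)[OF D s(3)] m cst2_diff, simp add: s(3) field_simps)+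
        show "xK * \<sigma>' xK + yK + \<sigma>' yK = 0"
        proof (rule inj, unfold hom)
          have "z $ 1 / z $ 3 * (m $ 1 / m $ 2) + z $ 2 / z $ 3 + m $ 3 / m $ 2 = (z $ 1 * m $ 1 + z $ 2 * m $ 2 + z $ 3 * m $ 3) / (z $ 3 * m $ 2)"
            using s(3) tz(3) by (simp add: field_simps)
          then show "z $ 1 / z $ 3 * (m $ 1 / m $ 2) + z $ 2 / z $ 3 + m $ 3 / m $ 2 = 0" unfolding rel by simp
        qed
      qed
    qed
    then show ?thesis unfolding s(2) .
  next
    case nilp
    obtain D \<tau> z m \<mu> \<nu> where D: "derivation cst2 D" and t: "alg_hom cst2 cst2 \<tau>" "bij \<tau>"
      and tz: "\<tau> xK = z $ 1 / z $ 3" "\<tau> yK = z $ 2 / z $ 3" "z $ 3 \<noteq> 0"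
      and Dz: "\<forall>i. D (z $ i) = (mat_K (vector [vector [a, 1, 0], vector [0, a, 1], vector [0, 0, a]]) *v z) $ i - \<mu> * z $ i"
      and Dm: "\<forall>i. D (m $ i) = \<nu> * m $ i - (transpose (mat_K (vector [vector [a, 1, 0], vector [0, a, 1], vector [0, 0, a]])) *v m) $ i"
      and rel: "z $ 1 * m $ 1 + z $ 2 * m $ 2 + z $ 3 * m $ 3 = 0"
      and ex: "\<forall>B C. B ** C = mat 1 \<and> C ** B = mat 1 \<longrightarrow>
        (\<exists>\<sigma>. alg_hom cst2 cst2 \<sigma> \<and> range \<sigma> = range (P2.pullback (gauss_vec P Q)) \<and> (mat_K B *v m) $ 3 \<noteq> 0 \<and>
        \<sigma> xK = (mat_K B *v m) $ 1 / (mat_K B *v m) $ 3 \<and> \<sigma> yK = (mat_K B *v m) $ 2 / (mat_K B *v m) $ 3)"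
      by (rule adapted_frame[OF F A(1) nilp])
    have z: "D (z $ 1) = (cst2 a - \<mu>) * z $ 1 + z $ 2" "D (z $ 2) = (cst2 a - \<mu>) * z $ 2 + z $ 3" "D (z $ 3) = (cst2 a - \<mu>) * z $ 3"
      using Dz by (simp_all add: mat_K_def matrix_vector_mult_def sum_3 cst2_field(1) algebra_simps)
    have m: "D (m $ 1) = (\<nu> - cst2 a) * m $ 1" "D (m $ 2) = (\<nu> - cst2 a) * m $ 2 - m $ 1" "D (m $ 3) = (\<nu> - cst2 a) * m $ 3 - m $ 2"
      using Dm[rule_format, of 1] Dm[rule_format, of 2] Dm[rule_format, of 3] by (simp_all add: mat_K_def matrix_vector_mult_def sum_3 transpose_def cst2_field(1) algebra_simps)
    \<comment> \<open>A cyclic permutation makes the eigenvector \<open>m\<^sub>1\<close> the denominator.\<close>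
    define B C :: "complex ^ 3 ^ 3" where "B = vector [vector [0, 1, 0], vector [0, 0, 1], vector [1, 0, 0]]"
      and "C = vector [vector [0, 0, 1], vector [1, 0, 0], vector [0, 1, 0]]"
    have BC: "B ** C = mat 1" "C ** B = mat 1"
      by (simp_all add: B_def C_def vec_eq_iff forall_3 matrix_matrix_mult_def sum_3 mat_def)
    have Bm: "(mat_K B *v m) $ 1 = m $ 2" "(mat_K B *v m) $ 2 = m $ 3" "(mat_K B *v m) $ 3 = m $ 1"
      by (simp_all add: B_def mat_K_def matrix_vector_mult_def sum_3 cst2_field(1))
    obtain \<sigma> where s: "alg_hom cst2 cst2 \<sigma>" "range \<sigma> = range (P2.pullback (gauss_vec P Q))" "m $ 1 \<noteq> 0"
      "\<sigma> xK = m $ 2 / m $ 1" "\<sigma> yK = m $ 3 / m $ 1"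
      using ex[rule_format, of B C] BC unfolding Bm by blast
    have "rational_quotient (range \<sigma>)"
    proof (rule transport_to_chart[OF t s(1) D ns[folded s(2)]])
      fix D' \<sigma>' assume *: "derivation cst2 D'" "alg_hom cst2 cst2 \<sigma>'" "range \<sigma>' \<noteq> UNIV"
        "\<And>f. \<tau> (D' f) = D (\<tau> f)" "\<And>f. \<tau> (\<sigma>' f) = \<sigma> f"
      interpret t: field_hom \<tau> using t(1) by (rule alg_homD)
      have inj: "\<tau> f = \<tau> g \<Longrightarrow> f = g" for f g using field_hom_eq_iff[OF alg_homD(1)[OF t(1)]] by simp
      note hom = t.hom_add t.hom_mult t.hom_uminus t.hom_one t.hom_zero alg_homD(2)[OF t(1)] *(4,5) tz(1,2) s(4,5)
      show "rational_quotient (range \<sigma>')"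
      proof (rule quotient_of_J3[OF *(1) _ _ *(2)])
        show "D' xK = yK" "D' yK = 1"
          by (rule inj, simp only: hom, simp only: derivationD(8)[OF D tz(3)] z, simp add: tz(3) field_simps)+
        show "D' (\<sigma>' xK) = - 1" "D' (\<sigma>' yK) = - \<sigma>' xK"
          by (rule inj, simp only: hom, simp only: derivationD(8)[OF D s(3)] m, simp add: s(3) field_simps)+
        show "xK + yK * \<sigma>' xK + \<sigma>' yK = 0"
        proof (rule inj, unfold hom)
          have "z $ 1 / z $ 3 + z $ 2 / z $ 3 * (m $ 2 / m $ 1) + m $ 3 / m $ 1 = (z $ 1 * m $ 1 + z $ 2 * m $ 2 + z $ 3 * m $ 3) / (z $ 3 * m $ 1)"
            using s(3) tz(3) by (simp add: field_simps)
          then show "z $ 1 / z $ 3 + z $ 2 / z $ 3 * (m $ 2 / m $ 1) + m $ 3 / m $ 1 = 0" unfolding rel by simp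
        qed
      qed
    qed
    then show ?thesis unfolding s(2) .
  qed
qed

section \<open>The associated morphism of the projective line\<close>

text \<open>An automorphism of the big field carries a range to a range, to which normality transfers in both directions.\<close>

lemma galois_ext_image:
  fixes \<tau> :: "'k::field_char_0 \<Rightarrow> 'k" and \<gamma> :: "'a::field_char_0 \<Rightarrow> 'k"
  assumes t: "field_hom \<tau>" "bij \<tau>" and g: "field_hom \<gamma>"
  shows "galois_ext (\<tau> ` range \<gamma>) \<longleftrightarrow> galois_ext (range \<gamma>)"
proof -
  have eq: "\<tau> ` range \<gamma> = range (\<tau> \<circ> \<gamma>)" by (simp add: image_comp)
  have "inv_into UNIV \<tau> ` \<tau> ` range \<gamma> = range \<gamma>" using t(2) by (simp add: image_comp bij_is_inj)
  then have "normal_ext (\<tau> ` range \<gamma>) \<longleftrightarrow> normal_ext (range \<gamma>)"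
    using normal_ext_image[OF t, of "range \<gamma>"] normal_ext_image[OF field_hom_inv[OF t] bij_imp_bij_inv[OF t(2)], of "\<tau> ` range \<gamma>"] by metis
  then show ?thesis
    using galois_ext_iff_normal_ext[OF g] galois_ext_iff_normal_ext[OF field_hom_comp[OF g t(1)]] unfolding eq by simp
qed

text \<open>The morphism is \<open>[G : 1]\<close> with \<open>G = \<gamma> x\<close>, in lowest terms \<open>[p : q]\<close>. It
is not constant since \<open>\<gamma>\<close> is injective and fixes the constants.\<close>

lemma morphism_of_endo:
  assumes g: "alg_hom cst1 cst1 \<gamma>"
  shows "nonconstant_morphism_P1 (proj_class (vector [\<gamma> tK, 1]))"
    "P1.dominant (vector [\<gamma> tK, 1])" "P1.pullback (vector [\<gamma> tK, 1]) = \<gamma>"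
proof -
  have 1: "(\<chi> i. \<gamma> (gen1 $ i)) = vector [\<gamma> tK, 1]"
  proof -
    interpret g: field_hom \<gamma> using g by (rule alg_homD)
    show ?thesis by (simp add: vec_eq_iff forall_2 gen1_def tK_def)
  qed
  show "P1.dominant (vector [\<gamma> tK, 1])" "P1.pullback (vector [\<gamma> tK, 1]) = \<gamma>"
    using R1.dominant_endo[OF g] unfolding 1 by simp_all
  define p q where "p = fst (quot_of_fract (\<gamma> tK))" and "q = snd (quot_of_fract (\<gamma> tK))"
  have pq: "\<gamma> tK = to_fract p / to_fract q" using Fract_quot_of_fract[of "\<gamma> tK"] by (simp add: p_def q_def Fract_conv_to_fract)
  have q: "q \<noteq> 0" unfolding q_def by (rule snd_quot_of_fract_nonzero)
  have co: "coprime p q" unfolding p_def q_def by (rule coprime_quot_of_fract)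
  have "\<not> (degree p = 0 \<and> degree q = 0)"
  proof
    assume "degree p = 0 \<and> degree q = 0"
    then obtain a b where ab: "p = [:a:]" "q = [:b:]" by (metis degree_eq_zeroE)
    interpret c: comm_ring_hom cst1 by (rule comm_ring_hom_cst1)
    have b: "b \<noteq> 0" using q ab by simp
    have "\<gamma> tK * cst1 b = cst1 a" using pq q unfolding ab by (simp add: cst1_def)
    then have "\<gamma> tK * cst1 b = cst1 (a / b) * cst1 b" using b by (simp add: c.hom_mult[symmetric])
    then have "\<gamma> tK = cst1 (a / b)" using b by (simp add: cst1_def)
    then have "tK \<in> range cst1" using hom_reflects_constants[OF g] by (metis rangeI)
    then show False by (auto simp: tK_def cst1_def)
  qed
  moreover have "proj_class (vector [\<gamma> tK, 1] :: complex poly fract ^ 2) = proj_class (vector [to_fract p, to_fract q])"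
  proof -
    have "(vector [to_fract p, to_fract q] :: complex poly fract ^ 2) = to_fract q *s vector [\<gamma> tK, 1]"
      using q by (simp add: vec_eq_iff forall_2 pq)
    then have "(vector [to_fract p, to_fract q] :: complex poly fract ^ 2) \<in> proj_class (vector [\<gamma> tK, 1])" using q unfolding proj_class_def by fastforce
    then show ?thesis using proj_class_eqI by blast
  qed
  ultimately show "nonconstant_morphism_P1 (proj_class (vector [\<gamma> tK, 1]))" unfolding nonconstant_morphism_P1_def using co by blast
qed

theorem proposition7p25:
  fixes P Q :: "complex poly poly" and d :: nat
  assumes "coprime P Q"
    and "foliation_degree P Q d" and "d \<ge> 3"
    and "has_continuous_automorphisms P Q"
  shows "\<exists>Ghat. nonconstant_morphism_P1 Ghat \<and>
           P2.Deck (gauss_map P Q) \<cong> P1.Deck Ghat \<and>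
           (P2.galois_map (gauss_map P Q) \<longleftrightarrow> P1.galois_map Ghat)"
proof -
  define M where "M = range (P2.pullback (gauss_vec P Q))"
  have dom: "P2.dominant (gauss_vec P Q)" using assms(1-3) by (rule gauss_dominant)
  have G: "gauss_map P Q = proj_class (gauss_vec P Q)" unfolding gauss_map_def ..
  obtain \<tau> \<gamma> where t: "alg_hom cst2 cst2 \<tau>" "bij \<tau>" and g: "alg_hom cst1 cst1 \<gamma>" and M: "M = \<tau> ` range (extend_endo \<gamma>)"
    using gauss_rational_quotient[OF assms] unfolding rational_quotient_def M_def by blast
  define w where "w = (vector [\<gamma> tK, 1] :: complex poly fract ^ 2)"
  note w = morphism_of_endo[OF g, folded w_def]
  have "Gal_group cst2 M \<cong> P2.Deck (gauss_map P Q)"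
    unfolding M_def G using dom by (rule R2.Deck_iso_Gal_group)
  then have "P2.Deck (gauss_map P Q) \<cong> Gal_group cst2 M" by (rule group.iso_sym[OF group_Gal_group])
  also have "Gal_group cst2 (range (extend_endo \<gamma>)) \<cong> Gal_group cst2 M" unfolding M using t by (rule Gal_group_image)
  then have "Gal_group cst2 M \<cong> Gal_group cst2 (range (extend_endo \<gamma>))" by (rule group.iso_sym[OF group_Gal_group])
  also have "Gal_group cst1 (range \<gamma>) \<cong> Gal_group cst2 (range (extend_endo \<gamma>))" using g by (rule Gal_group_extend)
  then have "Gal_group cst2 (range (extend_endo \<gamma>)) \<cong> Gal_group cst1 (range \<gamma>)" by (rule group.iso_sym[OF group_Gal_group])
  also have "Gal_group cst1 (range \<gamma>) \<cong> P1.Deck (proj_class w)"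
    using R1.Deck_iso_Gal_group[OF w(2)] unfolding w(3) .
  finally have "P2.Deck (gauss_map P Q) \<cong> P1.Deck (proj_class w)" .
  moreover have "P2.galois_map (gauss_map P Q) \<longleftrightarrow> P1.galois_map (proj_class w)"
  proof -
    have "P2.galois_map (gauss_map P Q) \<longleftrightarrow> galois_ext M" unfolding G R2.galois_map_iff M_def ..
    also have "\<dots> \<longleftrightarrow> galois_ext (range (extend_endo \<gamma>))" unfolding M using t(2) by (intro galois_ext_image alg_homD(1)[OF t(1)] alg_homD(1)[OF extend_endo(1)[OF g]])
    also have "\<dots> \<longleftrightarrow> galois_ext (range \<gamma>)" using g by (rule galois_ext_extend)
    also have "\<dots> \<longleftrightarrow> P1.galois_map (proj_class w)" unfolding R1.galois_map_iff w(3) ..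
    finally show ?thesis .
  qed
  ultimately show ?thesis using w(1) by blast
qed

end
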